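(* Let $F$ be an algebraically closed field of characteristic $0$ and let $A$ be a finite dimensional associative algebra over $F$ graded by an Abelian group $G$. Then $\mathrm{PIexp}^{\mathrm{gr}}(A)=\dim A$ if and only if $A$ is graded simple.
   Context: Associative algebras $A$ are not assumed unital. Let $A=\bigoplus_{g\in G}A^{(g)}$ be a $G$-graded algebra. $A$ is graded simple if $A^2\ne0$ and its only graded two-sided ideals are $0$ and $A$. Let $F\langle X^{\mathrm{gr}}\rangle$ be the free associative algebra on the variables $x_j^{(g)}$, $j\in\mathbb N$, $g\in G$. A polynomial $f\in F\langle X^{\mathrm{gr}}\rangle$ is a graded polynomial identity of $A$ if $f$ vanishes under every substitution $x_j^{(g)}\mapsto a_j^{(g)}$ with $a_j^{(g)}\in A^{(g)}$; the set of these is $\mathrm{Id}^{\mathrm{gr}}(A)$. For $n\in\mathbb N$ let $P_n^{\mathrm{gr}}$ be the linear span of all $x_{\sigma(1)}^{(g_1)}\cdots x_{\sigma(n)}^{(g_n)}$, $g_i\in G$, $\sigma\in S_n$, where $S_n$ is the $n$th symmetric group. Then $c_n^{\mathrm{gr}}(A):=\dim\bigl(P_n^{\mathrm{gr}}/(P_n^{\mathrm{gr}}\cap\mathrm{Id}^{\mathrm{gr}}(A))\bigr)$ and $\mathrm{PIexp}^{\mathrm{gr}}(A):=\lim_{n\to\infty}\sqrt[n]{c_n^{\mathrm{gr}}(A)}$.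
   Formalization: The algebra A is assumed nonzero: for A = 0 all graded codimensions with n ≥ 1 vanish, so PIexp^gr(A) = 0 = dim A although A is not graded simple. *)

theory Defs
  imports
    Complex_Main
    "HOL-Computational_Algebra.Polynomial"
    "HOL-Combinatorics.Permutations"
    "HOL-Library.Poly_Mapping"
begin

section \<open>Dimension of a quotient space\<close>

definition quotient_basis ::
    "('f::field \<Rightarrow> 'v::ab_group_add \<Rightarrow> 'v) \<Rightarrow> 'v set \<Rightarrow> 'v set \<Rightarrow> 'v set \<Rightarrow> bool" where
  \<comment> \<open>the residue classes of the elements of \<open>B\<close> are pairwise distinct and form a basis of \<open>V / W\<close>\<close>
  "quotient_basis scale V W B \<longleftrightarrow>
     B \<subseteq> V \<and>
     (\<forall>t u. finite t \<longrightarrow> t \<subseteq> B \<longrightarrow> (\<Sum>v\<in>t. scale (u v) v) \<in> W \<longrightarrow> (\<forall>v\<in>t. u v = 0)) \<and>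
     (\<forall>v\<in>V. \<exists>b\<in>module.span scale B. v - b \<in> W)"

definition quotient_dim ::
    "('f::field \<Rightarrow> 'v::ab_group_add \<Rightarrow> 'v) \<Rightarrow> 'v set \<Rightarrow> 'v set \<Rightarrow> nat" where
  \<comment> \<open>as for \<^const>\<open>vector_space.dim\<close>, the value is \<open>0\<close> if \<open>V / W\<close> is infinite-dimensional\<close>
  "quotient_dim scale V W = card (SOME B. quotient_basis scale V W B)"

lemma quotient_basis_zero:
  assumes "vector_space scale"
  shows "quotient_basis scale V {0} B \<longleftrightarrow>
    B \<subseteq> V \<and> \<not> module.dependent scale B \<and> V \<subseteq> module.span scale B"
proof -
  interpret vector_space scale by fact
  have "independent B \<longleftrightarrow>
      (\<forall>t u. finite t \<longrightarrow> t \<subseteq> B \<longrightarrow> (\<Sum>v\<in>t. scale (u v) v) = 0 \<longrightarrow> (\<forall>v\<in>t. u v = 0))"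
    unfolding dependent_explicit by blast
  then show ?thesis
    unfolding quotient_basis_def by (auto simp: subset_eq)
qed

lemma quotient_dim_zero:
  assumes "vector_space scale"
  shows "quotient_dim scale V {0} = vector_space.dim scale V"
proof -
  interpret vector_space scale by fact
  obtain B where "B \<subseteq> V" "independent B" "V \<subseteq> span B"
    using maximal_independent_subset by blast
  then have "quotient_basis scale V {0} B"
    by (simp add: quotient_basis_zero[OF assms])
  then have "quotient_basis scale V {0} (SOME B. quotient_basis scale V {0} B)"
    by (rule someI)
  then show ?thesis
    unfolding quotient_dim_def quotient_basis_zero[OF assms] by (auto intro: basis_card_eq_dim)
qed

section \<open>The free associative algebra\<close>

datatype 'x word = Word "'x list"

instantiation word :: (type) monoid_add
begin

definition zero_word :: "'a word" where
  "0 = Word []"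

fun plus_word :: "'a word \<Rightarrow> 'a word \<Rightarrow> 'a word" where
  "Word u + Word v = Word (u @ v)"

instance
proof
  fix a b c :: "'a word"
  show "a + b + c = a + (b + c)"
    by (cases a; cases b; cases c) simp
  show "0 + a = a" and "a + 0 = a"
    by (cases a; simp add: zero_word_def)+
qed

end

text \<open>
  By the convolution product of \<^type>\<open>poly_mapping\<close>, the type \<open>'x word \<Rightarrow>\<^sub>0 'f\<close> is the free
  associative algebra with unit. As algebras need not be unital here, the free algebra is the
  subset of the polynomials without constant term. The variable $x_j^{(g)}$ is the one-letter
  word \<open>(j, g)\<close>.
\<close>

type_synonym ('g, 'f) gr_poly = "(nat \<times> 'g) word \<Rightarrow>\<^sub>0 'f"

definition free_scale :: "'f \<Rightarrow> ('x word \<Rightarrow>\<^sub>0 'f) \<Rightarrow> ('x word \<Rightarrow>\<^sub>0 'f::field)" where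
  "free_scale c f = Poly_Mapping.single 0 c * f"

global_interpretation free_alg: vector_space "free_scale :: 'f::field \<Rightarrow> ('x word \<Rightarrow>\<^sub>0 'f) \<Rightarrow> _"
proof
  fix a b :: 'f and x y :: "'x word \<Rightarrow>\<^sub>0 'f"
  show "free_scale a (x + y) = free_scale a x + free_scale a y"
    by (simp add: free_scale_def distrib_left)
  show "free_scale (a + b) x = free_scale a x + free_scale b x"
    by (simp add: free_scale_def single_add distrib_right)
  show "free_scale a (free_scale b x) = free_scale (a * b) x"
    by (simp add: free_scale_def mult_single flip: mult.assoc)
  show "free_scale 1 x = x"
    by (simp add: free_scale_def)
qed

definition free_algebra :: "('x word \<Rightarrow>\<^sub>0 'f::field) set" where
  "free_algebra = {f. Poly_Mapping.lookup f 0 = 0}"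

definition var :: "nat \<Rightarrow> 'g \<Rightarrow> ('g, 'f::field) gr_poly" where
  "var j g = Poly_Mapping.single (Word [(j, g)]) 1"

definition multilinear :: "nat \<Rightarrow> ('g, 'f::field) gr_poly set" where
  "multilinear n =
     free_alg.span {(\<Prod>i\<leftarrow>[1..<Suc n]. var (\<sigma> i) (g i)) | \<sigma> g. \<sigma> permutes {1..n}}"

fun word_eval :: "('x \<Rightarrow> 'a) \<Rightarrow> 'x word \<Rightarrow> 'a::ring" where
  "word_eval \<phi> (Word []) = 0"  \<comment> \<open>irrelevant: does not occur in elements of \<^const>\<open>free_algebra\<close>\<close>
| "word_eval \<phi> (Word [x]) = \<phi> x"
| "word_eval \<phi> (Word (x # y # w)) = \<phi> x * word_eval \<phi> (Word (y # w))"

section \<open>Graded algebras\<close>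

definition homogeneous_decomposition ::
    "('g \<Rightarrow> 'a set) \<Rightarrow> ('g \<Rightarrow> 'a) \<Rightarrow> 'a::comm_monoid_add \<Rightarrow> bool" where
  "homogeneous_decomposition \<Gamma> d x \<longleftrightarrow>
     (\<forall>g. d g \<in> \<Gamma> g) \<and> finite {g. d g \<noteq> 0} \<and> x = (\<Sum>g | d g \<noteq> 0. d g)"

locale assoc_algebra = vector_space scale
  for scale :: "'f::field \<Rightarrow> 'a::ring \<Rightarrow> 'a" (infixr \<open>*s\<close> 75) +
  assumes scale_mult_left: "(c *s x) * y = c *s (x * y)"
    and scale_mult_right: "x * (c *s y) = c *s (x * y)"

locale graded_algebra = assoc_algebra scale
  for scale :: "'f::field \<Rightarrow> 'a::ring \<Rightarrow> 'a" (infixr \<open>*s\<close> 75) +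
  fixes \<Gamma> :: "'g::ab_group_add \<Rightarrow> 'a set"
  assumes subspace_component: "subspace (\<Gamma> g)"
    and direct_sum: "\<exists>!d. homogeneous_decomposition \<Gamma> d x"
    and component_mult: "x \<in> \<Gamma> g \<Longrightarrow> y \<in> \<Gamma> h \<Longrightarrow> x * y \<in> \<Gamma> (g + h)"
begin

definition graded_ideal :: "'a set \<Rightarrow> bool" where
  "graded_ideal I \<longleftrightarrow>
     subspace I \<and> (\<forall>x\<in>I. \<forall>a. a * x \<in> I \<and> x * a \<in> I) \<and>
     (\<forall>x\<in>I. \<exists>d. homogeneous_decomposition (\<lambda>g. \<Gamma> g \<inter> I) d x)"

definition graded_simple :: bool where
  "graded_simple \<longleftrightarrow>
     span {x * y | x y. True} \<noteq> {0} \<and> (\<forall>I. graded_ideal I \<longrightarrow> I = {0} \<or> I = UNIV)"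

text \<open>
  Substitution of elements of the algebra for the variables. On \<^const>\<open>free_algebra\<close> it is additive
  and multiplicative, and it extends \<open>\<phi>\<close>; see \<open>eval_poly_add\<close>, \<open>eval_poly_mult\<close>, \<open>eval_poly_var\<close>.
\<close>

definition eval_poly :: "(nat \<times> 'g \<Rightarrow> 'a) \<Rightarrow> ('g, 'f) gr_poly \<Rightarrow> 'a" where
  "eval_poly \<phi> f = (\<Sum>w\<in>Poly_Mapping.keys f. Poly_Mapping.lookup f w *s word_eval \<phi> w)"

lemma eval_poly_superset:
  assumes "finite S" "Poly_Mapping.keys f \<subseteq> S"
  shows "eval_poly \<phi> f = (\<Sum>w\<in>S. Poly_Mapping.lookup f w *s word_eval \<phi> w)"
  unfolding eval_poly_def using assms
  by (intro sum.mono_neutral_left) (auto simp: in_keys_iff)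

lemma eval_poly_single: "eval_poly \<phi> (Poly_Mapping.single w c) = c *s word_eval \<phi> w"
  by (subst eval_poly_superset[of "{w}"]) auto

lemma eval_poly_var: "eval_poly \<phi> (var j g) = \<phi> (j, g)"
  by (simp add: var_def eval_poly_single)

lemma eval_poly_add: "eval_poly \<phi> (f + g) = eval_poly \<phi> f + eval_poly \<phi> g"
proof -
  let ?S = "Poly_Mapping.keys f \<union> Poly_Mapping.keys g"
  have "Poly_Mapping.keys (f + g) \<subseteq> ?S"
    by (rule Poly_Mapping.keys_add)
  then show ?thesis
    by (simp add: eval_poly_superset[of ?S] lookup_add scale_left_distrib sum.distrib)
qed

lemma eval_poly_sum: "eval_poly \<phi> (sum f T) = (\<Sum>t\<in>T. eval_poly \<phi> (f t))"
proof -
  have "eval_poly \<phi> 0 = 0"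
    by (simp add: eval_poly_def)
  then show ?thesis
    by (induction T rule: infinite_finite_induct) (simp_all add: eval_poly_add)
qed

lemma word_eval_Cons:
  assumes "u \<noteq> []"
  shows "word_eval \<phi> (Word (x # u)) = \<phi> x * word_eval \<phi> (Word u)"
  using assms by (cases u) auto

lemma word_eval_add:
  assumes "u \<noteq> 0" "v \<noteq> 0"
  shows "word_eval \<phi> (u + v) = word_eval \<phi> u * word_eval \<phi> v"
proof -
  obtain us vs where uv: "u = Word us" "v = Word vs"
    by (cases u, cases v)
  from assms have "us \<noteq> []" "vs \<noteq> []"
    by (auto simp: uv zero_word_def)
  then have "word_eval \<phi> (Word (us @ vs)) = word_eval \<phi> (Word us) * word_eval \<phi> (Word vs)"
    by (induction us rule: list_nonempty_induct) (auto simp: word_eval_Cons mult.assoc)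
  then show ?thesis
    by (simp add: uv)
qed

lemma eval_poly_mult:
  assumes "f \<in> free_algebra" "g \<in> free_algebra"
  shows "eval_poly \<phi> (f * g) = eval_poly \<phi> f * eval_poly \<phi> g"
proof -
  have expand: "h = (\<Sum>w\<in>Poly_Mapping.keys h. Poly_Mapping.single w (Poly_Mapping.lookup h w))"
    for h :: "('g, 'f) gr_poly"
    by (rule poly_mapping_eqI) (auto simp: lookup_sum lookup_single when_def in_keys_iff)
  have nz: "w \<noteq> 0" if "h \<in> free_algebra" "w \<in> Poly_Mapping.keys h"
    for h :: "('g, 'f) gr_poly" and w
    using that by (auto simp: free_algebra_def in_keys_iff)
  have "f * g = (\<Sum>u\<in>Poly_Mapping.keys f. \<Sum>v\<in>Poly_Mapping.keys g.
      Poly_Mapping.single (u + v) (Poly_Mapping.lookup f u * Poly_Mapping.lookup g v))"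
    by (subst expand[of f], subst expand[of g]) (simp add: sum_product mult_single)
  then have "eval_poly \<phi> (f * g) = (\<Sum>u\<in>Poly_Mapping.keys f. \<Sum>v\<in>Poly_Mapping.keys g.
      (Poly_Mapping.lookup f u * Poly_Mapping.lookup g v) *s word_eval \<phi> (u + v))"
    by (simp add: eval_poly_sum eval_poly_single)
  also have "\<dots> = (\<Sum>u\<in>Poly_Mapping.keys f. \<Sum>v\<in>Poly_Mapping.keys g.
      (Poly_Mapping.lookup f u *s word_eval \<phi> u) * (Poly_Mapping.lookup g v *s word_eval \<phi> v))"
    using nz assms
    by (intro sum.cong) (simp_all add: word_eval_add scale_mult_left scale_mult_right)
  also have "\<dots> = eval_poly \<phi> f * eval_poly \<phi> g"
    by (simp add: eval_poly_def sum_product)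
  finally show ?thesis .
qed

definition gr_identities :: "('g, 'f) gr_poly set" where
  "gr_identities =
     {f \<in> free_algebra. \<forall>\<phi>. (\<forall>j g. \<phi> (j, g) \<in> \<Gamma> g) \<longrightarrow> eval_poly \<phi> f = 0}"

definition gr_codim :: "nat \<Rightarrow> nat" where
  "gr_codim n = quotient_dim free_scale (multilinear n) (multilinear n \<inter> gr_identities)"

definition has_gr_PI_exponent :: "real \<Rightarrow> bool" where
  \<comment> \<open>a relation, as the existence of the limit is not part of the definition\<close>
  "has_gr_PI_exponent L \<longleftrightarrow> (\<lambda>n. root n (real (gr_codim n))) \<longlonglongrightarrow> L"

end

end

theory Submission
  imports Defs
    "HOL-Library.FuncSet"
    "HOL-Library.Function_Algebras"
    "HOL-Combinatorics.Multiset_Permutations"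
begin

text \<open>
  Let \<open>d = dim A\<close>. The codimension \<open>c\<^sub>n\<close> is the dimension of the space of those multilinear maps
  \<open>A\<^sup>n \<rightarrow> A\<close> that are given by multilinear graded polynomials, where the letter \<open>(j, g)\<close> stands for
  the component of degree \<open>g\<close> of the \<open>j\<close>-th argument (\<open>gr_codim_eq_dim\<close>). These maps are determined by
  their values on tuples of basis elements, so \<open>c\<^sub>n \<le> d\<^sup>n\<^sup>+\<^sup>1\<close>.

  Both directions use the trace form \<open>(x, y) \<mapsto> tr (x y)\<close>, where \<open>tr x\<close> is the trace of the
  left multiplication by \<open>x\<close>. Homogeneous elements of nonzero degree have trace \<open>0\<close>, so the orthogonal
  complement of a graded ideal is a graded ideal; and in characteristic \<open>0\<close> a subalgebra \<open>M = M\<^sup>2\<close> on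
  which the form vanishes is zero (\<open>trace_form_zero_imp_zero\<close>).

  Suppose that \<open>A\<close> is not graded simple. Then \<open>A\<close> has a nonzero graded ideal of square zero or
  two nonzero graded ideals that intersect in \<open>0\<close> and hence annihilate each other: if \<open>I\<close> is a proper
  nonzero graded ideal, take \<open>I\<close> and its complement if they intersect in \<open>0\<close>; otherwise the form
  vanishes on the intersection, and a minimal nonzero graded ideal on which the form vanishes has square
  zero. Choosing a basis that contains elements of these ideals, all
  monomials vanish on all but \<open>O((d - 1/2)\<^sup>n)\<close> tuples of basis elements, so the exponent is less than \<open>d\<close>.

  Suppose that \<open>A\<close> is graded simple. By the density theorem the multiplications and the
  projections onto components generate all endomorphisms of \<open>A\<close>; this yields a nonzero polynomial map
  \<open>\<Phi>\<close> that alternates in \<open>d\<close> of its arguments (\<open>alternating_map_exists\<close>). Substituting \<open>x y z\<close> for each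
  of these arguments \<open>z\<close> in turn and adding up multiplies \<open>\<Phi>\<close> by \<open>tr (x y)\<close>. Repeating this, one obtains
  for each bijection \<open>\<pi>\<close> of a set of \<open>m\<close> elements the polynomial map \<open>\<Phi> \<cdot> \<Prod>\<^sub>p tr (x\<^sub>p y\<^bsub>\<pi> p\<^esub>)\<close> in \<open>2 m\<close> further
  arguments, while the number of arguments of \<open>\<Phi>\<close> itself stays bounded. The trace form is nondegenerate,
  so the arguments can be taken from a basis and its dual basis, where the map tests whether \<open>\<pi>\<close>
  transports one colouring of the \<open>m\<close> elements with \<open>d\<close> colours to another. A double count shows that
  certain bijections, which shift the points of colour \<open>i\<close> by \<open>i\<close> blocks, are separated by such tests
  (\<open>colouring_determined\<close>); there are at least \<open>q\<^sup>2\<^sup>m\<close> of them, up to a constant factor, for every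
  \<open>q < d\<close>. Hence the exponent is \<open>d\<close>.
\<close>

section \<open>Linear algebra of function spaces\<close>

definition fscale :: "('f \<Rightarrow> 'v \<Rightarrow> 'v) \<Rightarrow> 'f \<Rightarrow> ('x \<Rightarrow> 'v) \<Rightarrow> 'x \<Rightarrow> 'v" where
  "fscale s c F = (\<lambda>x. s c (F x))"

lemma vector_space_fscale:
  assumes "vector_space s"
  shows "vector_space (fscale s)"
proof -
  interpret vector_space s by fact
  show ?thesis
    by unfold_locales (simp_all add: fscale_def fun_eq_iff scale_right_distrib scale_left_distrib)
qed

lemma module_times: "module ((*) :: 'f::field \<Rightarrow> 'f \<Rightarrow> 'f)"
  by unfold_locales (auto simp: algebra_simps)

lemma sum_fun_apply: "(\<Sum>i\<in>I. F i) x = (\<Sum>i\<in>I. F i x)" for F :: "'i \<Rightarrow> 'x \<Rightarrow> 'v::comm_monoid_add"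
  by (induction I rule: infinite_finite_induct) auto

lemma module_hom_eval:
  assumes "vector_space s"
  shows "module_hom (fscale s) s (\<lambda>F. F x)"
  using vector_space_fscale[OF assms] assms
  by (simp add: module_hom_iff module_iff_vector_space fscale_def)

text \<open>
  \<open>V / W\<close> is isomorphic to the image of \<open>V\<close> under a linear map with kernel \<open>W\<close>; so the dimension
  that \<^const>\<open>quotient_dim\<close> picks from some basis is that of the image.
\<close>

lemma quotient_dim_eq_dim_image:
  fixes s1 :: "'f::field \<Rightarrow> 'v::ab_group_add \<Rightarrow> 'v"
  assumes hom: "module_hom s1 s2 L" and V: "module.subspace s1 V"
    and W: "W = {v \<in> V. L v = 0}"
  shows "quotient_dim s1 V W = vector_space.dim s2 (L ` V)"
proof -
  interpret v1: vector_space s1 using hom by (simp add: module_hom_iff module_iff_vector_space)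
  interpret v2: vector_space s2 using hom by (simp add: module_hom_iff module_iff_vector_space)
  interpret L: module_hom s1 s2 L by fact
  have sumV: "(\<Sum>v\<in>t. s1 (u v) v) \<in> V" if "t \<subseteq> V" for t u
    using that by (intro v1.subspace_sum[OF V] v1.subspace_scale[OF V]) auto
  have Lsum: "L (\<Sum>v\<in>t. s1 (u v) v) = (\<Sum>v\<in>t. s2 (u v) (L v))" for t u
    by (simp add: L.sum L.scale)
  have card_eq: "card B = v2.dim (L ` V)" if qb: "quotient_basis s1 V W B" for B
  proof -
    have BV: "B \<subseteq> V" using qb by (simp add: quotient_basis_def)
    have ind: "u v = 0" if "finite t" "t \<subseteq> B" "(\<Sum>v\<in>t. s2 (u v) (L v)) = 0" "v \<in> t" for t u v
    proof -
      have "(\<Sum>v\<in>t. s1 (u v) v) \<in> W"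
        using sumV[of t u] that BV by (auto simp: W Lsum)
      then show ?thesis
        using qb that unfolding quotient_basis_def by blast
    qed
    have inj: "inj_on L B"
    proof (rule inj_onI, rule ccontr)
      fix x y assume xy: "x \<in> B" "y \<in> B" "L x = L y" "x \<noteq> y"
      let ?u = "\<lambda>v. if v = x then 1 else - 1 :: 'f"
      have "(\<Sum>v\<in>{x, y}. s2 (?u v) (L v)) = 0"
        using xy by simp
      from ind[OF _ _ this, of x] xy show False by simp
    qed
    have indep: "v2.independent (L ` B)"
      unfolding v2.independent_explicit_finite_subsets
    proof (intro allI impI ballI)
      fix S u v assume S: "S \<subseteq> L ` B" "finite S" "(\<Sum>v\<in>S. s2 (u v) v) = 0" "v \<in> S"
      obtain t where t: "t \<subseteq> B" "S = L ` t" using S(1) by (meson subset_imageE)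
      have injt: "inj_on L t" using inj t inj_on_subset by blast
      have ft: "finite t" using S(2) t injt by (simp add: finite_image_iff)
      have "(\<Sum>v\<in>t. s2 (u (L v)) (L v)) = 0"
        using S(3) t injt by (simp add: sum.reindex)
      from ind[OF ft t(1) this] S(4) t show "u v = 0" by auto
    qed
    have "L ` V \<subseteq> v2.span (L ` B)"
    proof
      fix y assume "y \<in> L ` V"
      then obtain v where v: "v \<in> V" "y = L v" by auto
      obtain b where b: "b \<in> v1.span B" "v - b \<in> W"
        using qb v unfolding quotient_basis_def by blast
      then have "L v = L b" by (simp add: W L.diff)
      with b v show "y \<in> v2.span (L ` B)"
        using L.span_image by auto
    qed
    then have "card (L ` B) = v2.dim (L ` V)"
      using BV indep by (intro v2.basis_card_eq_dim) auto
    then show ?thesis using inj by (simp add: card_image)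
  qed
  obtain C where C: "C \<subseteq> L ` V" "v2.independent C" "L ` V \<subseteq> v2.span C"
    using v2.maximal_independent_subset by blast
  obtain B where B: "B \<subseteq> V" "inj_on L B" "L ` B = C"
    using C(1) by (metis subset_image_inj)
  have "quotient_basis s1 V W B"
    unfolding quotient_basis_def
  proof (intro conjI allI impI ballI)
    fix t u v assume t: "finite t" "t \<subseteq> B" "(\<Sum>v\<in>t. s1 (u v) v) \<in> W" "v \<in> t"
    let ?g = "the_inv_into B L"
    have inv: "?g (L w) = w" if "w \<in> t" for w
      using t that B by (auto intro: the_inv_into_f_f)
    have "(\<Sum>w\<in>L ` t. s2 (u (?g w)) w) = (\<Sum>v\<in>t. s2 (u v) (L v))"
      using inj_on_subset[OF B(2) t(2)] by (simp add: sum.reindex inv)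
    also have "\<dots> = 0" using t(3) by (simp add: W Lsum)
    finally have "u (?g (L v)) = 0"
      using v2.independentD[OF C(2), of "L ` t" "\<lambda>w. u (?g w)" "L v"] t B by auto
    then show "u v = 0" using inv t by simp
  next
    fix v assume "v \<in> V"
    then have "L v \<in> L ` v1.span B" using C B L.span_image by auto
    then obtain b where b: "b \<in> v1.span B" "L v = L b" by auto
    moreover have "b \<in> V" using b(1) B(1) V v1.span_minimal by blast
    ultimately show "\<exists>b\<in>v1.span B. v - b \<in> W"
      using \<open>v \<in> V\<close> V v1.subspace_diff by (intro bexI[of _ b]) (auto simp: W L.diff)
  qed (use B in auto)
  then have "quotient_basis s1 V W (SOME B. quotient_basis s1 V W B)"
    by (rule someI)
  then show ?thesis unfolding quotient_dim_def by (rule card_eq)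
qed

text \<open>
  A function space whose members are determined by their values on a finite set \<open>X\<close> embeds into
  the functions \<open>X \<times> E \<Rightarrow> 'f\<close>, where \<open>E\<close> is a basis of the range.
\<close>

lemma (in finite_dimensional_vector_space) dim_function_space_le:
  fixes U :: "('x \<Rightarrow> 'b) set"
  assumes U: "module.subspace (fscale scale) U" and X: "finite X"
    and determined: "\<And>F. F \<in> U \<Longrightarrow> (\<And>x. x \<in> X \<Longrightarrow> F x = 0) \<Longrightarrow> F = 0"
  shows "\<exists>Y. finite Y \<and> U \<subseteq> module.span (fscale scale) Y"
    and "vector_space.dim (fscale scale) U \<le> card X * card Basis"
proof -
  interpret v: vector_space "fscale scale :: 'a \<Rightarrow> ('x \<Rightarrow> 'b) \<Rightarrow> _"
    by (rule vector_space_fscale) (rule vector_space_axioms)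
  interpret w: vector_space "fscale (*) :: 'a \<Rightarrow> ('x \<times> 'b \<Rightarrow> 'a) \<Rightarrow> _"
    by (rule vector_space_fscale) (simp flip: module_iff_vector_space add: module_times)
  define ev where "ev F = (\<lambda>(x, b). if (x, b) \<in> X \<times> Basis then representation Basis (F x) b else 0)"
    for F :: "'x \<Rightarrow> 'b"
  have hom: "module_hom (fscale scale) (fscale (*)) ev"
    unfolding module_hom_iff using v.module_axioms w.module_axioms
    by (auto simp: ev_def fun_eq_iff representation_add representation_scale
        independent_Basis span_Basis fscale_def)
  interpret ev: module_hom "fscale scale" "fscale (*)" ev by (rule hom)
  define ind where "ind p = (\<lambda>q. if q = p then 1 else 0 :: 'a)" for p :: "'x \<times> 'b"
  have range: "ev F \<in> w.span (ind ` (X \<times> Basis))" for F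
  proof -
    have "ev F = (\<Sum>p\<in>X \<times> Basis. fscale (*) (ev F p) (ind p))"
    proof
      fix q
      have "(\<Sum>p\<in>X \<times> Basis. fscale (*) (ev F p) (ind p)) q
          = (\<Sum>p\<in>X \<times> Basis. if q = p then ev F p else 0)"
        unfolding sum_fun_apply by (rule sum.cong) (auto simp: fscale_def ind_def)
      also have "\<dots> = ev F q"
        using X finite_Basis by (auto simp: sum.delta ev_def split: prod.splits)
      finally show "ev F q = (\<Sum>p\<in>X \<times> Basis. fscale (*) (ev F p) (ind p)) q" ..
    qed
    also have "\<dots> \<in> w.span (ind ` (X \<times> Basis))"
      by (intro w.span_sum w.span_scale w.span_base) auto
    finally show ?thesis .
  qed
  have inj0: "F = 0" if "F \<in> U" "ev F = 0" for F
  proof (rule determined[OF that(1)])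
    fix x assume x: "x \<in> X"
    have "representation Basis (F x) b = 0" if "b \<in> Basis" for b
      using fun_cong[OF \<open>ev F = 0\<close>, of "(x, b)"] x that by (simp add: ev_def)
    then have "(\<Sum>b\<in>Basis. representation Basis (F x) b *s b) = 0" by simp
    then show "F x = 0"
      using sum_representation_eq[OF independent_Basis _ finite_Basis subset_refl, of "F x"] span_Basis by simp
  qed
  obtain B where B: "B \<subseteq> U" "v.independent B" "U \<subseteq> v.span B"
    using v.maximal_independent_subset by blast
  have spanB: "v.span B = U" using B U v.span_subspace by blast
  have inj: "inj_on ev (v.span B)"
    unfolding spanB
  proof (rule inj_onI)
    fix F G assume "F \<in> U" "G \<in> U" "ev F = ev G"
    then show "F = G" using inj0[of "F - G"] v.subspace_diff[OF U] by (simp add: ev.diff)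
  qed
  have "w.independent (ev ` B)" by (rule ev.independent_injective_image[OF B(2) inj])
  moreover have "ev ` B \<subseteq> w.span (ind ` (X \<times> Basis))" using range by auto
  ultimately have "finite (ev ` B) \<and> card (ev ` B) \<le> card (ind ` (X \<times> Basis))"
    using X finite_Basis by (intro w.independent_span_bound) auto
  moreover have injB: "inj_on ev B" using inj inj_on_subset v.span_superset by blast
  ultimately have fin: "finite B" and "card B \<le> card (ind ` (X \<times> Basis))"
    by (auto simp: finite_image_iff card_image)
  moreover have "card (ind ` (X \<times> Basis)) \<le> card X * card Basis"
    using card_image_le[of "X \<times> Basis" ind] X finite_Basis by (simp add: card_cartesian_product)
  moreover have "card B = v.dim U" using B by (intro v.basis_card_eq_dim)
  ultimately show "v.dim U \<le> card X * card Basis" by simp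
  show "\<exists>Y. finite Y \<and> U \<subseteq> v.span Y" using fin B by auto
qed

text \<open>
  The point \<open>x j\<close> singles out \<open>F j\<close>, so evaluation there reads off the \<open>j\<close>-th coefficient of a
  linear combination.
\<close>

lemma dim_function_space_ge:
  fixes U :: "('x \<Rightarrow> 'v::ab_group_add) set" and s :: "'f::field \<Rightarrow> 'v \<Rightarrow> 'v"
  assumes vs: "vector_space s" and U: "\<exists>Y. finite Y \<and> U \<subseteq> module.span (fscale s) Y"
    and I: "finite I" and FU: "\<And>i. i \<in> I \<Longrightarrow> F i \<in> U"
    and diag: "\<And>i. i \<in> I \<Longrightarrow> F i (x i) \<noteq> 0"
    and off: "\<And>i j. i \<in> I \<Longrightarrow> j \<in> I \<Longrightarrow> i \<noteq> j \<Longrightarrow> F i (x j) = 0"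
  shows "card I \<le> vector_space.dim (fscale s) U"
proof -
  interpret s: vector_space s by fact
  interpret v: vector_space "fscale s :: 'f \<Rightarrow> ('x \<Rightarrow> 'v) \<Rightarrow> _"
    by (rule vector_space_fscale) (rule vs)
  have inj: "inj_on F I"
    by (rule inj_onI) (metis diag off)
  have indep: "v.independent (F ` I)"
    unfolding v.independent_explicit_finite_subsets
  proof (intro allI impI ballI)
    fix S u G assume S: "S \<subseteq> F ` I" "finite S" "(\<Sum>G\<in>S. fscale s (u G) G) = 0" "G \<in> S"
    then obtain j where j: "j \<in> I" "G = F j" by auto
    have zero: "fscale s (u H) H (x j) = 0" if "H \<in> S - {G}" for H
      using that S(1) j off by (auto simp: fscale_def)
    have "0 = (\<Sum>G\<in>S. fscale s (u G) G (x j))"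
      using fun_cong[OF S(3), of "x j"] by (simp add: sum_fun_apply)
    also have "\<dots> = fscale s (u G) G (x j)"
      using S(2,4) zero by (simp add: sum.remove)
    finally show "u G = 0" using diag j by (simp add: fscale_def)
  qed
  obtain Y where Y: "finite Y" "U \<subseteq> v.span Y" using U by blast
  obtain C where C: "F ` I \<subseteq> C" "C \<subseteq> U" "v.independent C" "U \<subseteq> v.span C"
    using v.maximal_independent_subset_extend[of "F ` I" U] FU indep by blast
  have "finite C" using v.independent_span_bound[OF Y(1) C(3)] C Y by blast
  then have "card (F ` I) \<le> card C" using C by (intro card_mono)
  moreover have "card C = v.dim U" using C by (intro v.basis_card_eq_dim)
  ultimately show ?thesis using inj by (simp add: card_image)
qed

text \<open>The arguments are replaced by elements of the spans one slot at a time.\<close>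

lemma multilinear_eq_0_on_span:
  assumes I: "finite I"
    and lin: "\<And>i a. i \<in> I \<Longrightarrow> module_hom s1 s2 (\<lambda>x. F (a(i := x)))"
    and zero: "\<And>a. (\<And>i. i \<in> I \<Longrightarrow> a i \<in> S) \<Longrightarrow> F a = 0"
    and a: "\<And>i. i \<in> I \<Longrightarrow> a i \<in> module.span s1 S"
  shows "F a = 0"
proof -
  have "J \<subseteq> I \<longrightarrow> (\<forall>a. (\<forall>i\<in>J. a i \<in> module.span s1 S) \<longrightarrow> (\<forall>i\<in>I - J. a i \<in> S) \<longrightarrow> F a = 0)"
    if "finite J" for J
    using that
  proof (induction J rule: finite_induct)
    case empty
    then show ?case using zero by auto
  next
    case (insert j J)
    show ?case
    proof (intro impI allI)
      fix a assume J: "insert j J \<subseteq> I" and a1: "\<forall>i\<in>insert j J. a i \<in> module.span s1 S"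
        and a2: "\<forall>i\<in>I - insert j J. a i \<in> S"
      have "F (a(j := x)) = 0" if "x \<in> S" for x
        using insert J a1 a2 that by (intro insert.IH[rule_format]) auto
      moreover have "module_hom s1 s2 (\<lambda>x. F (a(j := x)))" using lin J by blast
      ultimately have "F (a(j := a j)) = 0"
        using a1 module_hom.eq_0_on_span[of s1 s2 "\<lambda>x. F (a(j := x))" S "a j"] by blast
      then show "F a = 0" by simp
    qed
  qed
  from this[OF I] a show ?thesis by auto
qed

section \<open>Homogeneous components and multilinear maps\<close>

context graded_algebra
begin

definition component :: "'g \<Rightarrow> 'a \<Rightarrow> 'a" where
  "component g x = (THE d. homogeneous_decomposition \<Gamma> d x) g"

lemma homogeneous_decomposition_component: "homogeneous_decomposition \<Gamma> (\<lambda>g. component g x) x"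
  unfolding component_def using theI'[OF direct_sum[of x]] by simp

lemma component_eqI:
  assumes "\<And>g. d g \<in> \<Gamma> g" "finite S" "\<And>g. g \<notin> S \<Longrightarrow> d g = 0" "x = (\<Sum>g\<in>S. d g)"
  shows "component g x = d g"
proof -
  have sub: "{g. d g \<noteq> 0} \<subseteq> S" using assms(3) by auto
  have "(\<Sum>g\<in>S. d g) = (\<Sum>g | d g \<noteq> 0. d g)"
    using assms(2) sub by (intro sum.mono_neutral_right) auto
  then have "homogeneous_decomposition \<Gamma> d x"
    unfolding homogeneous_decomposition_def using assms finite_subset[OF sub] by auto
  then have "(\<lambda>g. component g x) = d"
    using direct_sum[of x] homogeneous_decomposition_component[of x] by blast
  then show ?thesis by (rule fun_cong)
qed

lemma component_in: "component g x \<in> \<Gamma> g"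
  and finite_component: "finite {g. component g x \<noteq> 0}"
  using homogeneous_decomposition_component[of x] by (auto simp: homogeneous_decomposition_def)

lemma sum_component:
  assumes "finite S" "\<And>g. g \<notin> S \<Longrightarrow> component g x = 0"
  shows "(\<Sum>g\<in>S. component g x) = x"
proof -
  have "(\<Sum>g\<in>S. component g x) = (\<Sum>g | component g x \<noteq> 0. component g x)"
    using assms by (intro sum.mono_neutral_right) auto
  then show ?thesis
    using homogeneous_decomposition_component[of x] by (simp add: homogeneous_decomposition_def)
qed

lemma component_add: "component g (x + y) = component g x + component g y"
proof (rule component_eqI[where S = "{g. component g x \<noteq> 0} \<union> {g. component g y \<noteq> 0}"])
  let ?S = "{g. component g x \<noteq> 0} \<union> {g. component g y \<noteq> 0}"
  have "(\<Sum>g\<in>?S. component g x) = x" "(\<Sum>g\<in>?S. component g y) = y"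
    by (rule sum_component; simp add: finite_component)+
  then show "x + y = (\<Sum>g\<in>?S. component g x + component g y)"
    by (simp add: sum.distrib)
qed (auto simp: finite_component component_in subspace_add[OF subspace_component])

lemma component_scale: "component g (c *s x) = c *s component g x"
proof (rule component_eqI[where S = "{g. component g x \<noteq> 0}"])
  have "(\<Sum>g | component g x \<noteq> 0. component g x) = x"
    by (rule sum_component; simp add: finite_component)
  then show "c *s x = (\<Sum>g | component g x \<noteq> 0. c *s component g x)"
    by (simp flip: scale_sum_right)
qed (auto simp: finite_component component_in subspace_scale[OF subspace_component])

lemma component_hom: "module_hom scale scale (component g)"
  by (simp add: module_hom_iff module_axioms component_add component_scale)

lemma component_0 [simp]: "component g 0 = 0"
  using component_hom by (rule module_hom.zero)

lemma component_homogeneous: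
  assumes "x \<in> \<Gamma> h"
  shows "component g x = (if g = h then x else 0)"
proof (rule component_eqI[where S = "{h}"])
  show "(if g = h then x else 0) \<in> \<Gamma> g" for g
    using assms subspace_0[OF subspace_component] by auto
qed auto

lemma graded_ideal_iff:
  "graded_ideal I \<longleftrightarrow>
     subspace I \<and> (\<forall>x\<in>I. \<forall>a. a * x \<in> I \<and> x * a \<in> I) \<and> (\<forall>x\<in>I. \<forall>g. component g x \<in> I)"
proof -
  have "(\<exists>d. homogeneous_decomposition (\<lambda>g. \<Gamma> g \<inter> I) d x) \<longleftrightarrow> (\<forall>g. component g x \<in> I)" for x
  proof
    assume "\<exists>d. homogeneous_decomposition (\<lambda>g. \<Gamma> g \<inter> I) d x"
    then obtain d where d: "homogeneous_decomposition (\<lambda>g. \<Gamma> g \<inter> I) d x" by blast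
    then have "homogeneous_decomposition \<Gamma> d x" by (auto simp: homogeneous_decomposition_def)
    then have "(\<lambda>g. component g x) = d"
      using direct_sum[of x] homogeneous_decomposition_component[of x] by blast
    with d show "\<forall>g. component g x \<in> I"
      by (auto simp: homogeneous_decomposition_def fun_eq_iff)
  next
    assume "\<forall>g. component g x \<in> I"
    then show "\<exists>d. homogeneous_decomposition (\<lambda>g. \<Gamma> g \<inter> I) d x"
      using homogeneous_decomposition_component[of x]
      by (auto simp: homogeneous_decomposition_def intro!: exI[of _ "\<lambda>g. component g x"])
  qed
  then show ?thesis by (simp add: graded_ideal_def)
qed

definition monomial_map :: "(nat \<times> 'g) list \<Rightarrow> (nat \<Rightarrow> 'a) \<Rightarrow> 'a" where
  "monomial_map l a = word_eval (\<lambda>(j, g). component g (a j)) (Word l)"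

text \<open>
  The multilinear maps in the arguments \<open>a j\<close>, \<open>j \<in> J\<close>, that are given by multilinear graded
  polynomials: the letter \<open>(j, g)\<close> stands for the component of degree \<open>g\<close> of the argument \<open>a j\<close>.
\<close>

definition multilinear_maps :: "nat set \<Rightarrow> ((nat \<Rightarrow> 'a) \<Rightarrow> 'a) set" where
  "multilinear_maps J = module.span (fscale scale)
     (monomial_map ` {l. distinct (map fst l) \<and> fst ` set l = J})"

interpretation fv: vector_space "fscale scale :: 'f \<Rightarrow> ((nat \<Rightarrow> 'a) \<Rightarrow> 'a) \<Rightarrow> _"
  by (rule vector_space_fscale) (rule vector_space_axioms)

lemma monomial_map_single: "monomial_map [(j, g)] a = component g (a j)"
  by (simp add: monomial_map_def)

lemma monomial_map_Cons:
  "l \<noteq> [] \<Longrightarrow> monomial_map ((j, g) # l) a = component g (a j) * monomial_map l a"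
  by (simp add: monomial_map_def word_eval_Cons)

lemma monomial_map_append:
  "l \<noteq> [] \<Longrightarrow> l' \<noteq> [] \<Longrightarrow> monomial_map (l @ l') a = monomial_map l a * monomial_map l' a"
  using word_eval_add[of "Word l" "Word l'"] by (simp add: monomial_map_def zero_word_def)

lemma monomial_map_cong:
  "(\<And>j. j \<in> fst ` set l \<Longrightarrow> a j = b j) \<Longrightarrow> monomial_map l a = monomial_map l b"
proof (induction l)
  case (Cons x l)
  then show ?case
    by (cases x; cases "l = []") (auto simp: monomial_map_single monomial_map_Cons)
qed (simp add: monomial_map_def)

lemma monomial_map_homogeneous:
  "l \<noteq> [] \<Longrightarrow> monomial_map l a \<in> \<Gamma> (sum_list (map snd l))"
proof (induction l)
  case (Cons x l)
  then show ?case
    by (cases x; cases "l = []")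
      (auto simp: monomial_map_single monomial_map_Cons component_in component_mult)
qed simp

lemma monomial_map_hom:
  "distinct (map fst l) \<Longrightarrow> j \<in> fst ` set l \<Longrightarrow> module_hom scale scale (\<lambda>x. monomial_map l (a(j := x)))"
proof (induction l)
  case (Cons p l)
  obtain i g where p: "p = (i, g)" by force
  show ?case
  proof (cases "l = []")
    case True
    then show ?thesis using Cons p component_hom by (simp add: monomial_map_single)
  next
    case ne: False
    show ?thesis
    proof (cases "i = j")
      case True
      then have rest: "monomial_map l (a(j := x)) = monomial_map l a" for x
        using Cons.prems p by (intro monomial_map_cong) auto
      have "(\<lambda>x. monomial_map (p # l) (a(j := x))) = (\<lambda>x. component g x * monomial_map l a)"
        using True ne by (intro ext, unfold p monomial_map_Cons[OF ne] rest) simp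
      then show ?thesis
        by (simp only: module_hom_iff module_axioms component_add component_scale scale_mult_left
            distrib_right simp_thms)
    next
      case False
      then have "module_hom scale scale (\<lambda>x. monomial_map l (a(j := x)))"
        using Cons p by (intro Cons.IH) auto
      then show ?thesis
        using False ne by (simp add: p monomial_map_Cons module_hom_iff
            scale_mult_right distrib_left del: fun_upd_apply) simp
    qed
  qed
qed simp

lemma multilinear_maps_induct [consumes 1, case_names subspace monomial]:
  assumes "F \<in> multilinear_maps J" and "module.subspace (fscale scale) (Collect P)"
    and "\<And>l. distinct (map fst l) \<Longrightarrow> fst ` set l = J \<Longrightarrow> P (monomial_map l)"
  shows "P F"
  using assms(1) unfolding multilinear_maps_def
  by (rule fv.span_induct) (use assms(2,3) in auto)

lemma monomial_map_in: "distinct (map fst l) \<Longrightarrow> fst ` set l = J \<Longrightarrow> monomial_map l \<in> multilinear_maps J"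
  unfolding multilinear_maps_def by (rule fv.span_base) auto

lemma subspace_multilinear_maps: "fv.subspace (multilinear_maps J)"
  unfolding multilinear_maps_def by (rule fv.subspace_span)

lemma multilinear_maps_add:
  "F \<in> multilinear_maps J \<Longrightarrow> H \<in> multilinear_maps J \<Longrightarrow> (\<lambda>a. F a + H a) \<in> multilinear_maps J"
  using fv.subspace_add[OF subspace_multilinear_maps, of F J H] by (simp add: plus_fun_def)

lemma multilinear_maps_scale: "F \<in> multilinear_maps J \<Longrightarrow> (\<lambda>a. c *s F a) \<in> multilinear_maps J"
  using fv.subspace_scale[OF subspace_multilinear_maps, of F J c] by (simp add: fscale_def)

lemma multilinear_maps_0: "(\<lambda>a. 0) \<in> multilinear_maps J"
  using fv.subspace_0[OF subspace_multilinear_maps, of J] by (simp add: zero_fun_def)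

lemma multilinear_maps_sum:
  assumes "\<And>i. i \<in> I \<Longrightarrow> F i \<in> multilinear_maps J"
  shows "(\<lambda>a. \<Sum>i\<in>I. F i a) \<in> multilinear_maps J"
proof -
  have "(\<Sum>i\<in>I. F i) = (\<lambda>a. \<Sum>i\<in>I. F i a)" by (simp add: fun_eq_iff sum_fun_apply)
  then show ?thesis using fv.subspace_sum[OF subspace_multilinear_maps] assms by metis
qed

lemma multilinear_maps_cong:
  assumes "F \<in> multilinear_maps J" "\<And>j. j \<in> J \<Longrightarrow> a j = b j"
  shows "F a = F b"
  using assms(1)
proof (induction rule: multilinear_maps_induct)
  case (monomial l)
  then show ?case using assms(2) by (intro monomial_map_cong) auto
qed (auto simp: fv.subspace_def fscale_def)

lemma multilinear_maps_hom:
  assumes "F \<in> multilinear_maps J" "j \<in> J"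
  shows "module_hom scale scale (\<lambda>x. F (a(j := x)))"
  using assms(1)
proof (induction rule: multilinear_maps_induct)
  case (monomial l)
  then show ?case using assms(2) by (intro monomial_map_hom) auto
qed (auto simp: fv.subspace_def fscale_def module_hom_iff module_axioms scale_right_distrib
       mult.commute intro: module_axioms)

text \<open>A monomial has homogeneous values of a fixed degree, so a projection keeps it or kills it.\<close>

lemma multilinear_maps_component:
  assumes "F \<in> multilinear_maps J" "J \<noteq> {}"
  shows "(\<lambda>a. component g (F a)) \<in> multilinear_maps J"
  using assms(1)
proof (induction rule: multilinear_maps_induct)
  case (monomial l)
  then have hom: "monomial_map l a \<in> \<Gamma> (sum_list (map snd l))" for a
    using assms(2) by (intro monomial_map_homogeneous) auto
  then have "(\<lambda>a. component g (monomial_map l a))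
      = (if g = sum_list (map snd l) then monomial_map l else (\<lambda>a. 0))"
    by (simp add: component_homogeneous[OF hom] fun_eq_iff)
  then show ?case using monomial by (auto simp: monomial_map_in multilinear_maps_0)
qed (auto simp: fv.subspace_def fscale_def component_add component_scale
      multilinear_maps_0 multilinear_maps_add multilinear_maps_scale)

lemma multilinear_maps_mult:
  assumes F: "F \<in> multilinear_maps J" and H: "H \<in> multilinear_maps K"
    and JK: "J \<noteq> {}" "K \<noteq> {}" "J \<inter> K = {}"
  shows "(\<lambda>a. F a * H a) \<in> multilinear_maps (J \<union> K)"
  using F
proof (induction rule: multilinear_maps_induct)
  case (monomial l)
  note l = this
  show ?case using H
  proof (induction rule: multilinear_maps_induct)
    case (monomial l')
    have "(\<lambda>a. monomial_map l a * monomial_map l' a) = monomial_map (l @ l')"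
      using l monomial JK by (intro ext monomial_map_append[symmetric]) auto
    moreover have "monomial_map (l @ l') \<in> multilinear_maps (J \<union> K)"
      using l monomial JK by (intro monomial_map_in) (simp_all add: image_Un)
    ultimately show ?case by simp
  qed (auto simp: fv.subspace_def fscale_def distrib_left scale_mult_right
      multilinear_maps_0 multilinear_maps_add multilinear_maps_scale)
qed (auto simp: fv.subspace_def fscale_def distrib_right scale_mult_left
      multilinear_maps_0 multilinear_maps_add multilinear_maps_scale)

text \<open>
  Substitution relies on \<open>multilinear_maps_component\<close>: the components of the substituted maps that
  a letter of the outer monomial selects are again given by polynomials.
\<close>

lemma monomial_map_subst:
  assumes "l \<noteq> []" "distinct (map fst l)"
    and "\<And>j. j \<in> fst ` set l \<Longrightarrow> X j \<in> multilinear_maps (K j) \<and> K j \<noteq> {}"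
    and "\<And>i j. i \<in> fst ` set l \<Longrightarrow> j \<in> fst ` set l \<Longrightarrow> i \<noteq> j \<Longrightarrow> K i \<inter> K j = {}"
  shows "(\<lambda>a. monomial_map l (\<lambda>j. X j a)) \<in> multilinear_maps (\<Union>j\<in>fst ` set l. K j)"
  using assms
proof (induction l)
  case (Cons p l)
  obtain i g where p: "p = (i, g)" by force
  have X: "(\<lambda>a. component g (X i a)) \<in> multilinear_maps (K i)"
    using Cons.prems(3)[of i] by (intro multilinear_maps_component) (auto simp: p)
  show ?case
  proof (cases "l = []")
    case True
    then show ?thesis using X by (simp add: p monomial_map_single)
  next
    case ne: False
    have IH: "(\<lambda>a. monomial_map l (\<lambda>j. X j a)) \<in> multilinear_maps (\<Union>j\<in>fst ` set l. K j)"
      using Cons.prems by (intro Cons.IH[OF ne]) auto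
    have "K i \<inter> (\<Union>j\<in>fst ` set l. K j) = {}"
    proof -
      have "K i \<inter> K j = {}" if "j \<in> fst ` set l" for j
        using Cons.prems(2) that by (intro Cons.prems(4)) (auto simp: p)
      then show ?thesis by blast
    qed
    moreover have "K i \<noteq> {}" "(\<Union>j\<in>fst ` set l. K j) \<noteq> {}"
      using Cons.prems(3)[of i] Cons.prems(3)[of "fst (hd l)"] ne by (auto simp: p)
    ultimately have "(\<lambda>a. component g (X i a) * monomial_map l (\<lambda>j. X j a))
        \<in> multilinear_maps (K i \<union> (\<Union>j\<in>fst ` set l. K j))"
      by (intro multilinear_maps_mult X IH)
    then show ?thesis using ne by (simp add: p monomial_map_Cons)
  qed
qed simp

lemma multilinear_maps_subst:
  assumes F: "F \<in> multilinear_maps J" and J: "J \<noteq> {}"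
    and X: "\<And>j. j \<in> J \<Longrightarrow> X j \<in> multilinear_maps (K j)" and K: "\<And>j. j \<in> J \<Longrightarrow> K j \<noteq> {}"
    and disj: "\<And>i j. i \<in> J \<Longrightarrow> j \<in> J \<Longrightarrow> i \<noteq> j \<Longrightarrow> K i \<inter> K j = {}"
  shows "(\<lambda>a. F (\<lambda>j. X j a)) \<in> multilinear_maps (\<Union>j\<in>J. K j)"
  using F
proof (induction rule: multilinear_maps_induct)
  case (monomial l)
  have "(\<lambda>a. monomial_map l (\<lambda>j. X j a)) \<in> multilinear_maps (\<Union>j\<in>fst ` set l. K j)"
    using monomial J X K disj by (intro monomial_map_subst) auto
  then show ?case using monomial by simp
qed (auto simp: fv.subspace_def fscale_def
      multilinear_maps_0 multilinear_maps_add multilinear_maps_scale)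

text \<open>A multilinear graded polynomial as a map of arguments that need not be homogeneous.\<close>

definition poly_map :: "('g, 'f) gr_poly \<Rightarrow> (nat \<Rightarrow> 'a) \<Rightarrow> 'a" where
  "poly_map f = (\<lambda>a. eval_poly (\<lambda>(j, g). component g (a j)) f)"

lemma free_scale_eq_sum:
  "free_scale c f = (\<Sum>w\<in>Poly_Mapping.keys f. Poly_Mapping.single w (c * Poly_Mapping.lookup f w))"
proof -
  have "f = (\<Sum>w\<in>Poly_Mapping.keys f. Poly_Mapping.single w (Poly_Mapping.lookup f w))"
    by (rule poly_mapping_eqI) (auto simp: lookup_sum lookup_single when_def in_keys_iff)
  then have "free_scale c f = free_scale c (\<Sum>w\<in>Poly_Mapping.keys f.
      Poly_Mapping.single w (Poly_Mapping.lookup f w))"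
    by simp
  also have "\<dots> = (\<Sum>w\<in>Poly_Mapping.keys f. Poly_Mapping.single w (c * Poly_Mapping.lookup f w))"
    unfolding free_alg.scale_sum_right by (simp add: free_scale_def mult_single)
  finally show ?thesis .
qed

lemma eval_poly_scale: "eval_poly \<phi> (free_scale c f) = c *s eval_poly \<phi> f"
  by (simp add: free_scale_eq_sum eval_poly_sum eval_poly_single) (simp add: eval_poly_def scale_sum_right)

lemma poly_map_hom: "module_hom free_scale (fscale scale) poly_map"
  by (simp add: module_hom_iff free_alg.module_axioms fv.module_axioms poly_map_def eval_poly_add
      eval_poly_scale fscale_def fun_eq_iff)

lemma prod_list_var:
  "(\<Prod>x\<leftarrow>l. var (fst x) (snd x)) = Poly_Mapping.single (Word l) (1 :: 'f)"
proof (induction l)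
  case Nil
  then show ?case by (simp flip: zero_word_def)
next
  case (Cons x l)
  then show ?case by (simp add: var_def mult_single)
qed

text \<open>
  Permutations and degrees are encoded together as lists of letters, which is the form in which
  monomials are concatenated and evaluated.
\<close>

lemma multilinear_generators:
  fixes n :: nat
  shows "{(\<Prod>i\<leftarrow>[1..<Suc n]. var (\<sigma> i) (g i)) | \<sigma> (g :: nat \<Rightarrow> 'g). \<sigma> permutes {1..n}}
    = (\<lambda>l. Poly_Mapping.single (Word l) (1 :: 'f)) ` {l. distinct (map fst l) \<and> fst ` set l = {1..n}}"
    (is "?L = ?f ` ?R")
proof (intro set_eqI iffI)
  fix x assume "x \<in> ?L"
  then obtain \<sigma> g where x: "x = (\<Prod>i\<leftarrow>[1..<Suc n]. var (\<sigma> i) (g i))" and \<sigma>: "\<sigma> permutes {1..n}"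
    by blast
  let ?l = "map (\<lambda>i. (\<sigma> i, g i)) [1..<Suc n]"
  have "x = ?f ?l"
    unfolding x prod_list_var[symmetric] by (simp add: o_def)
  moreover have "fst ` set ?l = {1..n}"
    using permutes_image[OF \<sigma>]
    by (simp add: image_image atLeastLessThanSuc_atLeastAtMost del: upt_Suc)
  moreover have "distinct (map fst ?l)"
    using permutes_inj_on[OF \<sigma>] by (simp add: o_def distinct_map del: upt_Suc)
  ultimately show "x \<in> ?f ` ?R" by blast
next
  fix x assume "x \<in> ?f ` ?R"
  then obtain l where x: "x = ?f l" and l: "distinct (map fst l)" "set (map fst l) = {1..n}" by auto
  have len: "length l = n" using distinct_card[OF l(1)] l(2) by simp
  define \<sigma> where "\<sigma> i = (if i \<in> {1..n} then fst (l ! (i - 1)) else i)" for i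
  have "bij_betw (\<lambda>i. i - 1) {1..n} {..<n}"
    by (rule bij_betw_byWitness[where f' = Suc]) auto
  moreover have "bij_betw (\<lambda>i. map fst l ! i) {..<n} {1..n}"
    using bij_betw_nth[OF l(1), of "{..<n}"] len l(2) by auto
  ultimately have "bij_betw ((\<lambda>i. map fst l ! i) \<circ> (\<lambda>i. i - 1)) {1..n} {1..n}"
    by (rule bij_betw_trans)
  then have "bij_betw \<sigma> {1..n} {1..n}"
    by (rule bij_betw_cong[THEN iffD1, rotated]) (auto simp: \<sigma>_def len)
  then have \<sigma>: "\<sigma> permutes {1..n}" by (rule bij_imp_permutes) (auto simp: \<sigma>_def)
  have "l = map (\<lambda>i. (\<sigma> i, snd (l ! (i - 1)))) [1..<Suc n]"
    by (rule nth_equalityI) (auto simp: len \<sigma>_def simp del: upt_Suc)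
  then have "x = (\<Prod>x\<leftarrow>map (\<lambda>i. (\<sigma> i, snd (l ! (i - 1)))) [1..<Suc n]. var (fst x) (snd x))"
    unfolding x prod_list_var by simp
  then have "x = (\<Prod>i\<leftarrow>[1..<Suc n]. var (\<sigma> i) (snd (l ! (i - 1))))" by (simp add: o_def)
  with \<sigma> show "x \<in> ?L"
    by (auto intro!: exI[of _ \<sigma>] exI[of _ "\<lambda>i. snd (l ! (i - 1))"])
qed

lemma poly_map_multilinear: "poly_map ` multilinear n = multilinear_maps {1..n}"
proof -
  have single: "poly_map (Poly_Mapping.single (Word l) 1) = monomial_map l" for l
    by (simp add: poly_map_def monomial_map_def eval_poly_single fun_eq_iff)
  show ?thesis
    unfolding multilinear_def multilinear_maps_def multilinear_generators
      module_hom.span_image[OF poly_map_hom, symmetric] image_image single ..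
qed

end

locale fin_dim_graded_algebra = graded_algebra scale \<Gamma> + finite_dimensional_vector_space scale Basis
  for scale :: "'f::field \<Rightarrow> 'a::ring \<Rightarrow> 'a" (infixr \<open>*s\<close> 75)
    and \<Gamma> :: "'g::ab_group_add \<Rightarrow> 'a set" and Basis :: "'a set"
begin

interpretation fv: vector_space "fscale scale :: 'f \<Rightarrow> ((nat \<Rightarrow> 'a) \<Rightarrow> 'a) \<Rightarrow> _"
  by (rule vector_space_fscale) (rule vector_space_axioms)

text \<open>The finitely many degrees that occur in the algebra.\<close>

definition support :: "'g set" where
  "support = (\<Union>b\<in>Basis. {g. component g b \<noteq> 0})"

lemma finite_support: "finite support"
  unfolding support_def using finite_Basis finite_component by auto

lemma component_outside:
  assumes "g \<notin> support"
  shows "component g x = 0"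
proof (rule module_hom.eq_0_on_span[OF component_hom])
  show "component g b = 0" if "b \<in> Basis" for b
    using assms that by (auto simp: support_def)
qed (simp add: span_Basis)

lemma sum_component_support: "(\<Sum>g\<in>support. component g x) = x"
  by (rule sum_component[OF finite_support component_outside])

lemma multilinear_maps_arg: "(\<lambda>a. a j) \<in> multilinear_maps {j}"
proof -
  have "(\<lambda>a. \<Sum>g\<in>support. monomial_map [(j, g)] a) \<in> multilinear_maps {j}"
    by (intro multilinear_maps_sum monomial_map_in) auto
  then show ?thesis by (simp only: monomial_map_single sum_component_support)
qed

text \<open>
  The variables \<open>(j, g)\<close> with the same \<open>j\<close> are independent of each other, but their values are the
  components of a single element \<open>a j\<close>, the sum of these values.
\<close>

lemma gr_identities_iff:
  assumes "f \<in> free_algebra"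
  shows "f \<in> gr_identities \<longleftrightarrow> poly_map f = 0"
proof
  assume "f \<in> gr_identities"
  then show "poly_map f = 0"
    by (auto simp: gr_identities_def poly_map_def component_in fun_eq_iff)
next
  assume 0: "poly_map f = 0"
  have "eval_poly \<phi> f = 0" if \<phi>: "\<And>j g. \<phi> (j, g) \<in> \<Gamma> g" for \<phi>
  proof -
    define a where "a j = (\<Sum>g\<in>support. \<phi> (j, g))" for j
    have out: "\<phi> (j, g) = 0" if "g \<notin> support" for j g
      using component_homogeneous[OF \<phi>, of g j g] component_outside[OF that] by simp
    have "component g (a j) = \<phi> (j, g)" for j g
      by (rule component_eqI[where d = "\<lambda>g. \<phi> (j, g)", OF _ finite_support])
        (auto simp: \<phi> out a_def)
    then have "(\<lambda>(j, g). component g (a j)) = \<phi>" by auto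
    then show ?thesis using fun_cong[OF 0, of a] by (simp add: poly_map_def)
  qed
  then show "f \<in> gr_identities" using assms by (auto simp: gr_identities_def)
qed

lemma multilinear_subset_free_algebra:
  assumes "n \<ge> 1"
  shows "(multilinear n :: ('g, 'f) gr_poly set) \<subseteq> free_algebra"
  unfolding multilinear_def multilinear_generators
proof (rule free_alg.span_minimal)
  show "free_alg.subspace (free_algebra :: ('g, 'f) gr_poly set)"
  proof -
    have "Poly_Mapping.lookup (free_scale c f) 0 = 0"
      if "Poly_Mapping.lookup f 0 = 0" for c and f :: "('g, 'f) gr_poly"
      using that by (simp add: free_scale_eq_sum lookup_sum lookup_single when_def)
    then show ?thesis by (auto simp: free_alg.subspace_def free_algebra_def lookup_add)
  qed
qed (use assms in \<open>auto simp: free_algebra_def lookup_single when_def zero_word_def\<close>)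

lemma gr_codim_eq_dim:
  assumes "n \<ge> 1"
  shows "gr_codim n = vector_space.dim (fscale scale) (multilinear_maps {1..n})"
proof -
  have "free_alg.subspace (multilinear n :: ('g, 'f) gr_poly set)"
    unfolding multilinear_def by (rule free_alg.subspace_span)
  moreover have "multilinear n \<inter> gr_identities = {f \<in> multilinear n. poly_map f = 0}"
    using gr_identities_iff multilinear_subset_free_algebra[OF assms] by blast
  ultimately have "quotient_dim free_scale (multilinear n) (multilinear n \<inter> gr_identities)
      = vector_space.dim (fscale scale) (poly_map ` multilinear n)"
    by (rule quotient_dim_eq_dim_image[OF poly_map_hom])
  then show ?thesis
    unfolding gr_codim_def poly_map_multilinear .
qed

lemma multilinear_maps_eq_0:
  assumes F: "F \<in> multilinear_maps J" and J: "finite J" and B: "span B = UNIV"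
    and zero: "\<And>a. a \<in> J \<rightarrow>\<^sub>E B \<Longrightarrow> F a = 0"
  shows "F = 0"
proof
  fix a
  have "F b = 0" if "\<And>j. j \<in> J \<Longrightarrow> b j \<in> B" for b
  proof -
    have "F b = F (restrict b J)" by (rule multilinear_maps_cong[OF F]) auto
    then show ?thesis using zero that by auto
  qed
  then have "F a = 0"
    using multilinear_eq_0_on_span[OF J multilinear_maps_hom[OF F], of B a] B by auto
  then show "F a = 0 a" by simp
qed

text \<open>
  Only tuples of basis elements on which some monomial does not vanish contribute to the
  codimension.
\<close>

lemma gr_codim_le:
  assumes n: "n \<ge> 1" and B: "finite B" "span B = UNIV"
    and X: "finite X"
    and zero: "\<And>l a. distinct (map fst l) \<Longrightarrow> fst ` set l = {1..n} \<Longrightarrow> a \<in> {1..n} \<rightarrow>\<^sub>E B \<Longrightarrow>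
      a \<notin> X \<Longrightarrow> monomial_map l a = 0"
  shows "gr_codim n \<le> card X * card Basis"
  unfolding gr_codim_eq_dim[OF n]
proof (rule dim_function_space_le(2)[OF subspace_multilinear_maps X])
  fix F assume F: "F \<in> multilinear_maps {1..n}" and FX: "\<And>x. x \<in> X \<Longrightarrow> F x = 0"
  have "F a = 0" if a: "a \<in> {1..n} \<rightarrow>\<^sub>E B" "a \<notin> X" for a
    using F
    by (induction rule: multilinear_maps_induct) (use a zero in \<open>auto simp: fv.subspace_def fscale_def\<close>)
  then show "F = 0"
    using FX by (intro multilinear_maps_eq_0[OF F _ B(2)]) auto
qed

lemma multilinear_maps_finite_span:
  assumes "finite J"
  shows "\<exists>Y. finite Y \<and> multilinear_maps J \<subseteq> module.span (fscale scale) Y"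
proof (rule dim_function_space_le(1)[OF subspace_multilinear_maps])
  show "finite (J \<rightarrow>\<^sub>E Basis)" using assms finite_Basis by (intro finite_PiE)
  show "F = 0" if "F \<in> multilinear_maps J" "\<And>x. x \<in> J \<rightarrow>\<^sub>E Basis \<Longrightarrow> F x = 0" for F
    using that by (rule multilinear_maps_eq_0[OF _ assms span_Basis])
qed

end

section \<open>Traces and polynomials of endomorphisms\<close>

context finite_dimensional_vector_space
begin

abbreviation endo :: "('b \<Rightarrow> 'b) \<Rightarrow> bool" where
  "endo \<equiv> module_hom scale scale"

abbreviation coord :: "'b \<Rightarrow> 'b \<Rightarrow> 'a" where
  "coord b x \<equiv> representation Basis x b"

definition trace :: "('b \<Rightarrow> 'b) \<Rightarrow> 'a" where
  "trace f = (\<Sum>b\<in>Basis. coord b (f b))"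

lemma endoI: "(\<And>x y. f (x + y) = f x + f y) \<Longrightarrow> (\<And>c x. f (c *s x) = c *s f x) \<Longrightarrow> endo f"
  by (simp add: module_hom_iff module_axioms)

lemma coord_add: "coord b (x + y) = coord b x + coord b y"
  by (simp add: representation_add independent_Basis span_Basis)

lemma coord_scale: "coord b (c *s x) = c * coord b x"
  by (simp add: representation_scale independent_Basis span_Basis)

lemma coord_0: "coord b 0 = 0"
  by (simp add: representation_zero)

lemma coord_sum: "coord b (\<Sum>i\<in>I. f i) = (\<Sum>i\<in>I. coord b (f i))"
  by (simp add: representation_sum independent_Basis span_Basis)

lemma sum_coord: "(\<Sum>b\<in>Basis. coord b x *s b) = x"
  by (rule sum_representation_eq[OF independent_Basis _ finite_Basis]) (simp_all add: span_Basis)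

lemma coord_Basis: "c \<in> Basis \<Longrightarrow> coord b c = (if b = c then 1 else 0)"
  by (auto simp: representation_basis[OF independent_Basis])

lemma trace_add: "trace (\<lambda>x. f x + g x) = trace f + trace g"
  by (simp add: trace_def coord_add sum.distrib)

lemma trace_scale: "trace (\<lambda>x. c *s f x) = c * trace f"
  by (simp add: trace_def coord_scale sum_distrib_left)

lemma trace_0: "trace (\<lambda>x. 0) = 0"
  by (simp add: trace_def coord_0)

lemma trace_sum: "trace (\<lambda>x. \<Sum>i\<in>I. f i x) = (\<Sum>i\<in>I. trace (f i))"
  unfolding trace_def coord_sum by (rule sum.swap)

lemma trace_comm:
  assumes f: "endo f" and g: "endo g"
  shows "trace (\<lambda>x. f (g x)) = trace (\<lambda>x. g (f x))"
proof -
  have expand: "coord b (f x) = (\<Sum>c\<in>Basis. coord c x * coord b (f c))" if "endo f" for f b x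
  proof -
    have "f x = f (\<Sum>c\<in>Basis. coord c x *s c)" by (simp add: sum_coord)
    also have "\<dots> = (\<Sum>c\<in>Basis. coord c x *s f c)"
      by (simp add: module_hom.sum[OF that] module_hom.scale[OF that])
    finally show ?thesis by (simp add: coord_sum coord_scale)
  qed
  have "trace (\<lambda>x. f (g x)) = (\<Sum>b\<in>Basis. \<Sum>c\<in>Basis. coord c (g b) * coord b (f c))"
    unfolding trace_def by (intro sum.cong refl expand[OF f])
  also have "\<dots> = (\<Sum>c\<in>Basis. \<Sum>b\<in>Basis. coord b (f c) * coord c (g b))"
    by (subst sum.swap) (simp add: mult.commute)
  also have "\<dots> = trace (\<lambda>x. g (f x))"
    unfolding trace_def by (intro sum.cong refl expand[OF g, symmetric])
  finally show ?thesis .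
qed

lemma trace_rank_one:
  assumes "module_hom scale (*) \<phi>"
  shows "trace (\<lambda>x. \<phi> x *s u) = \<phi> u"
proof -
  have "\<phi> u = \<phi> (\<Sum>b\<in>Basis. coord b u *s b)" by (simp add: sum_coord)
  also have "\<dots> = (\<Sum>b\<in>Basis. coord b u * \<phi> b)"
    by (simp add: module_hom.sum[OF assms] module_hom.scale[OF assms])
  finally show ?thesis by (simp add: trace_def coord_scale mult.commute)
qed

text \<open>An idempotent is the sum of the rank one maps given by a basis of its range.\<close>

lemma trace_idempotent:
  assumes P: "endo P" and idem: "\<And>x. P (P x) = P x"
  shows "trace P = of_nat (dim (range P))"
proof -
  obtain U where U: "U \<subseteq> range P" "independent U" "range P \<subseteq> span U" "card U = dim (range P)"
    using basis_exists by blast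
  have fin: "finite U" using U(2) by (rule finiteI_independent)
  have in_span: "P x \<in> span U" for x using U(3) by auto
  have "P x = (\<Sum>u\<in>U. representation U (P x) u *s u)" for x
    by (rule sum_representation_eq[symmetric, OF U(2) in_span fin subset_refl])
  then have "trace P = trace (\<lambda>x. \<Sum>u\<in>U. representation U (P x) u *s u)" by presburger
  also have "\<dots> = (\<Sum>u\<in>U. representation U (P u) u)"
    unfolding trace_sum
  proof (rule sum.cong[OF refl], rule trace_rank_one)
    fix u
    show "module_hom scale (*) (\<lambda>x. representation U (P x) u)"
      by (simp add: module_hom_iff module_axioms module_times module_hom.add[OF P] module_hom.scale[OF P]
          representation_add[OF U(2)] representation_scale[OF U(2)] in_span)
  qed
  also have "\<dots> = (\<Sum>u\<in>U. 1)"
  proof (rule sum.cong[OF refl])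
    fix u assume u: "u \<in> U"
    then have "P u = u" using U(1) idem by auto
    then show "representation U (P u) u = 1" using u by (simp add: representation_basis[OF U(2)])
  qed
  finally show ?thesis using U(4) by simp
qed

text \<open>The value \<open>p(T)\<close> of the polynomial \<open>p\<close> at the endomorphism \<open>T\<close>.\<close>

definition poly_op :: "('b \<Rightarrow> 'b) \<Rightarrow> 'a poly \<Rightarrow> 'b \<Rightarrow> 'b" where
  "poly_op T p = fold_coeffs (\<lambda>a f v. a *s v + T (f v)) p (\<lambda>v. 0)"

context
  fixes T :: "'b \<Rightarrow> 'b" assumes T: "endo T"
begin

lemma poly_op_0: "poly_op T 0 v = 0"
  by (simp add: poly_op_def)

lemma poly_op_pCons: "poly_op T (pCons a p) v = a *s v + T (poly_op T p v)"
  by (cases "p = 0 \<and> a = 0")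
    (auto simp: poly_op_def module_hom.zero[OF T])

lemma poly_op_add: "poly_op T (p + q) v = poly_op T p v + poly_op T q v"
  by (induction p q rule: poly_induct2)
    (simp_all add: poly_op_0 poly_op_pCons scale_left_distrib module_hom.add[OF T] algebra_simps)

lemma poly_op_smult: "poly_op T (smult c p) v = c *s poly_op T p v"
  by (induction p) (simp_all add: poly_op_0 poly_op_pCons scale_right_distrib module_hom.scale[OF T])

lemma poly_op_endo: "endo (poly_op T p)"
proof (rule endoI)
  show "poly_op T p (x + y) = poly_op T p x + poly_op T p y" for x y
    by (induction p) (simp_all add: poly_op_0 poly_op_pCons scale_right_distrib module_hom.add[OF T])
  show "poly_op T p (c *s x) = c *s poly_op T p x" for c x
    by (induction p) (simp_all add: poly_op_0 poly_op_pCons scale_right_distrib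
        module_hom.scale[OF T] mult.commute)
qed

lemma poly_op_mult: "poly_op T (p * q) v = poly_op T p (poly_op T q v)"
  by (induction p) (simp_all add: poly_op_0 poly_op_pCons poly_op_add poly_op_smult)

lemma poly_op_monom: "poly_op T (monom c i) v = c *s (T ^^ i) v"
  by (induction i arbitrary: c)
    (simp_all add: monom_0 monom_Suc poly_op_pCons poly_op_0 module_hom.zero[OF T]
      module_hom.scale[OF T])

lemma poly_op_sum: "poly_op T (\<Sum>i\<in>I. p i) v = (\<Sum>i\<in>I. poly_op T (p i) v)"
  by (induction I rule: infinite_finite_induct) (simp_all add: poly_op_0 poly_op_add)

lemma poly_op_eigenvector: "T x = c *s x \<Longrightarrow> poly_op T p x = poly p c *s x"
  by (induction p) (simp_all add: poly_op_0 poly_op_pCons module_hom.scale[OF T] scale_left_distrib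
      mult.commute)

lemma family_dependent:
  fixes f :: "nat \<Rightarrow> 'b"
  shows "\<exists>u. (\<exists>i\<le>dimension. u i \<noteq> 0) \<and> (\<Sum>i\<le>dimension. u i *s f i) = 0"
proof (cases "inj_on f {..dimension}")
  case True
  have "dependent (f ` {..dimension})"
  proof (rule ccontr)
    assume "independent (f ` {..dimension})"
    then have "card (f ` {..dimension}) \<le> dimension"
      using independent_card_le_dim[of "f ` {..dimension}" UNIV] by (simp add: dimension_def)
    then show False using True by (simp add: card_image)
  qed
  then obtain u where u: "\<exists>v\<in>f ` {..dimension}. u v \<noteq> 0" "(\<Sum>v\<in>f ` {..dimension}. u v *s v) = 0"
    by (subst (asm) dependent_finite) auto
  then show ?thesis
    using True by (intro exI[of _ "\<lambda>i. u (f i)"]) (auto simp: sum.reindex)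
next
  case False
  then obtain i j where ij: "i \<le> dimension" "j \<le> dimension" "i \<noteq> j" "f i = f j"
    by (auto simp: inj_on_def)
  let ?u = "\<lambda>k. (if k = i then 1 else 0) - (if k = j then 1 else 0) :: 'a"
  have "(\<Sum>k\<le>dimension. ?u k *s f k)
      = (\<Sum>k\<le>dimension. (if k = i then f i else 0) - (if k = j then f j else 0))"
    by (rule sum.cong) (auto simp: scale_left_diff_distrib)
  also have "\<dots> = 0" using ij by (simp add: sum_subtractf)
  finally show ?thesis using ij by (intro exI[of _ ?u]) auto
qed

lemma annihilating_poly_of_vector: "\<exists>p. p \<noteq> 0 \<and> poly_op T p v = 0"
proof -
  obtain u i where u: "i \<le> dimension" "u i \<noteq> 0" "(\<Sum>i\<le>dimension. u i *s (T ^^ i) v) = 0"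
    using family_dependent[of "\<lambda>i. (T ^^ i) v"] by auto
  let ?p = "\<Sum>i\<le>dimension. monom (u i) i"
  have "coeff ?p i = u i" using u(1) by (simp add: coeff_sum)
  then have "?p \<noteq> 0" using u(2) by auto
  moreover have "poly_op T ?p v = 0" by (simp add: poly_op_sum poly_op_monom u(3))
  ultimately show ?thesis by blast
qed

lemma annihilating_poly: "\<exists>m. m \<noteq> 0 \<and> (\<forall>v. poly_op T m v = 0)"
proof -
  define p where "p b = (SOME p. p \<noteq> 0 \<and> poly_op T p b = 0)" for b
  have p: "p b \<noteq> 0" "poly_op T (p b) b = 0" for b
    using someI_ex[OF annihilating_poly_of_vector[of b]] by (auto simp: p_def)
  define m where "m = (\<Prod>b\<in>Basis. p b)"
  have "poly_op T m b = 0" if "b \<in> Basis" for b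
  proof -
    have "m = (\<Prod>c\<in>Basis - {b}. p c) * p b"
      unfolding m_def prod.remove[OF finite_Basis that] by (rule mult.commute)
    then show ?thesis
      by (simp only: poly_op_mult p module_hom.zero[OF poly_op_endo])
  qed
  then have "poly_op T m v = 0" for v
    by (rule module_hom.eq_0_on_span[OF poly_op_endo, of Basis]) (simp_all add: span_Basis)
  moreover have "m \<noteq> 0" using p finite_Basis by (simp add: m_def)
  ultimately show ?thesis by blast
qed

text \<open>
  If \<open>c\<close> is a root of an annihilating polynomial \<open>(X - c) q\<close> of \<open>v\<close> of minimal degree, then \<open>q(T) v\<close> is an
  eigenvector.
\<close>

lemma eigenvector_exists:
  fixes v :: 'b
  assumes closed: "\<And>p :: 'a poly. degree p > 0 \<Longrightarrow> \<exists>c. poly p c = 0" and v: "v \<noteq> 0"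
  shows "\<exists>c w. w \<noteq> 0 \<and> T w = c *s w"
proof -
  obtain p where p: "p \<noteq> 0" "poly_op T p v = 0"
    and min: "\<And>q. q \<noteq> 0 \<Longrightarrow> poly_op T q v = 0 \<Longrightarrow> degree p \<le> degree q"
    using annihilating_poly_of_vector[of v]
      ex_has_least_nat[of "\<lambda>p. p \<noteq> 0 \<and> poly_op T p v = 0" _ degree] by blast
  have "degree p > 0"
  proof (rule ccontr)
    assume "\<not> degree p > 0"
    then obtain c where "p = [:c:]" by (auto elim: degree_eq_zeroE)
    then show False using p v by (simp add: poly_op_pCons poly_op_0 module_hom.zero[OF T])
  qed
  then obtain c where "poly p c = 0" using closed by blast
  then obtain q where q: "p = [:- c, 1:] * q" by (auto simp: poly_eq_0_iff_dvd)
  then have "q \<noteq> 0" using p(1) by auto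
  then have "degree p = Suc (degree q)" using q by (simp add: degree_mult_eq del: mult_pCons_left)
  then have "poly_op T q v \<noteq> 0" using min[of q] \<open>q \<noteq> 0\<close> by auto
  moreover have "T (poly_op T q v) = c *s poly_op T q v"
    using p(2) unfolding q poly_op_mult by (simp add: poly_op_pCons poly_op_0 module_hom.zero[OF T])
  ultimately show ?thesis by blast
qed

text \<open>
  If \<open>T x = x \<noteq> 0\<close>, some polynomial without constant term takes \<open>T\<close> to a nonzero idempotent, the
  projection onto the generalised eigenspace for the eigenvalue \<open>1\<close>.
\<close>

lemma idempotent_poly:
  assumes x: "T x = x" "x \<noteq> 0"
  shows "\<exists>r. poly_op T (pCons 0 r) x = x \<and>
    (\<forall>v. poly_op T (pCons 0 r) (poly_op T (pCons 0 r) v) = poly_op T (pCons 0 r) v)"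
proof -
  let ?X1 = "[:- 1, 1:] :: 'a poly"
  obtain m where m: "m \<noteq> 0" "\<And>v. poly_op T m v = 0" using annihilating_poly by blast
  have ev: "poly_op T p x = poly p 1 *s x" for p using x by (intro poly_op_eigenvector) simp
  obtain q where q: "m = ?X1 ^ order 1 m * q" "\<not> ?X1 dvd q" using order_decomp[OF m(1)] by blast
  define k where "k = order 1 m"
  have "poly m 1 = 0" using ev[of m] m(2) x by simp
  then have k: "k > 0" using m(1) by (simp add: k_def order_root)
  have q1: "poly q 1 \<noteq> 0" using q(2) by (simp add: poly_eq_0_iff_dvd)
  \<comment> \<open>\<open>s \<equiv> 1\<close> modulo \<open>X - 1\<close>, so \<open>p \<equiv> 1\<close> modulo \<open>(X - 1)^k\<close>, while \<open>p\<close> is divisible by \<open>X q\<close>\<close>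
  define s where "s = smult (inverse (poly q 1)) (pCons 0 q)"
  define p where "p = 1 - (1 - s) ^ k"
  have s1: "poly s 1 = 1" using q1 by (simp add: s_def)
  then have "poly (1 - s) 1 = 0" by simp
  then have "?X1 dvd 1 - s" by (simp only: poly_eq_0_iff_dvd)
  then have "?X1 ^ k dvd (1 - s) ^ k" by (rule dvd_power_same)
  then obtain t where t: "(1 - s) ^ k = ?X1 ^ k * t" ..
  have "p = s * (\<Sum>i<k. (1 - s) ^ i)"
    using one_diff_power_eq[of "1 - s" k] by (simp add: p_def)
  then obtain y where y: "p = s * y" by blast
  have pX: "p = pCons 0 (smult (inverse (poly q 1)) q * y)"
    by (simp add: y s_def)
  have "p - p * p = p * (1 - s) ^ k" by (simp add: p_def algebra_simps)
  also have "\<dots> = m * (smult (inverse (poly q 1)) [:0, 1:] * y * t)"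
  proof -
    have "s = smult (inverse (poly q 1)) [:0, 1:] * q" by (simp add: s_def)
    then show ?thesis unfolding y t by (subst q(1)) (simp only: k_def mult_ac)
  qed
  finally have eq: "p - p * p = m * (smult (inverse (poly q 1)) [:0, 1:] * y * t)" .
  have "poly_op T (p - p * p) v = 0" for v
    unfolding eq poly_op_mult by (rule m(2))
  then have "poly_op T (p * p) v = poly_op T p v" for v
    using poly_op_add[of "p - p * p" "p * p" v] by simp
  then have "poly_op T p (poly_op T p v) = poly_op T p v" for v by (simp add: poly_op_mult)
  moreover have "poly p 1 = 1" using s1 k by (simp add: p_def)
  then have "poly_op T p x = x" using ev[of p] by simp
  ultimately show ?thesis
    by (intro exI[of _ "smult (inverse (poly q 1)) q * y"]) (simp only: pX[symmetric] simp_thms)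
qed

lemma trace_poly_op_0:
  assumes "\<And>i. trace (T ^^ Suc i) = 0"
  shows "trace (poly_op T (pCons 0 p)) = 0"
proof -
  have endo: "endo (T ^^ i)" for i
    by (induction i) (auto simp: module_hom_iff module_axioms module_hom.add[OF T] module_hom.scale[OF T])
  have "trace (\<lambda>v. (T ^^ Suc i) (poly_op T p v)) = 0" for i
  proof (induction p arbitrary: i)
    case 0
    then show ?case by (simp add: poly_op_0 module_hom.zero[OF endo] module_hom.zero[OF T] trace_0)
  next
    case (pCons a p)
    have "(T ^^ Suc i) (poly_op T (pCons a p) v)
        = a *s (T ^^ Suc i) v + (T ^^ Suc (Suc i)) (poly_op T p v)" for v
      unfolding poly_op_pCons module_hom.add[OF endo] module_hom.scale[OF endo]
      by (simp add: funpow_swap1)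
    then show ?case
      using pCons.IH[of "Suc i"] assms[of i] by (simp only: trace_add trace_scale) simp
  qed
  note powers = this[of 0]
  have "poly_op T (pCons 0 p) = (\<lambda>v. (T ^^ Suc 0) (poly_op T p v))"
    by (simp add: poly_op_pCons fun_eq_iff)
  then show ?thesis by (simp only: powers)
qed

text \<open>
  If the positive powers of \<open>T\<close> had trace \<open>0\<close>, so would the idempotent of \<open>idempotent_poly\<close>; but its
  trace is its rank, which is positive, and the characteristic is \<open>0\<close>.
\<close>

lemma trace_powers_eigenvalue_1:
  assumes char0: "\<And>n. of_nat n = (0 :: 'a) \<Longrightarrow> n = 0" and x: "T x = x" "x \<noteq> 0"
  shows "\<exists>i. trace (T ^^ Suc i) \<noteq> 0"
proof (rule ccontr)
  assume "\<nexists>i. trace (T ^^ Suc i) \<noteq> 0"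
  then have 0: "trace (poly_op T (pCons 0 r)) = 0" for r by (intro trace_poly_op_0) auto
  obtain r where r: "poly_op T (pCons 0 r) x = x"
    "\<And>v. poly_op T (pCons 0 r) (poly_op T (pCons 0 r) v) = poly_op T (pCons 0 r) v"
    using idempotent_poly[OF x] by blast
  have "of_nat (dim (range (poly_op T (pCons 0 r)))) = (0 :: 'a)"
    by (rule trans[OF trace_idempotent[OF poly_op_endo r(2), symmetric] 0])
  then have "dim (range (poly_op T (pCons 0 r))) = 0" by (rule char0)
  then have "range (poly_op T (pCons 0 r)) \<subseteq> {0}" by simp
  then have "poly_op T (pCons 0 r) x = 0" by blast
  then show False using r(1) x(2) by simp
qed

end

end

section \<open>The trace form\<close>

context fin_dim_graded_algebra
begin

lemma endo_left_mult: "endo (\<lambda>v. x * v)"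
  by (rule endoI) (simp_all add: distrib_left scale_mult_right)

definition tr :: "'a \<Rightarrow> 'f" where
  "tr x = trace (\<lambda>v. x * v)"

lemma tr_add: "tr (x + y) = tr x + tr y"
  by (simp add: tr_def distrib_right trace_add)

lemma tr_scale: "tr (c *s x) = c * tr x"
  by (simp add: tr_def scale_mult_left trace_scale)

lemma tr_hom: "module_hom scale (*) tr"
  by (simp add: module_hom_iff module_axioms module_times tr_add tr_scale)

lemma tr_comm: "tr (x * y) = tr (y * x)"
  using trace_comm[OF endo_left_mult[of x] endo_left_mult[of y]] by (simp add: tr_def mult.assoc)

text \<open>Multiplication by \<open>x\<close> moves each component to a different one, so it has no diagonal part.\<close>

lemma tr_homogeneous:
  assumes x: "x \<in> \<Gamma> g" and g: "g \<noteq> 0"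
  shows "tr x = 0"
proof -
  have zero: "trace (\<lambda>v. x * component h v) = 0" for h
  proof -
    have idem: "component h (component h v) = component h v" for v
      using component_homogeneous[OF component_in[of h v], of h] by simp
    have shift: "component h (x * component h v) = 0" for v
      using component_homogeneous[OF component_mult[OF x component_in[of h v]], of h] g by simp
    have "trace (\<lambda>v. (\<lambda>v. x * component h v) (component h v)) = trace (\<lambda>v. component h (x * component h v))"
      by (rule trace_comm[OF _ component_hom])
        (auto intro!: endoI simp: component_add component_scale distrib_left scale_mult_right)
    then show ?thesis by (simp add: idem shift trace_0)
  qed
  have "tr x = trace (\<lambda>v. x * (\<Sum>h\<in>support. component h v))"
    by (simp add: tr_def sum_component_support)
  also have "\<dots> = (\<Sum>h\<in>support. trace (\<lambda>v. x * component h v))"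
    by (simp add: sum_distrib_left trace_sum)
  finally show ?thesis by (simp add: zero)
qed

definition perp :: "'a set \<Rightarrow> 'a set" where
  "perp I = {x. \<forall>y\<in>I. tr (x * y) = 0}"

lemma subspace_perp: "subspace (perp I)"
  by (auto simp: subspace_def perp_def distrib_right scale_mult_left tr_add tr_scale
      module_hom.zero[OF tr_hom])

lemma sum_component_insert: "(\<Sum>k\<in>insert g support. component k x) = x"
  by (rule sum_component) (simp_all add: finite_support component_outside)

text \<open>
  By \<open>tr_homogeneous\<close>, the component of degree \<open>g\<close> of \<open>x\<close> is paired only with components of degree
  \<open>- g\<close>; so if \<open>x\<close> is orthogonal to the components of the elements of \<open>I\<close>, then so are its own
  components.
\<close>

lemma graded_ideal_perp:
  assumes "graded_ideal I"
  shows "graded_ideal (perp I)"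
  unfolding graded_ideal_iff
proof (intro conjI ballI allI subspace_perp)
  have I: "a * y \<in> I" "y * a \<in> I" "component g y \<in> I" if "y \<in> I" for a y g
    using assms that by (auto simp: graded_ideal_iff)
  fix x assume x: "x \<in> perp I"
  then have x0: "tr (x * y) = 0" if "y \<in> I" for y using that by (simp add: perp_def)
  show "a * x \<in> perp I" for a
    unfolding perp_def
  proof (intro CollectI ballI)
    fix y assume "y \<in> I"
    then show "tr (a * x * y) = 0"
      using x0[of "y * a"] I tr_comm[of a "x * y"] by (simp add: mult.assoc)
  qed
  show "x * a \<in> perp I" for a
    using x0 I by (auto simp: perp_def mult.assoc)
  show "component g x \<in> perp I" for g
    unfolding perp_def
  proof (intro CollectI ballI)
    fix y assume y: "y \<in> I"
    have off: "tr (component h x * component k y) = 0" if "h + k \<noteq> 0" for h k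
      by (rule tr_homogeneous[OF component_mult[OF component_in component_in] that])
    have "tr (component g x * y) = tr (component g x * (\<Sum>k\<in>insert (- g) support. component k y))"
      by (simp only: sum_component_insert)
    also have "\<dots> = (\<Sum>k\<in>insert (- g) support. tr (component g x * component k y))"
      by (simp only: sum_distrib_left module_hom.sum[OF tr_hom])
    also have "\<dots> = (\<Sum>k\<in>insert (- g) support. if k = - g then tr (component g x * component (- g) y) else 0)"
    proof (intro sum.cong refl)
      fix k
      show "tr (component g x * component k y)
          = (if k = - g then tr (component g x * component (- g) y) else 0)"
        using off[of g k] eq_neg_iff_add_eq_0[of k g] by (cases "k = - g") (simp_all add: add.commute)
    qed
    also have "\<dots> = tr (component g x * component (- g) y)"
      using finite_support by (simp only: sum.delta finite_insert insertI1 if_True)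
    finally have 1: "tr (component g x * y) = tr (component g x * component (- g) y)" .
    have "0 = tr (x * component (- g) y)" using x0 I y by simp
    also have "\<dots> = tr ((\<Sum>h\<in>insert g support. component h x) * component (- g) y)"
      by (simp only: sum_component_insert)
    also have "\<dots> = (\<Sum>h\<in>insert g support. tr (component h x * component (- g) y))"
      by (simp only: sum_distrib_right module_hom.sum[OF tr_hom])
    also have "\<dots> = (\<Sum>h\<in>insert g support. if h = g then tr (component g x * component (- g) y) else 0)"
    proof (intro sum.cong refl)
      fix h
      show "tr (component h x * component (- g) y)
          = (if h = g then tr (component g x * component (- g) y) else 0)"
        using off[of h "- g"] by simp
    qed
    also have "\<dots> = tr (component g x * component (- g) y)"
      using finite_support by (simp only: sum.delta finite_insert insertI1 if_True)
    finally show "tr (component g x * y) = 0" using 1 by simp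
  qed
qed

text \<open>
  For a basis \<open>C\<close> of \<open>I\<close>, the kernel of \<open>x \<mapsto> (\<Sum>y\<in>C. tr (x y) y)\<close> is the complement of \<open>I\<close>
  and its range lies in \<open>I\<close>; if it were injective, it would be surjective.
\<close>

lemma perp_nonzero:
  assumes I: "subspace I" "I \<noteq> UNIV"
  shows "perp I \<noteq> {0}"
proof
  assume 0: "perp I = {0}"
  obtain C where C: "C \<subseteq> I" "independent C" "I \<subseteq> span C"
    using basis_exists[of I] by metis
  define f where "f x = (\<Sum>y\<in>C. tr (x * y) *s y)" for x
  have f: "endo f"
  proof (rule endoI)
    show "f (x + y) = f x + f y" for x y
      by (simp add: f_def distrib_right tr_add scale_left_distrib sum.distrib)
    show "f (c *s x) = c *s f x" for c x
      by (simp add: f_def scale_mult_left tr_scale scale_sum_right)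
  qed
  have "\<forall>x. f x = 0 \<longrightarrow> x = 0"
  proof (intro allI impI)
    fix x assume "f x = 0"
    have tr0: "tr (x * y) = 0" if "y \<in> C" for y
      using \<open>f x = 0\<close> unfolding f_def
      by (rule independentD[where u = "\<lambda>y. tr (x * y)",
            OF C(2) finiteI_independent[OF C(2)] subset_refl _ that])
    have "tr (x * y) = 0" if "y \<in> span C" for y
    proof -
      have "module_hom scale (*) (\<lambda>y. tr (x * y))"
        by (simp add: module_hom_iff module_axioms module_times distrib_left scale_mult_right
            tr_add tr_scale)
      then show ?thesis using tr0 that by (rule module_hom.eq_0_on_span)
    qed
    then have "x \<in> perp I" unfolding perp_def using C(3) by blast
    then show "x = 0" using 0 by simp
  qed
  then have "inj f" by (simp only: module_hom.inj_iff_eq_0[OF f])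
  then have "surj f"
    by (rule linear_inj_imp_surj[OF f[unfolded module_hom_iff_linear]])
  moreover have "f x \<in> I" for x
    unfolding f_def by (rule subspace_sum[OF I(1)], rule subspace_scale[OF I(1)], rule subsetD[OF C(1)])
  then have "range f \<subseteq> I" by blast
  ultimately have "UNIV \<subseteq> I" by simp
  then show False using I(2) by blast
qed

text \<open>
  If \<open>M = M\<^sup>2\<close> were nonzero, a minimal left ideal \<open>L\<close> with
  \<open>M L \<noteq> 0\<close> would equal \<open>M x\<close> for some \<open>x \<in> L\<close>, so \<open>a x = x\<close> for some \<open>a \<in> M\<close>; but the
  powers of the multiplication by \<open>a\<close> all have trace \<open>0\<close>.
\<close>

lemma trace_form_zero_imp_zero:
  assumes char0: "\<And>n. of_nat n = (0 :: 'f) \<Longrightarrow> n = 0"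
    and M: "subspace M" "\<And>x y. x \<in> M \<Longrightarrow> y \<in> M \<Longrightarrow> x * y \<in> M"
    and square: "M \<subseteq> span {x * y | x y. x \<in> M \<and> y \<in> M}"
    and tr0: "\<And>x y. x \<in> M \<Longrightarrow> y \<in> M \<Longrightarrow> tr (x * y) = 0"
  shows "M = {0}"
proof (rule ccontr)
  assume "M \<noteq> {0}"
  then obtain z where z: "z \<in> M" "z \<noteq> 0" using subspace_0[OF M(1)] by blast
  have trM: "tr x = 0" if "x \<in> M" for x
  proof (rule module_hom.eq_0_on_span[OF tr_hom])
    show "x \<in> span {x * y | x y. x \<in> M \<and> y \<in> M}" using that square by blast
    show "tr p = 0" if "p \<in> {x * y | x y. x \<in> M \<and> y \<in> M}" for p
      using that tr0 by blast
  qed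
  define good where "good L \<longleftrightarrow> subspace L \<and> L \<subseteq> M \<and> (\<forall>m\<in>M. \<forall>x\<in>L. m * x \<in> L)
    \<and> (\<exists>m\<in>M. \<exists>x\<in>L. m * x \<noteq> 0)" for L
  have right_endo: "endo (\<lambda>m. m * x)" for x
    by (rule endoI) (simp_all add: distrib_right scale_mult_left)
  have "good M"
  proof -
    have "\<exists>m\<in>M. \<exists>x\<in>M. m * x \<noteq> 0"
    proof (rule ccontr)
      assume "\<not> ?thesis"
      then have "{x * y | x y. x \<in> M \<and> y \<in> M} \<subseteq> {0}" by auto
      then have "span {x * y | x y. x \<in> M \<and> y \<in> M} \<subseteq> {0}"
        by (intro span_minimal) auto
      then show False using square z by auto
    qed
    then show ?thesis using M by (simp add: good_def)
  qed
  then obtain L where L: "good L" and min: "\<And>K. good K \<Longrightarrow> dim L \<le> dim K"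
    using ex_has_least_nat[of good M dim] by blast
  then obtain m x where m: "m \<in> M" and x: "x \<in> L" and mx: "m * x \<noteq> 0"
    by (auto simp: good_def)
  define K where "K = (\<lambda>m. m * x) ` M"
  have "good K"
    unfolding good_def
  proof (intro conjI)
    show "subspace K"
      unfolding K_def using M(1) by (rule module_hom.subspace_image[OF right_endo])
    show "K \<subseteq> M" using L x by (auto simp: K_def good_def)
    show "\<forall>m\<in>M. \<forall>y\<in>K. m * y \<in> K"
    proof (intro ballI)
      fix m y assume m: "m \<in> M" and "y \<in> K"
      then obtain n where "n \<in> M" "m * y = (m * n) * x" by (auto simp: K_def mult.assoc)
      then show "m * y \<in> K" unfolding K_def using M(2)[OF m] by blast
    qed
    show "\<exists>m\<in>M. \<exists>y\<in>K. m * y \<noteq> 0"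
    proof (rule ccontr)
      assume "\<not> ?thesis"
      then have 0: "p * x = 0" if "p \<in> {x * y | x y. x \<in> M \<and> y \<in> M}" for p
        using that by (auto simp: K_def mult.assoc)
      have "m * x = 0"
        by (rule module_hom.eq_0_on_span[OF right_endo 0]) (use m square in blast)+
      then show False using mx by simp
    qed
  qed
  moreover have "K \<subseteq> L" using L x by (auto simp: K_def good_def)
  moreover have "subspace K" "subspace L" using \<open>good K\<close> L by (simp_all add: good_def)
  ultimately have "K = L"
    using min[OF \<open>good K\<close>] by (intro subspace_dim_equal)
  then obtain a where a: "a \<in> M" "a * x = x" using x by (auto simp: K_def)
  have "x \<noteq> 0" using mx by auto
  have pow: "\<exists>b\<in>M. (\<lambda>v. a * v) ^^ Suc i = (\<lambda>v. b * v)" for i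
  proof (induction i)
    case 0
    then show ?case using a(1) by (intro bexI[of _ a]) auto
  next
    case (Suc i)
    then obtain b where b: "b \<in> M" "(\<lambda>v. a * v) ^^ Suc i = (\<lambda>v. b * v)" by blast
    have "(\<lambda>v. a * v) ^^ Suc (Suc i) = (\<lambda>v. a * b * v)"
      unfolding funpow.simps(2)[of "Suc i"] b(2) by (simp add: fun_eq_iff mult.assoc)
    then show ?case using M(2)[OF a(1) b(1)] by blast
  qed
  obtain i where i: "trace ((\<lambda>v. a * v) ^^ Suc i) \<noteq> 0"
    using trace_powers_eigenvalue_1[OF endo_left_mult char0 a(2) \<open>x \<noteq> 0\<close>] by blast
  obtain b where "b \<in> M" "(\<lambda>v. a * v) ^^ Suc i = (\<lambda>v. b * v)" using pow by blast
  then show False using i trM by (simp add: tr_def del: funpow.simps)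
qed

lemma graded_ideal_square:
  assumes "graded_ideal N"
  shows "graded_ideal (span {x * y | x y. x \<in> N \<and> y \<in> N})" (is "graded_ideal (span ?P)")
proof -
  have N: "a * y \<in> N" "y * a \<in> N" "component g y \<in> N" if "y \<in> N" for a y g
    using assms that by (auto simp: graded_ideal_iff)
  have "p \<in> span ?P \<Longrightarrow> a * p \<in> span ?P \<and> p * a \<in> span ?P \<and> component g p \<in> span ?P" for p a g
  proof (induction p rule: span_induct)
    case base
    show ?case
      by (auto simp: subspace_def span_zero span_add span_scale distrib_left distrib_right
          scale_mult_left scale_mult_right component_add component_scale)
  next
    case (step p)
    then obtain x y where p: "p = x * y" "x \<in> N" "y \<in> N" by auto
    have "a * p = (a * x) * y" "p * a = x * (y * a)" by (simp_all add: p mult.assoc)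
    then have 1: "a * p \<in> ?P" "p * a \<in> ?P" using N p by blast+
    have "p = (\<Sum>h\<in>support. component h x) * (\<Sum>k\<in>support. component k y)"
      by (simp add: p sum_component_support)
    also have "\<dots> = (\<Sum>h\<in>support. \<Sum>k\<in>support. component h x * component k y)"
      by (simp add: sum_product)
    finally have "component g p = (\<Sum>h\<in>support. \<Sum>k\<in>support. component g (component h x * component k y))"
      by (simp only: module_hom.sum[OF component_hom])
    also have "\<dots> = (\<Sum>h\<in>support. \<Sum>k\<in>support. if g = h + k then component h x * component k y else 0)"
      by (intro sum.cong refl component_homogeneous component_mult component_in)
    also have "\<dots> \<in> span ?P"
    proof (intro span_sum)
      fix h k
      have "component h x * component k y \<in> ?P" using N p by blast
      then show "(if g = h + k then component h x * component k y else 0) \<in> span ?P"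
        by (simp add: span_base span_zero)
    qed
    finally have "component g p \<in> span ?P" .
    then show ?case using span_base[OF 1(1)] span_base[OF 1(2)] by blast
  qed
  then show ?thesis unfolding graded_ideal_iff using subspace_span by blast
qed

text \<open>
  A minimal nonzero graded ideal on which the trace form vanishes is not its own square, so its
  square is zero.
\<close>

lemma square_zero_ideal_exists:
  assumes char0: "\<And>n. of_nat n = (0 :: 'f) \<Longrightarrow> n = 0"
    and I: "graded_ideal I" "I \<noteq> {0}" "\<And>x y. x \<in> I \<Longrightarrow> y \<in> I \<Longrightarrow> tr (x * y) = 0"
  shows "\<exists>N. graded_ideal N \<and> N \<noteq> {0} \<and> (\<forall>x\<in>N. \<forall>y\<in>N. x * y = 0)"
proof -
  define good where "good N \<longleftrightarrow> graded_ideal N \<and> N \<noteq> {0} \<and> (\<forall>x\<in>N. \<forall>y\<in>N. tr (x * y) = 0)" for N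
  have "good I" using I by (simp add: good_def)
  then obtain N where N: "good N" and min: "\<And>K. good K \<Longrightarrow> dim N \<le> dim K"
    using ex_has_least_nat[of good I dim] by blast
  let ?S = "span {x * y | x y. x \<in> N \<and> y \<in> N}"
  have gi: "graded_ideal N" using N by (simp add: good_def)
  then have sub: "subspace N" and mult: "\<And>x y. x \<in> N \<Longrightarrow> y \<in> N \<Longrightarrow> x * y \<in> N"
    by (auto simp: graded_ideal_iff)
  have S: "?S \<subseteq> N" using mult by (intro span_minimal sub) auto
  have "?S = {0}"
  proof (rule ccontr)
    assume "?S \<noteq> {0}"
    then have "good ?S" using N S graded_ideal_square[OF gi] by (auto simp: good_def)
    then have "?S = N" using min by (intro subspace_dim_equal[OF subspace_span sub S])
    then have "N = {0}"
      using trace_form_zero_imp_zero[OF char0 sub mult] N by (auto simp: good_def)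
    then show False using N by (simp add: good_def)
  qed
  then have "x * y = 0" if "x \<in> N" "y \<in> N" for x y
    using span_base[of "x * y" "{x * y | x y. x \<in> N \<and> y \<in> N}"] that by blast
  then show ?thesis using N by (auto simp: good_def)
qed

text \<open>Otherwise the trace form is zero on the whole algebra, which is its own square.\<close>

lemma trace_form_nondegenerate:
  assumes char0: "\<And>n. of_nat n = (0 :: 'f) \<Longrightarrow> n = 0" and simple: graded_simple
  shows "perp UNIV = {0}"
proof -
  have UNIV: "graded_ideal UNIV" by (auto simp: graded_ideal_iff)
  have square: "span {x * y | x y. True} \<noteq> {0}"
    and ideals: "\<And>I. graded_ideal I \<Longrightarrow> I = {0} \<or> I = UNIV"
    using simple by (simp_all add: graded_simple_def)
  have "graded_ideal (span {x * y | x y. True})" using graded_ideal_square[OF UNIV] by simp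
  from ideals[OF this] square have full: "span {x * y | x y. True} = UNIV" by blast
  show ?thesis
  proof (rule ccontr)
    assume "perp UNIV \<noteq> {0}"
    then have "perp UNIV = UNIV" using ideals[OF graded_ideal_perp[OF UNIV]] by blast
    then have tr0: "tr (x * y) = 0" for x y unfolding perp_def by blast
    have "UNIV = {0 :: 'a}"
      by (rule trace_form_zero_imp_zero[OF char0]) (simp_all add: full[simplified] tr0)
    then have "span {x * y | x y. True} \<subseteq> {0}" by simp
    then show False using square span_zero by blast
  qed
qed

end

section \<open>The upper bound for algebras that are not graded simple\<close>

lemma root_power_bound_tendsto:
  assumes "C > 0" "q \<ge> 0"
  shows "(\<lambda>n. root n (C * q ^ n)) \<longlonglongrightarrow> q"
proof -
  have "(\<lambda>n. root n C * q) \<longlonglongrightarrow> 1 * q"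
    using assms by (intro tendsto_intros LIMSEQ_root_const)
  then have "(\<lambda>n. root n C * q) \<longlonglongrightarrow> q" by simp
  then show ?thesis
  proof (rule Lim_transform_eventually)
    show "\<forall>\<^sub>F n in sequentially. root n C * q = root n (C * q ^ n)"
      by (rule eventually_mono[OF eventually_gt_at_top[of 0]])
        (use assms in \<open>simp add: real_root_mult real_root_power_cancel\<close>)
  qed
qed

text \<open>
  Give each tuple the weight \<open>1/2\<close> per occurrence of \<open>x\<close>. The tuples in question have weight at least
  \<open>1/2\<close>, and the weights of all tuples add up to a power of \<open>card B - 1/2\<close>.
\<close>

lemma card_tuples_occurring_once_le:
  assumes B: "finite B" "x \<in> B" and J: "finite J"
  shows "real (card {a \<in> J \<rightarrow>\<^sub>E B. card {j \<in> J. a j = x} \<le> 1})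
    \<le> 2 * (real (card B) - 1 / 2) ^ card J"
proof -
  define w where "w b = (if b = x then 1 / 2 else 1 :: real)" for b
  let ?X = "{a \<in> J \<rightarrow>\<^sub>E B. card {j \<in> J. a j = x} \<le> 1}"
  have fin: "finite (J \<rightarrow>\<^sub>E B)" using J B by (intro finite_PiE)
  have "1 / 2 \<le> (\<Prod>j\<in>J. w (a j))" if "a \<in> ?X" for a
  proof -
    have "(\<Prod>j\<in>J. w (a j)) = (\<Prod>j\<in>{j \<in> J. a j = x}. 1 / 2)"
      using J by (simp add: w_def prod.If_cases Int_def)
    also have "\<dots> = (1 / 2) ^ card {j \<in> J. a j = x}" by simp
    also have "\<dots> \<ge> (1 / 2) ^ 1" using that by (intro power_decreasing) auto
    finally show ?thesis by simp
  qed
  then have "(\<Sum>a\<in>?X. 1 / 2) \<le> (\<Sum>a\<in>?X. \<Prod>j\<in>J. w (a j))"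
    by (rule sum_mono)
  also have "\<dots> \<le> (\<Sum>a\<in>J \<rightarrow>\<^sub>E B. \<Prod>j\<in>J. w (a j))"
    using fin by (intro sum_mono2) (auto intro!: prod_nonneg simp: w_def)
  also have "\<dots> = (\<Prod>j\<in>J. \<Sum>b\<in>B. w b)"
    using J B by (intro prod_sum_PiE[symmetric])
  also have "(\<Sum>b\<in>B. w b) = (\<Sum>b\<in>B. 1 - (if b = x then 1 / 2 else 0))"
    by (intro sum.cong) (auto simp: w_def)
  also have "\<dots> = real (card B) - 1 / 2"
    using B by (simp add: sum_subtractf)
  finally show ?thesis by simp
qed

context fin_dim_graded_algebra
begin

lemma monomial_map_in_ideal:
  assumes N: "graded_ideal N" and "j \<in> fst ` set l" "a j \<in> N"
  shows "monomial_map l a \<in> N"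
  using assms(2)
proof (induction l)
  case (Cons p l)
  have I: "b * y \<in> N" "y * b \<in> N" "component g y \<in> N" if "y \<in> N" for b y g
    using N that by (auto simp: graded_ideal_iff)
  obtain i g where p: "p = (i, g)" by force
  show ?case
  proof (cases "l = []")
    case True
    then show ?thesis using Cons.prems assms(3) I by (simp add: p monomial_map_single)
  next
    case False
    then show ?thesis using Cons assms(3) I by (auto simp: p monomial_map_Cons)
  qed
qed simp

lemma monomial_map_orthogonal_ideals:
  assumes N: "graded_ideal N" and K: "graded_ideal K"
    and zero: "\<And>x y. x \<in> N \<Longrightarrow> y \<in> K \<Longrightarrow> x * y = 0" "\<And>x y. x \<in> N \<Longrightarrow> y \<in> K \<Longrightarrow> y * x = 0"
    and ij: "i \<in> fst ` set l" "j \<in> fst ` set l" "i \<noteq> j" and a: "a i \<in> N" "a j \<in> K"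
  shows "monomial_map l a = 0"
  using ij(1,2)
proof (induction l)
  case (Cons p l)
  obtain m g where p: "p = (m, g)" by force
  have ne: "l \<noteq> []" using Cons.prems ij(3) by (auto simp: p)
  have comp: "component g (a i) \<in> N" "component g (a j) \<in> K"
    using N K a by (auto simp: graded_ideal_iff)
  consider "m = i" | "m = j" | "m \<noteq> i" "m \<noteq> j" by blast
  then show ?case
  proof cases
    case 1
    then have "monomial_map l a \<in> K"
      using Cons.prems ij(3) a by (intro monomial_map_in_ideal[OF K, of j]) (auto simp: p)
    then show ?thesis using 1 zero(1)[OF comp(1)] by (simp add: p monomial_map_Cons[OF ne])
  next
    case 2
    then have "monomial_map l a \<in> N"
      using Cons.prems ij(3) a by (intro monomial_map_in_ideal[OF N, of i]) (auto simp: p)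
    then show ?thesis using 2 zero(2)[OF _ comp(2)] by (simp add: p monomial_map_Cons[OF ne])
  next
    case 3
    then have "monomial_map l a = 0" using Cons.prems by (intro Cons.IH) (auto simp: p)
    then show ?thesis by (simp add: p monomial_map_Cons[OF ne])
  qed
qed simp

lemma basis_extending:
  assumes "independent S"
  obtains B where "S \<subseteq> B" "finite B" "span B = UNIV" "card B = dimension"
proof -
  obtain B where B: "S \<subseteq> B" "independent B" "UNIV \<subseteq> span B"
    using maximal_independent_subset_extend[of S UNIV] assms by auto
  then have "card B = dimension" using dim_unique[of B UNIV dimension] basis_card_eq_dim[of B UNIV]
    by (simp add: dimension_def)
  then show ?thesis using that[of B] B finiteI_independent by auto
qed

text \<open>Extend some \<open>x \<in> N\<close> to a basis: monomials in which \<open>x\<close> occurs twice vanish.\<close>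

lemma gr_codim_le_square_zero:
  assumes N: "graded_ideal N" "N \<noteq> {0}" and zero: "\<And>x y. x \<in> N \<Longrightarrow> y \<in> N \<Longrightarrow> x * y = 0"
    and n: "n \<ge> 1"
  shows "real (gr_codim n) \<le> 2 * real dimension * (real dimension - 1 / 2) ^ n"
proof -
  have "0 \<in> N" using N by (auto simp: graded_ideal_iff subspace_0)
  then obtain x where x: "x \<in> N" "x \<noteq> 0" using N(2) by blast
  obtain B where B: "{x} \<subseteq> B" "finite B" "span B = UNIV" "card B = dimension"
    by (rule basis_extending[of "{x}"]) (use x(2) in simp)
  let ?X = "{a \<in> {1..n} \<rightarrow>\<^sub>E B. card {j \<in> {1..n}. a j = x} \<le> 1}"
  have "gr_codim n \<le> card ?X * card Basis"
  proof (rule gr_codim_le[OF n B(2,3)])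
    show "finite ?X"
      by (rule finite_subset[of _ "{1..n} \<rightarrow>\<^sub>E B"]) (use B(2) in \<open>auto intro: finite_PiE\<close>)
    fix l :: "(nat \<times> 'g) list" and a assume l: "distinct (map fst l)" "fst ` set l = {1..n}"
      and a: "a \<in> {1..n} \<rightarrow>\<^sub>E B" "a \<notin> ?X"
    have "\<not> card {j \<in> {1..n}. a j = x} \<le> Suc 0" using a by simp
    then obtain i j where ij: "i \<in> {1..n}" "j \<in> {1..n}" "i \<noteq> j" "a i = x" "a j = x"
      by (subst (asm) card_le_Suc0_iff_eq) auto
    show "monomial_map l a = 0"
    proof (rule monomial_map_orthogonal_ideals[OF N(1) N(1)])
      show "i \<in> fst ` set l" "j \<in> fst ` set l" using l ij by simp_all
      show "a i \<in> N" "a j \<in> N" using ij x by simp_all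
    qed (rule zero ij(3); assumption)+
  qed
  then have "real (gr_codim n) \<le> real (card ?X) * real dimension"
    unfolding dimension_def by (simp only: of_nat_le_iff flip: of_nat_mult)
  also have "\<dots> \<le> (2 * (real dimension - 1 / 2) ^ n) * real dimension"
    using card_tuples_occurring_once_le[OF B(2), of x "{1..n}"] B by (intro mult_right_mono) auto
  finally show ?thesis by (simp add: mult_ac)
qed

text \<open>
  Extend some \<open>x \<in> I\<close> and \<open>y \<in> K\<close> to a basis: monomials in which both \<open>x\<close> and \<open>y\<close> occur vanish, so one
  of the two is never used.
\<close>

lemma gr_codim_le_orthogonal:
  assumes I: "graded_ideal I" "I \<noteq> {0}" and K: "graded_ideal K" "K \<noteq> {0}" and IK: "I \<inter> K = {0}"
    and n: "n \<ge> 1"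
  shows "real (gr_codim n) \<le> 2 * real dimension * (real dimension - 1) ^ n"
proof -
  have 0: "0 \<in> I" "0 \<in> K" using I K by (auto simp: graded_ideal_iff subspace_0)
  obtain x where x: "x \<in> I" "x \<noteq> 0" using I(2) 0 by blast
  obtain y where y: "y \<in> K" "y \<noteq> 0" using K(2) 0 by blast
  have "y \<notin> span {x}"
  proof
    assume "y \<in> span {x}"
    moreover have "span {x} \<subseteq> I" using I x by (intro span_minimal) (auto simp: graded_ideal_iff)
    ultimately have "y \<in> I \<inter> K" using y by blast
    then show False using IK y by simp
  qed
  moreover have "independent {x}" using x by simp
  ultimately have "independent {y, x}" by (rule independent_insertI)
  then obtain B where B: "{y, x} \<subseteq> B" "finite B" "span B = UNIV" "card B = dimension"
    by (rule basis_extending)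
  let ?X = "({1..n} \<rightarrow>\<^sub>E B - {x}) \<union> ({1..n} \<rightarrow>\<^sub>E B - {y})"
  have "gr_codim n \<le> card ?X * card Basis"
  proof (rule gr_codim_le[OF n B(2,3)])
    show "finite ?X" using B(2) by (auto intro: finite_PiE)
    fix l :: "(nat \<times> 'g) list" and a assume l: "distinct (map fst l)" "fst ` set l = {1..n}"
      and a: "a \<in> {1..n} \<rightarrow>\<^sub>E B" "a \<notin> ?X"
    then obtain i j where ij: "i \<in> {1..n}" "j \<in> {1..n}" "a i = x" "a j = y"
      by (auto simp: PiE_def Pi_def)
    have "x \<noteq> y" using IK x y by blast
    have zero: "u * v = 0" "v * u = 0" if "u \<in> I" "v \<in> K" for u v
    proof -
      have "u * v \<in> I \<inter> K" "v * u \<in> I \<inter> K"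
        using I(1) K(1) that by (simp_all add: graded_ideal_iff)
      then show "u * v = 0" "v * u = 0" unfolding IK by simp_all
    qed
    show "monomial_map l a = 0"
    proof (rule monomial_map_orthogonal_ideals[OF I(1) K(1) zero])
      show "i \<in> fst ` set l" "j \<in> fst ` set l" using l ij by simp_all
      show "i \<noteq> j" using ij \<open>x \<noteq> y\<close> by blast
      show "a i \<in> I" "a j \<in> K" using ij x y by simp_all
    qed
  qed
  also have "card ?X \<le> card ({1..n} \<rightarrow>\<^sub>E B - {x}) + card ({1..n} \<rightarrow>\<^sub>E B - {y})"
    by (rule card_Un_le)
  also have "\<dots> = 2 * (dimension - 1) ^ n"
    using B by (simp add: card_PiE)
  finally have "gr_codim n \<le> 2 * (dimension - 1) ^ n * dimension"
    by (simp add: dimension_def)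
  moreover have "dimension \<ge> 1"
  proof -
    have "0 < card B" using B(1,2) by (auto simp: card_gt_0_iff)
    then show ?thesis using B(4) by simp
  qed
  then have "real (2 * (dimension - 1) ^ n * dimension) = 2 * (real dimension - 1) ^ n * real dimension"
    by (simp add: of_nat_diff)
  ultimately have "real (gr_codim n) \<le> 2 * (real dimension - 1) ^ n * real dimension"
    by (metis of_nat_le_iff)
  then show ?thesis by (simp add: mult_ac)
qed

text \<open>
  A proper nonzero graded ideal \<open>I\<close> either meets its complement for the trace form, and then a
  graded ideal of square zero exists, or annihilates that complement.
\<close>

lemma not_graded_simple_cases:
  assumes char0: "\<And>n. of_nat n = (0 :: 'f) \<Longrightarrow> n = 0"
    and nonzero: "(UNIV :: 'a set) \<noteq> {0}" and "\<not> graded_simple"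
  obtains (square_zero) N where "graded_ideal N" "N \<noteq> {0}" "\<And>x y. x \<in> N \<Longrightarrow> y \<in> N \<Longrightarrow> x * y = 0"
  | (orthogonal) I K where "graded_ideal I" "I \<noteq> {0}" "graded_ideal K" "K \<noteq> {0}" "I \<inter> K = {0}"
proof (cases "span {x * y | x y. True} = {0 :: 'a}")
  case True
  have "graded_ideal UNIV" by (simp add: graded_ideal_iff)
  moreover have "x * y = 0" for x y :: 'a
  proof -
    have "x * y \<in> span {x * y | x y. True}" by (rule span_base) blast
    then show ?thesis using True by blast
  qed
  ultimately show ?thesis using nonzero square_zero by blast
next
  case False
  then obtain I where I: "graded_ideal I" "I \<noteq> {0}" "I \<noteq> UNIV"
    using assms(3) by (auto simp: graded_simple_def)
  have K: "graded_ideal (perp I)" by (rule graded_ideal_perp[OF I(1)])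
  have sub: "subspace I" using I(1) by (simp add: graded_ideal_iff)
  show ?thesis
  proof (cases "I \<inter> perp I = {0}")
    case True
    then show ?thesis using orthogonal I K perp_nonzero[OF sub I(3)] by blast
  next
    case False
    have "graded_ideal (I \<inter> perp I)"
      using I(1) K by (simp add: graded_ideal_iff subspace_inter)
    moreover have "tr (x * y) = 0" if "x \<in> I \<inter> perp I" "y \<in> I \<inter> perp I" for x y
      using that by (simp add: perp_def)
    ultimately show ?thesis
      using square_zero_ideal_exists[OF char0 _ False] square_zero by blast
  qed
qed

theorem gr_PI_exponent_less_of_not_graded_simple:
  assumes char0: "\<And>n. of_nat n = (0 :: 'f) \<Longrightarrow> n = 0"
    and nonzero: "(UNIV :: 'a set) \<noteq> {0}" and "\<not> graded_simple"
  shows "\<not> has_gr_PI_exponent (real dimension)"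
proof
  assume lim: "has_gr_PI_exponent (real dimension)"
  have "Basis \<noteq> {}" using span_Basis nonzero by auto
  then have d: "dimension \<ge> 1" using finite_Basis by (simp add: dimension_def Suc_le_eq card_gt_0_iff)
  have bound: "real (gr_codim n) \<le> 2 * real dimension * (real dimension - 1 / 2) ^ n" if "n \<ge> 1" for n
  proof (rule not_graded_simple_cases[OF assms])
    fix N assume "graded_ideal N" "N \<noteq> {0}" "\<And>x y. x \<in> N \<Longrightarrow> y \<in> N \<Longrightarrow> x * y = 0"
    then show ?thesis by (rule gr_codim_le_square_zero[OF _ _ _ that])
  next
    fix I K assume "graded_ideal I" "I \<noteq> {0}" "graded_ideal K" "K \<noteq> {0}" "I \<inter> K = {0}"
    then have "real (gr_codim n) \<le> 2 * real dimension * (real dimension - 1) ^ n"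
      by (rule gr_codim_le_orthogonal[OF _ _ _ _ _ that])
    also have "\<dots> \<le> 2 * real dimension * (real dimension - 1 / 2) ^ n"
      using d by (intro mult_left_mono power_mono) auto
    finally show ?thesis .
  qed
  have upper: "(\<lambda>n. root n (2 * real dimension * (real dimension - 1 / 2) ^ n)) \<longlonglongrightarrow> real dimension - 1 / 2"
    using d by (intro root_power_bound_tendsto) auto
  have "\<exists>N. \<forall>n\<ge>N. root n (real (gr_codim n))
      \<le> root n (2 * real dimension * (real dimension - 1 / 2) ^ n)"
    using bound by (intro exI[of _ 1] allI impI real_root_le_mono) auto
  then have "real dimension \<le> real dimension - 1 / 2"
    by (rule LIMSEQ_le[OF lim[unfolded has_gr_PI_exponent_def] upper])
  then show False by simp
qed

end

section \<open>Density and a nonzero alternating multilinear map\<close>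

lemma word_eval_eq_0: "x \<in> set l \<Longrightarrow> \<phi> x = 0 \<Longrightarrow> word_eval \<phi> (Word l) = 0"
proof (induction l)
  case (Cons y l)
  then show ?case by (cases l) auto
qed simp

lemma word_eval_cong: "(\<And>x. x \<in> set l \<Longrightarrow> \<phi> x = \<psi> x) \<Longrightarrow> word_eval \<phi> (Word l) = word_eval \<psi> (Word l)"
proof (induction l)
  case (Cons y l)
  then show ?case by (cases l) auto
qed simp

lemma word_eval_snoc: "l \<noteq> [] \<Longrightarrow> word_eval \<phi> (Word (l @ [x])) = word_eval \<phi> (Word l) * \<phi> x"
proof (induction l rule: list_nonempty_induct)
  case (cons y l)
  then show ?case by (cases l) (simp_all add: mult.assoc)
qed simp

context fin_dim_graded_algebra
begin

interpretation fo: vector_space "fscale scale :: 'f \<Rightarrow> ('a \<Rightarrow> 'a) \<Rightarrow> _"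
  by (rule vector_space_fscale) (rule vector_space_axioms)

text \<open>
  The operators given by multiplications and projections onto homogeneous components; the graded
  ideals are the subspaces that they leave invariant.
\<close>

inductive_set mult_words :: "('a \<Rightarrow> 'a) set" where
  ident: "(\<lambda>x. x) \<in> mult_words"
| left: "T \<in> mult_words \<Longrightarrow> (\<lambda>x. c * T x) \<in> mult_words"
| right: "T \<in> mult_words \<Longrightarrow> (\<lambda>x. T x * c) \<in> mult_words"
| comp: "T \<in> mult_words \<Longrightarrow> (\<lambda>x. component g (T x)) \<in> mult_words"

definition mult_algebra :: "('a \<Rightarrow> 'a) set" where
  "mult_algebra = module.span (fscale scale) mult_words"

lemma mult_words_in_algebra: "T \<in> mult_words \<Longrightarrow> T \<in> mult_algebra"
  unfolding mult_algebra_def by (rule fo.span_base)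

lemma subspace_mult_algebra: "fo.subspace mult_algebra"
  unfolding mult_algebra_def by (rule fo.subspace_span)

lemma mult_algebra_0: "(\<lambda>x. 0) \<in> mult_algebra"
  using fo.subspace_0[OF subspace_mult_algebra] by (simp add: zero_fun_def)

lemma mult_algebra_add: "S \<in> mult_algebra \<Longrightarrow> T \<in> mult_algebra \<Longrightarrow> (\<lambda>x. S x + T x) \<in> mult_algebra"
  using fo.subspace_add[OF subspace_mult_algebra, of S T] by (simp add: plus_fun_def)

lemma mult_algebra_scale: "S \<in> mult_algebra \<Longrightarrow> (\<lambda>x. c *s S x) \<in> mult_algebra"
  using fo.subspace_scale[OF subspace_mult_algebra, of S c] by (simp add: fscale_def)

lemma mult_algebra_induct [consumes 1, case_names subspace word]:
  assumes "T \<in> mult_algebra" and "fo.subspace (Collect P)"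
    and "\<And>T. T \<in> mult_words \<Longrightarrow> P T"
  shows "P T"
  using assms(1) unfolding mult_algebra_def
  by (rule fo.span_induct) (use assms(2,3) in auto)

lemma mult_words_endo: "T \<in> mult_words \<Longrightarrow> endo T"
proof (induction rule: mult_words.induct)
  case ident
  then show ?case by (rule endoI) auto
next
  case (left T c)
  then show ?case
    by (intro endoI) (simp_all add: module_hom.add module_hom.scale distrib_left scale_mult_right)
next
  case (right T c)
  then show ?case
    by (intro endoI) (simp_all add: module_hom.add module_hom.scale distrib_right scale_mult_left)
next
  case (comp T g)
  then show ?case
    by (intro endoI) (simp_all add: module_hom.add module_hom.scale component_add component_scale)
qed

lemma mult_algebra_endo: "T \<in> mult_algebra \<Longrightarrow> endo T"
proof (induction rule: mult_algebra_induct)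
  case subspace
  show ?case
    by (auto simp: fo.subspace_def fscale_def module_hom_iff module_axioms scale_right_distrib mult.commute)
qed (rule mult_words_endo)

lemma mult_words_compose: "S \<in> mult_words \<Longrightarrow> T \<in> mult_words \<Longrightarrow> (\<lambda>x. S (T x)) \<in> mult_words"
  by (induction rule: mult_words.induct) (auto intro: mult_words.intros)

lemma mult_algebra_compose_word:
  assumes S: "S \<in> mult_words" and "T \<in> mult_algebra"
  shows "(\<lambda>x. S (T x)) \<in> mult_algebra"
  using assms(2)
proof (induction rule: mult_algebra_induct)
  case subspace
  note S' = mult_words_endo[OF S]
  show ?case
    by (auto simp: fo.subspace_def fscale_def module_hom.add[OF S'] module_hom.scale[OF S']
        module_hom.zero[OF S'] mult_algebra_0 mult_algebra_add mult_algebra_scale)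
next
  case (word T)
  then show ?case using mult_words_compose[OF S] by (intro mult_words_in_algebra)
qed

lemma mult_algebra_compose:
  assumes "S \<in> mult_algebra" and T: "T \<in> mult_algebra"
  shows "(\<lambda>x. S (T x)) \<in> mult_algebra"
  using assms(1)
proof (induction rule: mult_algebra_induct)
  case subspace
  show ?case
    by (auto simp: fo.subspace_def fscale_def mult_algebra_0 mult_algebra_add mult_algebra_scale)
next
  case (word S)
  then show ?case by (rule mult_algebra_compose_word[OF _ T])
qed

lemma invariant_subspace:
  assumes simple: graded_simple and S: "subspace S" "S \<noteq> {0}"
    and inv: "\<And>T x. T \<in> mult_words \<Longrightarrow> x \<in> S \<Longrightarrow> T x \<in> S"
  shows "S = UNIV"
proof -
  have "a * x \<in> S" "x * a \<in> S" "component g x \<in> S" if "x \<in> S" for a x g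
    using inv[OF mult_words.left[OF mult_words.ident] that] inv[OF mult_words.right[OF mult_words.ident] that]
      inv[OF mult_words.comp[OF mult_words.ident] that] .
  then have "graded_ideal S" using S(1) unfolding graded_ideal_iff by blast
  then show ?thesis using simple S(2) unfolding graded_simple_def by blast
qed

lemma orbit_eq_UNIV:
  assumes simple: graded_simple
    and N: "fo.subspace N" "\<And>S T. S \<in> mult_words \<Longrightarrow> T \<in> N \<Longrightarrow> (\<lambda>x. S (T x)) \<in> N"
    and T: "T \<in> N" "T s \<noteq> 0"
  shows "(\<lambda>T. T s) ` N = UNIV"
proof (rule invariant_subspace[OF simple])
  show "subspace ((\<lambda>T. T s) ` N)"
    by (rule module_hom.subspace_image[OF module_hom_eval[OF vector_space_axioms] N(1)])
  show "(\<lambda>T. T s) ` N \<noteq> {0}" using T by blast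
  fix S x assume S: "S \<in> mult_words" and "x \<in> (\<lambda>T. T s) ` N"
  then obtain T where "T \<in> N" "x = T s" by blast
  then show "S x \<in> (\<lambda>T. T s) ` N"
    using N(2)[OF S, of T] by (intro image_eqI[of _ _ "\<lambda>x. S (T x)"]) auto
qed

text \<open>
  Jacobson's density theorem for \<^const>\<open>mult_algebra\<close>, which acts irreducibly; by Schur's lemma
  over an algebraically closed field, only scalars commute with it.
\<close>

lemma density:
  assumes closed: "\<And>p :: 'f poly. degree p > 0 \<Longrightarrow> \<exists>c. poly p c = 0" and simple: graded_simple
    and "finite S" "v \<notin> span S"
  shows "\<exists>T\<in>mult_algebra. (\<forall>s\<in>S. T s = 0) \<and> T v \<noteq> 0"
  using assms(3,4)
proof (induction S arbitrary: v rule: finite_induct)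
  case empty
  then show ?case using mult_words_in_algebra[OF mult_words.ident] by (intro bexI[of _ "\<lambda>x. x"]) auto
next
  case (insert s S)
  define N where "N = {T \<in> mult_algebra. \<forall>t\<in>S. T t = 0}"
  have vS: "v \<notin> span S" using insert.prems span_mono[of S "insert s S"] by blast
  have subN: "fo.subspace N"
    using subspace_mult_algebra by (auto simp: fo.subspace_def N_def fscale_def)
  have compN: "(\<lambda>x. W (T x)) \<in> N" if "W \<in> mult_words" "T \<in> N" for W T
    using that mult_algebra_compose_word[of W T] module_hom.zero[OF mult_words_endo[of W]]
    by (simp add: N_def)
  show ?case
  proof (cases "\<forall>T\<in>N. T s = 0")
    case True
    then show ?thesis using insert.IH[OF vS] unfolding N_def by blast
  next
    case False
    then obtain T0 where T0: "T0 \<in> N" "T0 s \<noteq> 0" by blast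
    have orbit: "(\<lambda>T. T s) ` N = UNIV"
      using simple subN compN T0 by (rule orbit_eq_UNIV)
    show ?thesis
    proof (rule ccontr)
      assume contra: "\<not> ?thesis"
      have kills: "T v = 0" if "T \<in> N" "T s = 0" for T
        using contra that unfolding N_def by blast
      \<comment> \<open>so \<open>T s \<mapsto> T v\<close> is a well-defined endomorphism commuting with all operators\<close>
      define \<theta> where "\<theta> a = (SOME T. T \<in> N \<and> T s = a) v" for a
      have \<theta>: "\<theta> (T s) = T v" if "T \<in> N" for T
      proof -
        let ?T = "SOME T'. T' \<in> N \<and> T' s = T s"
        have "\<exists>T'. T' \<in> N \<and> T' s = T s" using that by blast
        then have T': "?T \<in> N" "?T s = T s" using someI_ex by (metis (mono_tags, lifting))+
        have "?T - T \<in> N" by (rule fo.subspace_diff[OF subN T'(1) that])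
        from kills[OF this] have "(?T - T) v = 0" using T'(2) by simp
        then show ?thesis by (simp add: \<theta>_def)
      qed
      have ex: "\<exists>T\<in>N. a = T s" for a using orbit by blast
      have endo\<theta>: "endo \<theta>"
      proof (rule endoI)
        fix x y c
        obtain T where T: "T \<in> N" "x = T s" using ex by blast
        obtain T' where T': "T' \<in> N" "y = T' s" using ex by blast
        show "\<theta> (x + y) = \<theta> x + \<theta> y"
          using \<theta>[OF fo.subspace_add[OF subN T(1) T'(1)]] \<theta>[OF T(1)] \<theta>[OF T'(1)] T T' by simp
        show "\<theta> (c *s x) = c *s \<theta> x"
          using \<theta>[OF fo.subspace_scale[OF subN T(1), of c]] \<theta>[OF T(1)] T by (simp add: fscale_def)
      qed
      have commute: "\<theta> (W a) = W (\<theta> a)" if "W \<in> mult_words" for W a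
      proof -
        obtain T where T: "T \<in> N" "a = T s" using ex by blast
        then show ?thesis using \<theta>[OF compN[OF that T(1)]] \<theta>[OF T(1)] by simp
      qed
      obtain c w where w: "w \<noteq> 0" "\<theta> w = c *s w"
        using eigenvector_exists[OF endo\<theta> closed T0(2)] by blast
      have "{w. \<theta> w = c *s w} = UNIV"
      proof (rule invariant_subspace[OF simple])
        show "subspace {w. \<theta> w = c *s w}"
          by (auto simp: subspace_def module_hom.zero[OF endo\<theta>] module_hom.add[OF endo\<theta>]
              module_hom.scale[OF endo\<theta>] scale_right_distrib mult.commute)
        show "{w. \<theta> w = c *s w} \<noteq> {0}" using w by blast
        show "T x \<in> {w. \<theta> w = c *s w}" if "T \<in> mult_words" "x \<in> {w. \<theta> w = c *s w}" for T x
          using that commute[OF that(1), of x] module_hom.scale[OF mult_words_endo[OF that(1)]] by simp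
      qed
      then have scalar: "\<theta> a = c *s a" for a by blast
      have "v - c *s s \<notin> span S" using insert.prems unfolding span_insert by blast
      from insert.IH[OF this] obtain T where T: "T \<in> N" "T (v - c *s s) \<noteq> 0"
        unfolding N_def by blast
      have "endo T" using T(1) by (simp add: N_def mult_algebra_endo)
      then have "T (v - c *s s) = 0"
        using \<theta>[OF T(1)] scalar[of "T s"] by (simp add: module_hom.diff module_hom.scale)
      then show False using T(2) by simp
    qed
  qed
qed

lemma rank_one_in_mult_algebra:
  assumes closed: "\<And>p :: 'f poly. degree p > 0 \<Longrightarrow> \<exists>c. poly p c = 0" and simple: graded_simple
    and b: "b \<in> Basis"
  shows "\<exists>T\<in>mult_algebra. T b = c \<and> (\<forall>b'\<in>Basis - {b}. T b' = 0)"
proof -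
  have "b \<notin> span (Basis - {b})" using independent_Basis b unfolding dependent_def by blast
  then obtain T where T: "T \<in> mult_algebra" "\<forall>b'\<in>Basis - {b}. T b' = 0" "T b \<noteq> 0"
    using density[OF closed simple, of "Basis - {b}" b] finite_Basis by blast
  have "(\<lambda>S. S (T b)) ` mult_algebra = UNIV"
  proof (rule orbit_eq_UNIV[OF simple subspace_mult_algebra])
    show "(\<lambda>x. x) \<in> mult_algebra" by (rule mult_words_in_algebra[OF mult_words.ident])
  qed (use T(3) in \<open>simp_all add: mult_algebra_compose_word\<close>)
  then obtain S where S: "S \<in> mult_algebra" "c = S (T b)" by blast
  have "S 0 = 0" by (rule module_hom.zero[OF mult_algebra_endo[OF S(1)]])
  then show ?thesis
    using mult_algebra_compose[OF S(1) T(1)] T(2) S(2) by (intro bexI[of _ "\<lambda>x. S (T x)"]) auto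
qed

lemma square_nonzero:
  assumes simple: graded_simple
  shows "\<exists>x y :: 'a. x * y \<noteq> 0"
proof (rule ccontr)
  assume "\<not> ?thesis"
  then have "{x * y | x y. True} \<subseteq> {0 :: 'a}" by auto
  then have "span {x * y | x y. True} \<subseteq> {0 :: 'a}" by (rule span_minimal) simp
  then have "span {x * y | x y. True} = {0 :: 'a}" using span_zero by fast
  then show False using simple unfolding graded_simple_def by simp
qed

text \<open>The left annihilator of the algebra is a graded ideal, hence zero.\<close>

lemma right_mult_nonzero:
  fixes x :: 'a
  assumes simple: graded_simple and x: "x \<noteq> 0"
  shows "\<exists>y. x * y \<noteq> 0"
proof (rule ccontr)
  assume contra: "\<nexists>y. x * y \<noteq> 0"
  let ?A = "{x :: 'a. \<forall>y. x * y = 0}"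
  have "graded_ideal ?A"
    unfolding graded_ideal_iff
  proof (intro conjI ballI allI)
    show "subspace ?A" by (auto simp: subspace_def distrib_right scale_mult_left)
    fix u assume u: "u \<in> ?A"
    show "a * u \<in> ?A" "u * a \<in> ?A" for a using u by (simp_all add: mult.assoc)
    show "component g u \<in> ?A" for g
    proof (intro CollectI allI)
      fix y
      have "component g u * component h y = 0" for h
      proof -
        have "0 = component (g + h) (u * component h y)" using u by simp
        also have "u * component h y = (\<Sum>k\<in>insert g support. component k u) * component h y"
          by (simp only: sum_component_insert)
        also have "\<dots> = (\<Sum>k\<in>insert g support. component k u * component h y)"
          by (rule sum_distrib_right)
        also have "component (g + h) \<dots> = (\<Sum>k\<in>insert g support. component (g + h) (component k u * component h y))"
          by (rule module_hom.sum[OF component_hom])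
        also have "\<dots> = (\<Sum>k\<in>insert g support. if k = g then component g u * component h y else 0)"
        proof (intro sum.cong refl)
          fix k
          show "component (g + h) (component k u * component h y)
              = (if k = g then component g u * component h y else 0)"
            using component_homogeneous[OF component_mult[OF component_in[of k u] component_in[of h y]], of "g + h"]
            by (cases "k = g") simp_all
        qed
        also have "\<dots> = component g u * component h y"
          using finite_support by (simp only: sum.delta finite_insert insertI1 if_True)
        finally show ?thesis ..
      qed
      then have "component g u * (\<Sum>h\<in>support. component h y) = 0"
        unfolding sum_distrib_left by simp
      then show "component g u * y = 0" by (simp only: sum_component_support)
    qed
  qed
  then have "?A = {0} \<or> ?A = UNIV" using simple unfolding graded_simple_def by simp
  moreover have "x \<in> ?A" using contra by simp
  then have "?A \<noteq> {0}" using x by (metis singletonD)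
  ultimately have A: "?A = UNIV" by simp
  have "u * y = 0" for u y :: 'a
  proof -
    have "u \<in> ?A" unfolding A by simp
    then show ?thesis by simp
  qed
  then show False using square_nonzero[OF simple] by simp
qed

lemma word_eval_nonzero:
  assumes simple: graded_simple and "n \<ge> 1"
  shows "\<exists>c. word_eval c (Word [0..<n]) \<noteq> (0 :: 'a)"
  using assms(2)
proof (induction n rule: dec_induct)
  case base
  have "\<exists>x. x \<noteq> (0 :: 'a)"
  proof (rule ccontr)
    assume "\<nexists>x. x \<noteq> (0 :: 'a)"
    then show False using square_nonzero[OF simple] by simp
  qed
  then obtain x where "x \<noteq> (0 :: 'a)" by blast
  then show ?case by (intro exI[of _ "\<lambda>_. x"]) simp
next
  case (step n)
  then obtain c where c: "word_eval c (Word [0..<n]) \<noteq> (0 :: 'a)" by blast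
  then obtain y where y: "word_eval c (Word [0..<n]) * y \<noteq> 0"
    using right_mult_nonzero[OF simple] by blast
  have "word_eval (c(n := y)) (Word [0..<n]) = word_eval c (Word [0..<n])"
    by (rule word_eval_cong) simp
  then have "word_eval (c(n := y)) (Word ([0..<n] @ [n])) = word_eval c (Word [0..<n]) * y"
    using step.hyps by (subst word_eval_snoc) auto
  also have "[0..<n] @ [n] = [0..<Suc n]" using step.hyps by simp
  finally show ?case using y by (intro exI[of _ "c(n := y)"]) (simp only: not_False_eq_True)
qed

lemma word_eval_slot_hom:
  assumes "distinct l" "j \<in> set l"
  shows "module_hom scale scale (\<lambda>x. word_eval (\<phi>(j := x)) (Word l))"
  using assms
proof (induction l)
  case (Cons i l)
  show ?case
  proof (cases "l = []")
    case True
    then show ?thesis using Cons.prems by (intro endoI) simp_all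
  next
    case ne: False
    show ?thesis
    proof (cases "i = j")
      case True
      have rest: "word_eval (\<phi>(j := x)) (Word l) = word_eval \<phi> (Word l)" for x
        using Cons.prems True by (intro word_eval_cong) auto
      show ?thesis
        using True by (intro endoI)
          (simp_all add: word_eval_Cons[OF ne] rest distrib_right scale_mult_left del: fun_upd_apply, simp_all add: distrib_right scale_mult_left)
    next
      case False
      then have IH: "module_hom scale scale (\<lambda>x. word_eval (\<phi>(j := x)) (Word l))"
        using Cons by (intro Cons.IH) auto
      show ?thesis
        using False
        by (intro endoI)
          (simp_all add: word_eval_Cons[OF ne] module_hom.add[OF IH] module_hom.scale[OF IH]
            distrib_left scale_mult_right del: fun_upd_apply, simp_all)
    qed
  qed
qed simp

definition alternating_on :: "nat set \<Rightarrow> ((nat \<Rightarrow> 'a) \<Rightarrow> 'a) \<Rightarrow> bool" where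
  "alternating_on I \<Phi> \<longleftrightarrow> (\<forall>a. \<forall>i\<in>I. \<forall>j\<in>I. i \<noteq> j \<longrightarrow> a i = a j \<longrightarrow> \<Phi> a = 0)"

text \<open>
  Only the permutation \<open>\<sigma> = id\<close> contributes if \<open>T i\<close> kills all basis vectors but the \<open>i\<close>-th; as the
  alternating sum is linear in each \<open>T i\<close>, it cannot vanish for all words.
\<close>

lemma alternating_sum_nonzero:
  assumes closed: "\<And>p :: 'f poly. degree p > 0 \<Longrightarrow> \<exists>c. poly p c = 0" and simple: graded_simple
    and e: "bij_betw e {..<d} Basis" and d: "d \<ge> 1"
  shows "\<exists>\<omega>. (\<forall>i<d. \<omega> i \<in> mult_words) \<and>
    (\<Sum>\<sigma> | \<sigma> permutes {..<d}. of_int (sign \<sigma>) *s word_eval (\<lambda>i. \<omega> i (e (\<sigma> i))) (Word [0..<d])) \<noteq> 0"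
proof (rule ccontr)
  define \<Psi> where "\<Psi> t = (\<Sum>\<sigma> | \<sigma> permutes {..<d}.
    of_int (sign \<sigma>) *s word_eval (\<lambda>i. t i (e (\<sigma> i))) (Word [0..<d]))" for t :: "nat \<Rightarrow> 'a \<Rightarrow> 'a"
  assume "\<not> ?thesis"
  then have words: "\<Psi> t = 0" if "\<And>i. i \<in> {..<d} \<Longrightarrow> t i \<in> mult_words" for t
    using that unfolding \<Psi>_def by blast
  obtain c where c: "word_eval c (Word [0..<d]) \<noteq> (0 :: 'a)"
    using word_eval_nonzero[OF simple d] by blast
  have eB: "e i \<in> Basis" if "i < d" for i using e that by (auto simp: bij_betw_def)
  have inj: "e i = e j \<longleftrightarrow> i = j" if "i < d" "j < d" for i j
    using e that by (auto simp: bij_betw_def inj_on_def)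
  define t where "t i = (SOME T. T \<in> mult_algebra \<and> T (e i) = c i \<and> (\<forall>b\<in>Basis - {e i}. T b = 0))" for i
  have t: "t i \<in> mult_algebra \<and> t i (e i) = c i \<and> (\<forall>b\<in>Basis - {e i}. t i b = 0)" if "i < d" for i
  proof -
    have "\<exists>T. T \<in> mult_algebra \<and> T (e i) = c i \<and> (\<forall>b\<in>Basis - {e i}. T b = 0)"
      using rank_one_in_mult_algebra[OF closed simple eB[OF that], of "c i"] by blast
    from someI_ex[OF this] show ?thesis unfolding t_def .
  qed
  have hom: "module_hom (fscale scale) scale (\<lambda>u. \<Psi> (s(j := u)))" if j: "j \<in> {..<d}" for j s
  proof -
    have summand: "module_hom scale scale (\<lambda>x. word_eval ((\<lambda>i. s i (e (\<sigma> i)))(j := x)) (Word [0..<d]))" for \<sigma>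
      using j by (intro word_eval_slot_hom) auto
    have upd: "(\<lambda>i. (s(j := u)) i (e (\<sigma> i))) = (\<lambda>i. s i (e (\<sigma> i)))(j := u (e (\<sigma> j)))" for u \<sigma>
      by auto
    show ?thesis
      unfolding module_hom_iff \<Psi>_def upd
      by (simp add: fo.module_axioms module_axioms module_hom.add[OF summand]
          module_hom.scale[OF summand] fscale_def scale_right_distrib sum.distrib scale_sum_right
          mult.commute)
  qed
  have "\<Psi> t = 0"
  proof (rule multilinear_eq_0_on_span[OF finite_lessThan hom words])
    show "t i \<in> fo.span mult_words" if "i \<in> {..<d}" for i
      using t[of i] that by (simp add: mult_algebra_def)
  qed
  moreover have "\<Psi> t = word_eval c (Word [0..<d])"
  proof -
    have zero: "word_eval (\<lambda>i. t i (e (\<sigma> i))) (Word [0..<d]) = 0"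
      if \<sigma>: "\<sigma> permutes {..<d}" "\<sigma> \<noteq> id" for \<sigma>
    proof -
      obtain i where i: "\<sigma> i \<noteq> i" using \<sigma>(2) by (auto simp: fun_eq_iff)
      then have "i < d" using \<sigma>(1) by (metis lessThan_iff permutes_def)
      moreover have "\<sigma> i < d" using permutes_in_image[OF \<sigma>(1), of i] \<open>i < d\<close> by simp
      ultimately have "t i (e (\<sigma> i)) = 0" using t[of i] eB[of "\<sigma> i"] inj[of "\<sigma> i" i] i by simp
      then show ?thesis using \<open>i < d\<close> by (intro word_eval_eq_0[of i]) auto
    qed
    have "\<Psi> t = (\<Sum>\<sigma> | \<sigma> permutes {..<d}. if \<sigma> = id then word_eval c (Word [0..<d]) else 0)"
      unfolding \<Psi>_def
    proof (rule sum.cong[OF refl])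
      fix \<sigma> assume "\<sigma> \<in> {\<sigma>. \<sigma> permutes {..<d}}"
      moreover have "word_eval (\<lambda>i. t i (e (id i))) (Word [0..<d]) = word_eval c (Word [0..<d])"
        by (rule word_eval_cong) (simp add: t)
      ultimately show "of_int (sign \<sigma>) *s word_eval (\<lambda>i. t i (e (\<sigma> i))) (Word [0..<d])
          = (if \<sigma> = id then word_eval c (Word [0..<d]) else 0)"
        using zero[of \<sigma>] by (cases "\<sigma> = id") (simp_all add: sign_id)
    qed
    also have "\<dots> = word_eval c (Word [0..<d])"
      by (simp add: finite_permutations permutes_id)
    finally show ?thesis .
  qed
  ultimately show False using c by simp
qed

text \<open>Words are multilinear maps in which all variables but one are specialised to constants.\<close>

lemma mult_word_realization:
  assumes "T \<in> mult_words" "finite Z" "j \<in> Z"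
  shows "\<exists>Y y F. finite Y \<and> Y \<inter> Z = {} \<and> F \<in> multilinear_maps (insert j Y) \<and>
    (\<forall>a. (\<forall>t\<in>Y. a t = y t) \<longrightarrow> F a = T (a j))"
  using assms(1)
proof (induction rule: mult_words.induct)
  case ident
  show ?case
    by (intro exI[of _ "{}"] exI[of _ "\<lambda>_. 0"] exI[of _ "\<lambda>a. a j"]) (simp add: multilinear_maps_arg)
next
  case (left T c)
  then obtain Y y F where Y: "finite Y" "Y \<inter> Z = {}" "F \<in> multilinear_maps (insert j Y)"
    "\<And>a. (\<forall>t\<in>Y. a t = y t) \<Longrightarrow> F a = T (a j)" by blast
  obtain s where s: "s \<notin> Z \<union> Y"
    using ex_new_if_finite[OF infinite_UNIV_nat, of "Z \<union> Y"] Y(1) assms(2) by blast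
  have "(\<lambda>a. a s * F a) \<in> multilinear_maps ({s} \<union> insert j Y)"
    using s assms(3) by (intro multilinear_maps_mult multilinear_maps_arg Y(3)) auto
  then show ?case
    using Y(1,2) s Y(4)
    by (intro exI[of _ "insert s Y"] exI[of _ "y(s := c)"] exI[of _ "\<lambda>a. a s * F a"] conjI)
      (auto simp: insert_commute split: if_splits)
next
  case (right T c)
  then obtain Y y F where Y: "finite Y" "Y \<inter> Z = {}" "F \<in> multilinear_maps (insert j Y)"
    "\<And>a. (\<forall>t\<in>Y. a t = y t) \<Longrightarrow> F a = T (a j)" by blast
  obtain s where s: "s \<notin> Z \<union> Y"
    using ex_new_if_finite[OF infinite_UNIV_nat, of "Z \<union> Y"] Y(1) assms(2) by blast
  have "(\<lambda>a. F a * a s) \<in> multilinear_maps (insert j Y \<union> {s})"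
    using s assms(3) by (intro multilinear_maps_mult multilinear_maps_arg Y(3)) auto
  then show ?case
    using Y(1,2) s Y(4)
    by (intro exI[of _ "insert s Y"] exI[of _ "y(s := c)"] exI[of _ "\<lambda>a. F a * a s"] conjI)
      (auto simp: insert_commute split: if_splits)
next
  case (comp T g)
  then obtain Y y F where Y: "finite Y" "Y \<inter> Z = {}" "F \<in> multilinear_maps (insert j Y)"
    "\<And>a. (\<forall>t\<in>Y. a t = y t) \<Longrightarrow> F a = T (a j)" by blast
  have "(\<lambda>a. component g (F a)) \<in> multilinear_maps (insert j Y)"
    using Y(3) by (rule multilinear_maps_component) simp
  with Y show ?case
    by (intro exI[of _ Y] exI[of _ y] exI[of _ "\<lambda>a. component g (F a)"]) simp
qed

lemma mult_words_product_realization: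
  assumes \<omega>: "\<And>i. i < d \<Longrightarrow> \<omega> i \<in> mult_words" and n: "1 \<le> n" "n \<le> d"
  shows "\<exists>Y y \<Omega>. finite Y \<and> Y \<inter> {..<d} = {} \<and> \<Omega> \<in> multilinear_maps ({..<n} \<union> Y) \<and>
    (\<forall>a. (\<forall>t\<in>Y. a t = y t) \<longrightarrow> \<Omega> a = word_eval (\<lambda>i. \<omega> i (a i)) (Word [0..<n]))"
  using n
proof (induction n rule: dec_induct)
  case base
  then obtain Y y F where Y: "finite Y" "Y \<inter> {..<d} = {}" "F \<in> multilinear_maps (insert 0 Y)"
    "\<And>a. (\<forall>t\<in>Y. a t = y t) \<Longrightarrow> F a = \<omega> 0 (a 0)"
    using mult_word_realization[of "\<omega> 0" "{..<d}" 0] \<omega>[of 0] by auto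
  have "{..<1} \<union> Y = insert 0 Y" by auto
  then show ?case using Y by (intro exI[of _ Y] exI[of _ y] exI[of _ F]) simp
next
  case (step n)
  then obtain Y y \<Omega> where Y: "finite Y" "Y \<inter> {..<d} = {}" "\<Omega> \<in> multilinear_maps ({..<n} \<union> Y)"
    "\<And>a. (\<forall>t\<in>Y. a t = y t) \<Longrightarrow> \<Omega> a = word_eval (\<lambda>i. \<omega> i (a i)) (Word [0..<n])" by auto
  obtain Y' y' F where Y': "finite Y'" "Y' \<inter> ({..<d} \<union> Y) = {}" "F \<in> multilinear_maps (insert n Y')"
    "\<And>a. (\<forall>t\<in>Y'. a t = y' t) \<Longrightarrow> F a = \<omega> n (a n)"
    using mult_word_realization[of "\<omega> n" "{..<d} \<union> Y" n] \<omega>[of n] Y(1) step.prems by auto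
  have "(\<lambda>a. \<Omega> a * F a) \<in> multilinear_maps (({..<n} \<union> Y) \<union> insert n Y')"
  proof (rule multilinear_maps_mult[OF Y(3) Y'(3)])
    have "0 \<in> {..<n} \<union> Y" using step.hyps by simp
    then show "{..<n} \<union> Y \<noteq> {}" by blast
    show "({..<n} \<union> Y) \<inter> insert n Y' = {}"
      using Y(2) Y'(2) step.prems by (auto simp: disjoint_iff)
  qed simp
  also have "({..<n} \<union> Y) \<union> insert n Y' = {..<Suc n} \<union> (Y \<union> Y')" by auto
  finally have \<Omega>: "(\<lambda>a. \<Omega> a * F a) \<in> multilinear_maps ({..<Suc n} \<union> (Y \<union> Y'))" .
  have eval: "\<Omega> a * F a = word_eval (\<lambda>i. \<omega> i (a i)) (Word [0..<Suc n])"
    if "\<forall>t\<in>Y \<union> Y'. a t = (if t \<in> Y then y t else y' t)" for a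
  proof -
    have "\<Omega> a = word_eval (\<lambda>i. \<omega> i (a i)) (Word [0..<n])" using that by (intro Y(4)) simp
    moreover have "F a = \<omega> n (a n)" using that Y'(2) by (intro Y'(4)) auto
    ultimately show ?thesis
      using word_eval_snoc[of "[0..<n]" "\<lambda>i. \<omega> i (a i)" n] step.hyps by simp
  qed
  show ?case
    by (intro exI[of _ "Y \<union> Y'"] exI[of _ "\<lambda>t. if t \<in> Y then y t else y' t"] exI[of _ "\<lambda>a. \<Omega> a * F a"])
      (use Y Y' \<Omega> eval in auto)
qed

lemma multilinear_maps_permute:
  assumes F: "F \<in> multilinear_maps J" and J: "J \<noteq> {}" and \<sigma>: "\<sigma> permutes J"
  shows "(\<lambda>a. F (\<lambda>j. a (\<sigma> j))) \<in> multilinear_maps J"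
proof -
  have "(\<lambda>a. F (\<lambda>j. (\<lambda>a. a (\<sigma> j)) a)) \<in> multilinear_maps (\<Union>j\<in>J. {\<sigma> j})"
    using permutes_inj[OF \<sigma>] by (intro multilinear_maps_subst[OF F J] multilinear_maps_arg) (auto dest: injD)
  moreover have "(\<Union>j\<in>J. {\<sigma> j}) = J" using permutes_image[OF \<sigma>] by auto
  ultimately show ?thesis by simp
qed

lemma alternating_on_antisymmetrization:
  assumes char0: "\<And>n. of_nat n = (0 :: 'f) \<Longrightarrow> n = 0" and I: "finite I"
  shows "alternating_on I (\<lambda>a. \<Sum>\<sigma> | \<sigma> permutes I. of_int (sign \<sigma>) *s \<Omega> (\<lambda>j. a (\<sigma> j)))"
  unfolding alternating_on_def
proof (intro allI ballI impI)
  fix a :: "nat \<Rightarrow> 'a" and i j assume ij: "i \<in> I" "j \<in> I" "i \<noteq> j" "a i = a j"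
  let ?f = "\<lambda>\<sigma>. of_int (sign \<sigma>) *s \<Omega> (\<lambda>j. a (\<sigma> j))"
  let ?\<tau> = "Transposition.transpose i j"
  have \<tau>: "?\<tau> permutes I" using ij by (intro permutes_swap_id)
  have a\<tau>: "a (?\<tau> k) = a k" for k using ij(4) by (auto simp: Transposition.transpose_def)
  have "(\<Sum>\<sigma> | \<sigma> permutes I. ?f \<sigma>) = (\<Sum>\<sigma> | \<sigma> permutes I. ?f (?\<tau> \<circ> \<sigma>))"
    by (rule setum_permutations_compose_left[OF \<tau>])
  also have "\<dots> = (\<Sum>\<sigma> | \<sigma> permutes I. - ?f \<sigma>)"
  proof (rule sum.cong[OF refl])
    fix \<sigma> assume "\<sigma> \<in> {\<sigma>. \<sigma> permutes I}"
    then have "sign (?\<tau> \<circ> \<sigma>) = - sign \<sigma>"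
      using ij I \<tau> by (simp add: sign_compose permutation_permutes[THEN iffD2] sign_swap_id exI[of _ I])
    then show "?f (?\<tau> \<circ> \<sigma>) = - ?f \<sigma>" by (simp add: a\<tau>)
  qed
  also have "\<dots> = - (\<Sum>\<sigma> | \<sigma> permutes I. ?f \<sigma>)" by (rule sum_negf)
  finally have "of_nat 2 *s (\<Sum>\<sigma> | \<sigma> permutes I. ?f \<sigma>) = 0"
    using scale_left_distrib[of 1 1 "\<Sum>\<sigma> | \<sigma> permutes I. ?f \<sigma>"]
    by (simp add: eq_neg_iff_add_eq_0)
  moreover have "of_nat 2 \<noteq> (0 :: 'f)" using char0[of 2] by linarith
  ultimately show "(\<Sum>\<sigma> | \<sigma> permutes I. ?f \<sigma>) = 0" by simp
qed

lemma alternating_map_exists: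
  assumes closed: "\<And>p :: 'f poly. degree p > 0 \<Longrightarrow> \<exists>c. poly p c = 0"
    and char0: "\<And>n. of_nat n = (0 :: 'f) \<Longrightarrow> n = 0" and simple: graded_simple
    and d: "dimension \<ge> 1"
  shows "\<exists>J \<Phi> a. finite J \<and> {..<dimension} \<subseteq> J \<and> \<Phi> \<in> multilinear_maps J \<and>
    alternating_on {..<dimension} \<Phi> \<and> \<Phi> a \<noteq> 0"
proof -
  let ?d = dimension
  obtain e where e: "bij_betw e {..<?d} Basis"
    using ex_bij_betw_nat_finite[OF finite_Basis] by (auto simp: dimension_def atLeast0LessThan)
  obtain \<omega> where \<omega>: "\<And>i. i < ?d \<Longrightarrow> \<omega> i \<in> mult_words"
    "(\<Sum>\<sigma> | \<sigma> permutes {..<?d}. of_int (sign \<sigma>) *s word_eval (\<lambda>i. \<omega> i (e (\<sigma> i))) (Word [0..<?d])) \<noteq> 0"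
    using alternating_sum_nonzero[OF closed simple e d] by blast
  obtain Y y \<Omega> where Y: "finite Y" "Y \<inter> {..<?d} = {}" "\<Omega> \<in> multilinear_maps ({..<?d} \<union> Y)"
    "\<And>a. (\<forall>t\<in>Y. a t = y t) \<Longrightarrow> \<Omega> a = word_eval (\<lambda>i. \<omega> i (a i)) (Word [0..<?d])"
    using mult_words_product_realization[of ?d \<omega> ?d, OF \<omega>(1) d order_refl] by blast
  define \<Phi> where "\<Phi> a = (\<Sum>\<sigma> | \<sigma> permutes {..<?d}. of_int (sign \<sigma>) *s \<Omega> (\<lambda>j. a (\<sigma> j)))" for a
  have "\<Phi> \<in> multilinear_maps ({..<?d} \<union> Y)"
    unfolding \<Phi>_def
  proof (intro multilinear_maps_sum multilinear_maps_scale multilinear_maps_permute[OF Y(3)])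
    have "0 \<in> {..<?d} \<union> Y" using d by simp
    then show "{..<?d} \<union> Y \<noteq> {}" by blast
    fix \<sigma> assume "\<sigma> \<in> {\<sigma>. \<sigma> permutes {..<?d}}"
    then show "\<sigma> permutes {..<?d} \<union> Y" by (auto intro: permutes_subset)
  qed
  moreover have "alternating_on {..<?d} \<Phi>"
    unfolding \<Phi>_def by (rule alternating_on_antisymmetrization[OF char0]) auto
  moreover have "\<Phi> (\<lambda>i. if i < ?d then e i else y i) \<noteq> 0"
  proof -
    let ?a = "\<lambda>i. if i < ?d then e i else y i"
    have "\<Omega> (\<lambda>j. ?a (\<sigma> j)) = word_eval (\<lambda>i. \<omega> i (e (\<sigma> i))) (Word [0..<?d])"
      if \<sigma>: "\<sigma> permutes {..<?d}" for \<sigma>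
    proof -
      have "\<sigma> t = t" if "t \<in> Y" for t
        using Y(2) that by (intro permutes_not_in[OF \<sigma>]) auto
      then have "\<Omega> (\<lambda>j. ?a (\<sigma> j)) = word_eval (\<lambda>i. \<omega> i (?a (\<sigma> i))) (Word [0..<?d])"
        using Y(2) by (intro Y(4)) auto
      also have "\<dots> = word_eval (\<lambda>i. \<omega> i (e (\<sigma> i))) (Word [0..<?d])"
        using permutes_in_image[OF \<sigma>] by (intro word_eval_cong) auto
      finally show ?thesis .
    qed
    then have "\<Phi> ?a = (\<Sum>\<sigma> | \<sigma> permutes {..<?d}. of_int (sign \<sigma>) *s
        word_eval (\<lambda>i. \<omega> i (e (\<sigma> i))) (Word [0..<?d]))"
      unfolding \<Phi>_def by (intro sum.cong refl) simp
    then show ?thesis using \<omega>(2) by simp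
  qed
  ultimately show ?thesis
    using Y(1) by (intro exI[of _ "{..<?d} \<union> Y"] exI[of _ \<Phi>] exI[of _ "\<lambda>i. if i < ?d then e i else y i"]) simp
qed

end

section \<open>Multiplication of alternating maps by the trace form\<close>

context fin_dim_graded_algebra
begin

lemma endo_sum:
  assumes "\<And>i. i \<in> I \<Longrightarrow> endo (f i)"
  shows "endo (\<lambda>x. \<Sum>i\<in>I. f i x)"
proof (rule endoI)
  show "(\<Sum>i\<in>I. f i (x + y)) = (\<Sum>i\<in>I. f i x) + (\<Sum>i\<in>I. f i y)" for x y
    unfolding sum.distrib[symmetric] by (intro sum.cong refl module_hom.add[OF assms])
  show "(\<Sum>i\<in>I. f i (c *s x)) = c *s (\<Sum>i\<in>I. f i x)" for c x
    unfolding scale_sum_right by (intro sum.cong refl module_hom.scale[OF assms])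
qed

text \<open>
  Letting an endomorphism act as a derivation on the arguments of an alternating map of \<open>dim A\<close>
  arguments multiplies the map by the trace. By multilinearity this can be checked on basis vectors.
\<close>

lemma alternating_trace:
  assumes \<Phi>: "\<Phi> \<in> multilinear_maps J" and J: "{..<dimension} \<subseteq> J"
    and alt: "alternating_on {..<dimension} \<Phi>" and T: "endo T"
  shows "(\<Sum>i<dimension. \<Phi> (a(i := T (a i)))) = trace T *s \<Phi> a"
proof -
  let ?d = dimension
  define D where "D a = (\<Sum>i<?d. \<Phi> (a(i := T (a i)))) - trace T *s \<Phi> a" for a
  have slot: "endo (\<lambda>x. \<Phi> (a(i := x)))" if "i < ?d" for i a
    using J that by (intro multilinear_maps_hom[OF \<Phi>]) auto
  have alt0: "\<Phi> a = 0" if "i < ?d" "j < ?d" "i \<noteq> j" "a i = a j" for a i j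
    using alt that unfolding alternating_on_def by blast
  have "D a = 0"
  proof (rule multilinear_eq_0_on_span[where I = "{..<?d}" and S = Basis and ?s1.0 = scale and ?s2.0 = scale and F = D])
    fix k a assume "k \<in> {..<?d}"
    then have k: "k < ?d" by simp
    have "endo (\<lambda>x. \<Phi> ((a(k := x))(i := T ((a(k := x)) i))))" if i: "i < ?d" for i
    proof (cases "i = k")
      case True
      then have "(a(k := x))(i := T ((a(k := x)) i)) = a(k := T x)" for x by simp
      then show ?thesis
        by (simp only:) (intro endoI, simp_all only: module_hom.add[OF T] module_hom.scale[OF T]
            module_hom.add[OF slot[OF k]] module_hom.scale[OF slot[OF k]])
    next
      case False
      then have "(a(k := x))(i := T ((a(k := x)) i)) = (a(i := T (a i)))(k := x)" for x
        by (simp add: fun_upd_twist)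
      then show ?thesis by (simp only:) (rule slot[OF k])
    qed
    then have "endo (\<lambda>x. \<Sum>i<?d. \<Phi> ((a(k := x))(i := T ((a(k := x)) i))))"
      by (intro endo_sum) simp
    note S = this
    show "endo (\<lambda>x. D (a(k := x)))"
      unfolding D_def
      by (rule endoI) (simp_all only: module_hom.add[OF S] module_hom.scale[OF S]
          module_hom.add[OF slot[OF k]] module_hom.scale[OF slot[OF k]] scale_right_distrib
          scale_right_diff_distrib scale_scale mult.commute[of "trace T"] add_diff_add)
  next
    fix a assume "\<And>i. i \<in> {..<?d} \<Longrightarrow> a i \<in> Basis"
    then have aB: "a i \<in> Basis" if "i < ?d" for i using that by simp
    show "D a = 0"
    proof (cases "inj_on a {..<?d}")
      case True
      have range: "a ` {..<?d} = Basis"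
      proof (rule card_subset_eq[OF finite_Basis])
        show "a ` {..<?d} \<subseteq> Basis" using aB by auto
        show "card (a ` {..<?d}) = card Basis" using True by (simp add: card_image dimension_def)
      qed
      have "\<Phi> (a(i := T (a i))) = coord (a i) (T (a i)) *s \<Phi> a" if i: "i < ?d" for i
      proof -
        have "\<Phi> (a(i := T (a i))) = \<Phi> (a(i := \<Sum>b\<in>Basis. coord b (T (a i)) *s b))"
          by (simp only: sum_coord)
        also have "\<dots> = (\<Sum>b\<in>Basis. coord b (T (a i)) *s \<Phi> (a(i := b)))"
          by (simp only: module_hom.sum[OF slot[OF i]] module_hom.scale[OF slot[OF i]])
        also have "\<dots> = (\<Sum>b\<in>Basis. if b = a i then coord (a i) (T (a i)) *s \<Phi> a else 0)"
        proof (rule sum.cong[OF refl])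
          fix b assume "b \<in> Basis"
          then obtain j where j: "j < ?d" "b = a j" using range by auto
          show "coord b (T (a i)) *s \<Phi> (a(i := b))
              = (if b = a i then coord (a i) (T (a i)) *s \<Phi> a else 0)"
          proof (cases "b = a i")
            case False
            then have "\<Phi> (a(i := b)) = 0" using j i by (intro alt0[of i j]) auto
            then show ?thesis using False by simp
          qed simp
        qed
        also have "\<dots> = coord (a i) (T (a i)) *s \<Phi> a"
          using finite_Basis aB[OF i] by (simp add: sum.delta)
        finally show ?thesis .
      qed
      then have "(\<Sum>i<?d. \<Phi> (a(i := T (a i)))) = (\<Sum>i<?d. coord (a i) (T (a i))) *s \<Phi> a"
        by (simp add: scale_sum_left)
      also have "(\<Sum>i<?d. coord (a i) (T (a i))) = (\<Sum>b\<in>a ` {..<?d}. coord b (T b))"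
        using True by (simp add: sum.reindex)
      finally show ?thesis unfolding D_def range trace_def by (simp only: diff_self)
    next
      case False
      then obtain p q where pq: "p < ?d" "q < ?d" "p \<noteq> q" "a p = a q" by (auto simp: inj_on_def)
      have zero: "\<Phi> a = 0" using pq by (intro alt0[of p q])
      define v w where "v = a p" and "w = T (a p)"
      have "\<Phi> (a(p := v + w, q := v + w)) = 0" "\<Phi> (a(p := v, q := v)) = 0" "\<Phi> (a(p := w, q := w)) = 0"
        using pq by (intro alt0[of p q]; simp)+
      moreover have "\<Phi> (a(p := v + w, q := v + w)) = \<Phi> (a(p := v, q := v)) + \<Phi> (a(p := w, q := v))
          + (\<Phi> (a(p := v, q := w)) + \<Phi> (a(p := w, q := w)))"
      proof -
        have "\<Phi> (a(p := v + w, q := x)) = \<Phi> (a(p := v, q := x)) + \<Phi> (a(p := w, q := x))" for x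
          unfolding fun_upd_twist[OF pq(3)] by (rule module_hom.add[OF slot[OF pq(1)]])
        then show ?thesis by (simp only: module_hom.add[OF slot[OF pq(2)]])
      qed
      moreover have "a(p := v, q := w) = a(q := T (a q))" "a(p := w, q := v) = a(p := T (a p))"
        using pq by (auto simp: v_def w_def fun_eq_iff)
      ultimately have swap: "\<Phi> (a(p := T (a p))) + \<Phi> (a(q := T (a q))) = 0" by simp
      have "(\<Sum>i<?d. \<Phi> (a(i := T (a i)))) = (\<Sum>i\<in>{p, q}. \<Phi> (a(i := T (a i))))"
      proof (rule sum.mono_neutral_right)
        show "\<forall>i\<in>{..<?d} - {p, q}. \<Phi> (a(i := T (a i))) = 0"
          using pq by (intro ballI alt0[of p q]) auto
      qed (use pq in auto)
      also have "\<dots> = 0" using swap pq(3) by simp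
      finally show ?thesis unfolding D_def zero by simp
    qed
  qed (simp_all add: span_Basis)
  then show ?thesis by (simp add: D_def)
qed

text \<open>
  The case of multiplication by \<open>a p * a q\<close> in \<open>alternating_trace\<close>. This is how an unbounded number of
  arguments is reached from a single alternating map.
\<close>

lemma trace_form_mult_in:
  assumes \<Phi>: "\<Phi> \<in> multilinear_maps J" and J: "{..<dimension} \<subseteq> J" "J \<noteq> {}"
    and alt: "alternating_on {..<dimension} \<Phi>" and pq: "p \<notin> J" "q \<notin> J" "p \<noteq> q"
  shows "(\<lambda>a. tr (a p * a q) *s \<Phi> a) \<in> multilinear_maps (J \<union> {p, q})"
proof -
  have "(\<lambda>a. \<Phi> (a(i := (a p * a q) * a i))) \<in> multilinear_maps (J \<union> {p, q})" if i: "i < dimension" for i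
  proof -
    let ?X = "\<lambda>j a. if j = i then a p * a q * a i else a j"
    let ?K = "\<lambda>j. if j = i then ({p} \<union> {q}) \<union> {i} else {j}"
    have "i \<in> J" using J(1) i by auto
    then have ne: "i \<noteq> p" "i \<noteq> q" using pq by auto
    have prod: "(\<lambda>a. a p * a q * a i) \<in> multilinear_maps (({p} \<union> {q}) \<union> {i})"
      using pq(3) ne by (intro multilinear_maps_mult multilinear_maps_arg) auto
    have "(\<lambda>a. \<Phi> (\<lambda>j. ?X j a)) \<in> multilinear_maps (\<Union>j\<in>J. ?K j)"
    proof (rule multilinear_maps_subst[OF \<Phi> J(2)])
      show "?X j \<in> multilinear_maps (?K j)" for j
        using prod multilinear_maps_arg by (cases "j = i") simp_all
      show "?K j \<noteq> {}" for j by simp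
      show "?K j \<inter> ?K k = {}" if "j \<in> J" "k \<in> J" "j \<noteq> k" for j k
        using that pq by auto
    qed
    moreover have "(\<Union>j\<in>J. ?K j) = J \<union> {p, q}"
      using \<open>i \<in> J\<close> by (auto split: if_splits)
    moreover have "(\<lambda>a. \<Phi> (\<lambda>j. ?X j a)) = (\<lambda>a. \<Phi> (a(i := (a p * a q) * a i)))"
      by (intro ext arg_cong[where f = \<Phi>]) auto
    ultimately show ?thesis by (simp only:)
  qed
  then have "(\<lambda>a. \<Sum>i<dimension. \<Phi> (a(i := (a p * a q) * a i))) \<in> multilinear_maps (J \<union> {p, q})"
    by (intro multilinear_maps_sum) simp
  then show ?thesis
    unfolding alternating_trace[OF \<Phi> J(1) alt endo_left_mult] tr_def .
qed

lemma trace_form_prod_in: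
  assumes \<Phi>: "\<Phi> \<in> multilinear_maps J" and J: "{..<dimension} \<subseteq> J" "J \<noteq> {}"
    and alt: "alternating_on {..<dimension} \<Phi>" and "finite I"
    and "inj_on \<alpha> I" "inj_on \<gamma> I" "\<alpha> ` I \<inter> \<gamma> ` I = {}" "(\<alpha> ` I \<union> \<gamma> ` I) \<inter> J = {}"
  shows "(\<lambda>a. (\<Prod>i\<in>I. tr (a (\<alpha> i) * a (\<gamma> i))) *s \<Phi> a) \<in> multilinear_maps (J \<union> \<alpha> ` I \<union> \<gamma> ` I)"
  using assms(5-9)
proof (induction I rule: finite_induct)
  case empty
  then show ?case using \<Phi> by simp
next
  case (insert i I)
  let ?\<Psi> = "\<lambda>a. (\<Prod>i\<in>I. tr (a (\<alpha> i) * a (\<gamma> i))) *s \<Phi> a"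
  have \<Psi>: "?\<Psi> \<in> multilinear_maps (J \<union> \<alpha> ` I \<union> \<gamma> ` I)"
    using insert.prems by (intro insert.IH) auto
  have alt\<Psi>: "alternating_on {..<dimension} ?\<Psi>"
    using alt by (simp add: alternating_on_def)
  have "(\<lambda>a. tr (a (\<alpha> i) * a (\<gamma> i)) *s ?\<Psi> a)
      \<in> multilinear_maps (J \<union> \<alpha> ` I \<union> \<gamma> ` I \<union> {\<alpha> i, \<gamma> i})"
  proof (rule trace_form_mult_in[OF \<Psi> _ _ alt\<Psi>])
    show "\<alpha> i \<notin> J \<union> \<alpha> ` I \<union> \<gamma> ` I" "\<gamma> i \<notin> J \<union> \<alpha> ` I \<union> \<gamma> ` I" "\<alpha> i \<noteq> \<gamma> i"
      using insert.prems insert.hyps by auto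
  qed (use J in auto)
  moreover have "J \<union> \<alpha> ` I \<union> \<gamma> ` I \<union> {\<alpha> i, \<gamma> i} = J \<union> \<alpha> ` insert i I \<union> \<gamma> ` insert i I" by auto
  ultimately show ?case using insert.hyps by simp
qed

text \<open>
  Additional arguments are multiplied to the right; they serve to reach every large enough degree.
\<close>

lemma alternating_map_exists_card:
  assumes closed: "\<And>p :: 'f poly. degree p > 0 \<Longrightarrow> \<exists>c. poly p c = 0"
    and char0: "\<And>n. of_nat n = (0 :: 'f) \<Longrightarrow> n = 0" and simple: graded_simple
    and d: "dimension \<ge> 1"
  shows "\<exists>r0. \<forall>r\<ge>r0. \<exists>J \<Phi> a. finite J \<and> card J = r \<and> {..<dimension} \<subseteq> J \<and> \<Phi> \<in> multilinear_maps J \<and>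
    alternating_on {..<dimension} \<Phi> \<and> \<Phi> a \<noteq> 0"
proof -
  obtain J \<Phi> a where J: "finite J" "{..<dimension} \<subseteq> J" "\<Phi> \<in> multilinear_maps J"
    "alternating_on {..<dimension} \<Phi>" "\<Phi> a \<noteq> 0"
    using alternating_map_exists[OF closed char0 simple d] by blast
  have "\<exists>J \<Phi> a. finite J \<and> card J = r \<and> {..<dimension} \<subseteq> J \<and> \<Phi> \<in> multilinear_maps J \<and>
    alternating_on {..<dimension} \<Phi> \<and> \<Phi> a \<noteq> 0" if "card J \<le> r" for r
    using that
  proof (induction r rule: dec_induct)
    case base
    then show ?case using J by blast
  next
    case (step r)
    then obtain J \<Phi> a where J: "finite J" "card J = r" "{..<dimension} \<subseteq> J" "\<Phi> \<in> multilinear_maps J"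
      "alternating_on {..<dimension} \<Phi>" "\<Phi> a \<noteq> 0" by blast
    obtain t where t: "t \<notin> J" using ex_new_if_finite[OF infinite_UNIV_nat J(1)] by blast
    obtain y where y: "\<Phi> a * y \<noteq> 0" using right_mult_nonzero[OF simple J(6)] by blast
    have "0 \<in> J" using J(3) d by auto
    then have "(\<lambda>a. \<Phi> a * a t) \<in> multilinear_maps (J \<union> {t})"
      using t by (intro multilinear_maps_mult J(4) multilinear_maps_arg) auto
    moreover have "alternating_on {..<dimension} (\<lambda>a. \<Phi> a * a t)"
      using J(5) by (auto simp: alternating_on_def)
    moreover have "\<Phi> (a(t := y)) = \<Phi> a"
      using t by (intro multilinear_maps_cong[OF J(4)]) auto
    moreover have "card (J \<union> {t}) = Suc r" using J(1,2) t by simp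
    moreover have "finite (J \<union> {t})" "{..<dimension} \<subseteq> J \<union> {t}" using J(1,3) by auto
    moreover have "\<Phi> (a(t := y)) * (a(t := y)) t \<noteq> 0"
      unfolding \<open>\<Phi> (a(t := y)) = \<Phi> a\<close> using y by simp
    ultimately show ?case
      by (intro exI[of _ "J \<union> {t}"] exI[of _ "\<lambda>a. \<Phi> a * a t"] exI[of _ "a(t := y)"] conjI)
  qed
  then show ?thesis by blast
qed

text \<open>The map \<open>x \<mapsto> (\<Sum>b\<in>Basis. tr (b x) b)\<close> is injective, hence invertible.\<close>

lemma dual_basis:
  assumes nondeg: "perp UNIV = {0}"
  shows "\<exists>e'. \<forall>b\<in>Basis. \<forall>c\<in>Basis. tr (b * e' c) = (if b = c then 1 else 0)"
proof -
  define f where "f x = (\<Sum>b\<in>Basis. tr (b * x) *s b)" for x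
  have f: "endo f"
  proof (rule endoI)
    show "f (x + y) = f x + f y" for x y
      by (simp add: f_def distrib_left tr_add scale_left_distrib sum.distrib)
    show "f (c *s x) = c *s f x" for c x
      by (simp add: f_def scale_mult_right tr_scale scale_sum_right)
  qed
  have coord_f: "coord b (f x) = tr (b * x)" if b: "b \<in> Basis" for b x
  proof -
    have "coord b (f x) = (\<Sum>c\<in>Basis. tr (c * x) * coord b c)"
      by (simp add: f_def coord_sum coord_scale)
    also have "\<dots> = (\<Sum>c\<in>Basis. if c = b then tr (b * x) else 0)"
      by (intro sum.cong refl) (auto simp: coord_Basis)
    also have "\<dots> = tr (b * x)" using b finite_Basis by simp
    finally show ?thesis .
  qed
  have "\<forall>x. f x = 0 \<longrightarrow> x = 0"
  proof (intro allI impI)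
    fix x assume fx: "f x = 0"
    have on_Basis: "tr (b * x) = 0" if "b \<in> Basis" for b
      using coord_f[OF that, of x] fx coord_0 by simp
    have hom: "module_hom scale (*) (\<lambda>y. tr (y * x))"
      by (simp add: module_hom_iff module_axioms module_times distrib_right scale_mult_left
          tr_add tr_scale)
    have "y \<in> span Basis" for y by (simp add: span_Basis)
    with hom on_Basis have "tr (y * x) = 0" for y by (rule module_hom.eq_0_on_span)
    then have "x \<in> perp UNIV" unfolding perp_def by (simp add: tr_comm[of x])
    then show "x = 0" using nondeg by simp
  qed
  then have "inj f" by (simp only: module_hom.inj_iff_eq_0[OF f])
  then have surj: "surj f"
    by (rule linear_inj_imp_surj[OF f[unfolded module_hom_iff_linear]])
  have "tr (b * inv f c) = (if b = c then 1 else 0)" if "b \<in> Basis" "c \<in> Basis" for b c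
    using coord_f[OF that(1), of "inv f c"] surj_f_inv_f[OF surj, of c] coord_Basis[OF that(2), of b]
    by simp
  then show ?thesis by blast
qed

end

section \<open>Many pairwise separated bijections\<close>

lemma bij_betw_of_equal_fibres:
  assumes fin: "finite P" "finite Q"
    and card: "\<And>\<kappa>. card {p \<in> P. f p = \<kappa>} = card {q \<in> Q. g q = \<kappa>}"
  shows "\<exists>\<pi>. bij_betw \<pi> P Q \<and> (\<forall>p\<in>P. g (\<pi> p) = f p)"
proof -
  have "\<forall>\<kappa>. \<exists>h. bij_betw h {p \<in> P. f p = \<kappa>} {q \<in> Q. g q = \<kappa>}"
    using finite_same_card_bij[OF _ _ card] fin by simp
  then obtain h where h: "\<forall>\<kappa>. bij_betw (h \<kappa>) {p \<in> P. f p = \<kappa>} {q \<in> Q. g q = \<kappa>}"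
    by (rule choice[THEN exE])
  define \<pi> where "\<pi> p = h (f p) p" for p
  have mem: "\<pi> p \<in> Q \<and> g (\<pi> p) = f p" if "p \<in> P" for p
    using bij_betwE[OF h[rule_format, of "f p"]] that by (simp add: \<pi>_def)
  have "inj_on \<pi> P"
  proof (rule inj_onI)
    fix p p' assume p: "p \<in> P" "p' \<in> P" "\<pi> p = \<pi> p'"
    then have "f p = f p'" using mem[of p] mem[of p'] by simp
    then show "p = p'"
      using p inj_onD[OF bij_betw_imp_inj_on[OF h[rule_format, of "f p"]], of p p'] by (simp add: \<pi>_def)
  qed
  moreover have "\<pi> ` P = Q"
  proof
    show "\<pi> ` P \<subseteq> Q" using mem by blast
    show "Q \<subseteq> \<pi> ` P"
    proof
      fix q assume "q \<in> Q"
      then have "q \<in> h (g q) ` {p \<in> P. f p = g q}"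
        using bij_betw_imp_surj_on[OF h[rule_format, of "g q"]] by simp
      then obtain p where "p \<in> P" "f p = g q" "q = h (g q) p" by blast
      then have "q = \<pi> p" by (simp add: \<pi>_def)
      then show "q \<in> \<pi> ` P" using \<open>p \<in> P\<close> by blast
    qed
  qed
  ultimately have "bij_betw \<pi> P Q" by (simp add: bij_betw_def)
  then show ?thesis using mem by blast
qed

text \<open>
  Suppose that \<open>\<pi>\<close> transports the colouring \<open>u\<close> to \<open>v\<close> and moves each point from its block to the
  block that is \<open>u p\<close> places further. If \<open>\<pi>\<close> also transports another such colouring \<open>u'\<close> to \<open>v'\<close>,
  then counting the sum of colour times block over all points in two ways gives
  \<open>\<Sum>u' u = \<Sum>u' u'\<close>; so \<open>u = u'\<close> if \<open>u\<close> and \<open>u'\<close> have the same norm.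
\<close>

lemma colouring_determined:
  fixes u u' bP :: "'p \<Rightarrow> int" and v v' bQ :: "'q \<Rightarrow> int"
  assumes fin: "finite P" and \<pi>: "bij_betw \<pi> P Q" and \<pi>': "bij_betw \<pi>' P Q"
    and b: "\<And>p. p \<in> P \<Longrightarrow> bQ (\<pi> p) = bP p + u p" "\<And>p. p \<in> P \<Longrightarrow> bQ (\<pi>' p) = bP p + u' p"
    and v': "\<And>p. p \<in> P \<Longrightarrow> v' (\<pi>' p) = u' p" "\<And>p. p \<in> P \<Longrightarrow> v' (\<pi> p) = u' p"
    and norm: "(\<Sum>p\<in>P. u p * u p) = (\<Sum>p\<in>P. u' p * u' p)"
    and p: "p \<in> P"
  shows "u p = u' p"
proof -
  have "(\<Sum>p\<in>P. u' p * (bP p + u p)) = (\<Sum>p\<in>P. v' (\<pi> p) * bQ (\<pi> p))"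
    by (intro sum.cong refl) (simp add: b v')
  also have "\<dots> = (\<Sum>q\<in>Q. v' q * bQ q)"
    by (rule sum.reindex_bij_betw[OF \<pi>])
  also have "\<dots> = (\<Sum>p\<in>P. v' (\<pi>' p) * bQ (\<pi>' p))"
    by (rule sum.reindex_bij_betw[OF \<pi>', symmetric])
  also have "\<dots> = (\<Sum>p\<in>P. u' p * (bP p + u' p))"
    by (intro sum.cong refl) (simp add: b v')
  finally have "(\<Sum>p\<in>P. u' p * u p) = (\<Sum>p\<in>P. u' p * u' p)"
    by (simp add: distrib_left sum.distrib)
  moreover have "(\<Sum>p\<in>P. (u p - u' p) * (u p - u' p))
      = (\<Sum>p\<in>P. u p * u p) - 2 * (\<Sum>p\<in>P. u' p * u p) + (\<Sum>p\<in>P. u' p * u' p)"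
    by (simp add: algebra_simps sum.distrib sum_subtractf sum_distrib_left)
  ultimately have "(\<Sum>p\<in>P. (u p - u' p) * (u p - u' p)) = 0" using norm by simp
  then have "\<forall>p\<in>P. (u p - u' p) * (u p - u' p) = 0"
    using fin by (subst (asm) sum_nonneg_eq_0_iff) auto
  then show ?thesis using p by simp
qed

lemma card_nth_eq_count: "card {t. t < length l \<and> l ! t = x} = count (mset l) x"
proof -
  have "count (mset l) x = length (filter (\<lambda>y. y = x) l)"
    by (induction l) auto
  then show ?thesis by (simp add: length_filter_conv_card)
qed

lemma fact_mult_power_le: "fact n * n ^ d \<le> (fact (n + d) :: nat)"
proof (induction d)
  case (Suc d)
  have "fact n * n ^ Suc d = n * (fact n * n ^ d)" by simp
  also have "\<dots> \<le> Suc (n + d) * fact (n + d)" using Suc by (intro mult_mono) auto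
  finally show ?case by simp
qed simp

lemma power_le_multinomial:
  fixes d k :: nat
  assumes "k \<ge> 1"
  shows "d ^ (k * d) * fact k ^ d \<le> fact (k * d) * (k * d) ^ d"
  using assms
proof (induction k rule: dec_induct)
  case base
  have "1 \<le> (fact d :: nat)" by (rule fact_ge_1)
  then show ?case by simp
next
  case (step k)
  have "d ^ (Suc k * d) = d ^ (k * d) * d ^ d" by (simp add: power_add)
  moreover have "fact (Suc k) ^ d = Suc k ^ d * fact k ^ d"
    by (simp only: fact_Suc of_nat_id power_mult_distrib)
  moreover have "(Suc k * d) ^ d = Suc k ^ d * d ^ d" by (rule power_mult_distrib)
  ultimately have "d ^ (Suc k * d) * fact (Suc k) ^ d = (d ^ (k * d) * fact k ^ d) * (Suc k * d) ^ d"
    by (simp only: mult_ac)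
  also have "\<dots> \<le> (fact (k * d) * (k * d) ^ d) * (Suc k * d) ^ d"
    using step.IH by (rule mult_right_mono) simp
  also have "\<dots> \<le> fact (k * d + d) * (Suc k * d) ^ d"
    using fact_mult_power_le by (rule mult_right_mono) simp
  finally show ?case by (simp add: add.commute)
qed

text \<open>Its permutations are the balanced words: each of the \<open>d\<close> letters occurs \<open>k\<close> times.\<close>

definition balanced_mset :: "nat \<Rightarrow> nat \<Rightarrow> nat multiset" where
  "balanced_mset d k = (\<Sum>i<d. replicate_mset k i)"

lemma count_balanced_mset: "count (balanced_mset d k) i = (if i < d then k else 0)"
  by (simp add: balanced_mset_def count_sum)

lemma size_balanced_mset: "size (balanced_mset d k) = k * d"
  by (simp add: balanced_mset_def size_multiset_sum)

text \<open>Among all words of length \<open>k d\<close>, the balanced ones are a fraction of at least \<open>(k d)\<close> to the power \<open>- d\<close>.\<close>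

lemma power_le_card_balanced_words:
  assumes "k \<ge> 1"
  shows "d ^ (k * d) \<le> card (permutations_of_multiset (balanced_mset d k)) * (k * d) ^ d"
proof -
  let ?M = "card (permutations_of_multiset (balanced_mset d k))"
  have "set_mset (balanced_mset d k) = {..<d}"
    using assms by (auto simp: set_mset_def count_balanced_mset split: if_splits)
  then have "?M * (\<Prod>x<d. fact (count (balanced_mset d k) x)) = fact (k * d)"
    using card_permutations_of_multiset_aux[of "balanced_mset d k"] by (simp add: size_balanced_mset)
  then have M: "fact (k * d) = ?M * fact k ^ d" by (simp add: count_balanced_mset)
  have "d ^ (k * d) * fact k ^ d \<le> fact (k * d) * (k * d) ^ d"
    by (rule power_le_multinomial[OF assms])
  also have "\<dots> = (?M * (k * d) ^ d) * fact k ^ d"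
    unfolding M by (simp only: mult_ac)
  finally have "d ^ (k * d) * fact k ^ d \<le> (?M * (k * d) ^ d) * fact k ^ d" .
  moreover have "0 < (fact k ^ d :: nat)" by simp
  ultimately show ?thesis by (simp only: mult_le_cancel2)
qed

text \<open>
  The points of \<open>P\<close> lie in \<open>s\<close> blocks of size \<open>k d\<close>, each with a balanced colouring. A bijection moves
  the points of colour \<open>i\<close> by \<open>i\<close> blocks, to a set \<open>Q\<close> of \<open>s + d - 1\<close> blocks: the \<open>c\<close>-th receives
  \<open>k\<close> points of each colour \<open>i\<close> such that \<open>c - i\<close> is a block of \<open>P\<close>, and these may be placed arbitrarily.
\<close>

lemma separated_bijections_exist:
  fixes d k s :: nat
  assumes d: "d \<ge> 1" and s: "s \<ge> d"
  defines "m \<equiv> k * d * s" and "M \<equiv> card (permutations_of_multiset (balanced_mset d k))"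
  shows "\<exists>Fam :: ((nat \<Rightarrow> nat) \<times> (nat \<Rightarrow> nat) \<times> (nat \<Rightarrow> nat)) set. finite Fam \<and>
    M ^ (2 * s + 1 - d) \<le> card Fam \<and>
    (\<forall>(u, v, \<pi>)\<in>Fam. bij_betw \<pi> {..<m} {..<m} \<and> (\<forall>p<m. u p < d \<and> v p < d \<and> u p = v (\<pi> p))) \<and>
    (\<forall>(u, v, \<pi>)\<in>Fam. \<forall>(u', v', \<pi>')\<in>Fam. (u, v, \<pi>) \<noteq> (u', v', \<pi>') \<longrightarrow> (\<exists>p<m. u' p \<noteq> v' (\<pi> p)))"
proof -
  define X where "X = balanced_mset d k"
  define Xq where "Xq c = filter_mset (\<lambda>i. i \<le> c \<and> c - i < s) X" for c
  \<comment> \<open>the last block of \<open>P\<close> moves by at most \<open>d - 1\<close>\<close>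
  define nQ where "nQ = s + d - 1"
  define P where "P = {..<s} \<times> {..<k * d}"
  define Q where "Q = Sigma {..<nQ} (\<lambda>c. {..<size (Xq c)})"
  define U where "U = {..<s} \<rightarrow>\<^sub>E permutations_of_multiset X"
  define V where "V = (\<Pi>\<^sub>E c\<in>{..<nQ}. permutations_of_multiset (Xq c))"
  define col :: "(nat \<Rightarrow> nat list) \<Rightarrow> nat \<times> nat \<Rightarrow> nat" where "col w p = w (fst p) ! snd p" for w p
  have finPQ: "finite P" "finite Q" by (auto simp: P_def Q_def)
  have finUV: "finite U" "finite V" by (auto simp: U_def V_def intro!: finite_PiE)
  have U: "mset (us b) = X \<and> length (us b) = k * d" if "us \<in> U" "b < s" for us b
  proof -
    have "us b \<in> permutations_of_multiset X" using that by (auto simp: U_def)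
    then have "mset (us b) = X" by (rule permutations_of_multisetD)
    then show ?thesis using size_balanced_mset[of d k] by (metis X_def size_mset)
  qed
  have V: "mset (vs c) = Xq c \<and> length (vs c) = size (Xq c)" if "vs \<in> V" "c < nQ" for vs c
  proof -
    have "vs c \<in> permutations_of_multiset (Xq c)" using that by (auto simp: V_def)
    then have "mset (vs c) = Xq c" by (rule permutations_of_multisetD)
    then show ?thesis by (metis size_mset)
  qed
  have countX: "count X i = (if i < d then k else 0)" for i by (simp add: X_def count_balanced_mset)
  have colU: "col us p < d" if "us \<in> U" "p \<in> P" for us p
  proof -
    have "col us p \<in># X"
    proof -
      have p: "fst p < s" "snd p < k * d" using that(2) by (auto simp: P_def)
      then have "us (fst p) ! snd p \<in># mset (us (fst p))"
        using U[OF that(1) p(1)] by (intro nth_mem_mset) simp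
      then show ?thesis using U[OF that(1) p(1)] by (simp add: col_def)
    qed
    then show ?thesis using countX[of "col us p"] by (auto simp flip: count_greater_zero_iff split: if_splits)
  qed
  have colV: "col vs q < d" if "vs \<in> V" "q \<in> Q" for vs q
  proof -
    have "col vs q \<in># Xq (fst q)"
    proof -
      have q: "fst q < nQ" "snd q < size (Xq (fst q))" using that(2) by (auto simp: Q_def)
      then have "vs (fst q) ! snd q \<in># mset (vs (fst q))"
        using V[OF that(1) q(1)] by (intro nth_mem_mset) simp
      then show ?thesis using V[OF that(1) q(1)] by (simp add: col_def)
    qed
    then have "col vs q \<in># X" by (simp add: Xq_def)
    then show ?thesis using countX[of "col vs q"] by (auto simp flip: count_greater_zero_iff split: if_splits)
  qed
  define good where "good us vs \<pi> \<longleftrightarrow> bij_betw \<pi> P Q \<and>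
    (\<forall>p\<in>P. fst (\<pi> p) = fst p + col us p \<and> col vs (\<pi> p) = col us p)" for us vs \<pi>
  have ex: "\<exists>\<pi>. good us vs \<pi>" if us: "us \<in> U" and vs: "vs \<in> V" for us vs
  proof -
    have "\<exists>\<pi>. bij_betw \<pi> P Q \<and> (\<forall>p\<in>P. (fst (\<pi> p), col vs (\<pi> p)) = (fst p + col us p, col us p))"
    proof (rule bij_betw_of_equal_fibres[OF finPQ])
      fix \<kappa> :: "nat \<times> nat"
      obtain c i where \<kappa>: "\<kappa> = (c, i)" by force
      let ?ok = "i < d \<and> i \<le> c \<and> c - i < s"
      have "card {p \<in> P. (fst p + col us p, col us p) = \<kappa>} = (if ?ok then k else 0)"
      proof (cases "i \<le> c \<and> c - i < s")
        case True
        have "{p \<in> P. (fst p + col us p, col us p) = \<kappa>} = Pair (c - i) ` {t. t < length (us (c - i)) \<and> us (c - i) ! t = i}"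
          using True U[OF us, of "c - i"] by (auto simp: P_def col_def \<kappa>)
        then have "card {p \<in> P. (fst p + col us p, col us p) = \<kappa>} = count X i"
          using True U[OF us, of "c - i"] card_nth_eq_count[of "us (c - i)" i]
          by (simp add: card_image inj_on_def)
        then show ?thesis using True by (simp add: countX)
      next
        case False
        then have "{p \<in> P. (fst p + col us p, col us p) = \<kappa>} = {}" by (auto simp: P_def \<kappa>)
        then show ?thesis using False by (simp only: card.empty) auto
      qed
      moreover have "card {q \<in> Q. (fst q, col vs q) = \<kappa>} = (if ?ok then k else 0)"
      proof (cases "c < nQ")
        case True
        have "{q \<in> Q. (fst q, col vs q) = \<kappa>} = Pair c ` {t. t < length (vs c) \<and> vs c ! t = i}"
          using True V[OF vs, of c] by (auto simp: Q_def col_def \<kappa>)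
        then have "card {q \<in> Q. (fst q, col vs q) = \<kappa>} = count (Xq c) i"
          using True V[OF vs, of c] card_nth_eq_count[of "vs c" i]
          by (simp add: card_image inj_on_def)
        then show ?thesis by (simp add: Xq_def countX)
      next
        case False
        then have "{q \<in> Q. (fst q, col vs q) = \<kappa>} = {}" by (auto simp: Q_def \<kappa>)
        moreover have "\<not> ?ok" using False by (auto simp: nQ_def)
        ultimately show ?thesis by (simp only: card.empty if_False)
      qed
      ultimately show "card {p \<in> P. (fst p + col us p, col us p) = \<kappa>} = card {q \<in> Q. (fst q, col vs q) = \<kappa>}"
        by simp
    qed
    then show ?thesis by (simp add: good_def)
  qed
  define pi where "pi us vs = (SOME \<pi>. good us vs \<pi>)" for us vs
  have pi: "good us vs (pi us vs)" if "us \<in> U" "vs \<in> V" for us vs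
    unfolding pi_def by (rule someI_ex[OF ex[OF that]])
  have norm: "(\<Sum>p\<in>P. int (col us p) * int (col us p)) = int s * (\<Sum>x\<in>#X. int x * int x)"
    if us: "us \<in> U" for us
  proof -
    have "(\<Sum>p\<in>P. int (col us p) * int (col us p))
        = (\<Sum>b<s. \<Sum>t<k * d. int (us b ! t) * int (us b ! t))"
      by (simp add: P_def col_def sum.cartesian_product case_prod_beta)
    also have "\<dots> = (\<Sum>b<s. (\<Sum>x\<in>#X. int x * int x))"
    proof (rule sum.cong[OF refl])
      fix b assume "b \<in> {..<s}"
      then have b: "mset (us b) = X" "length (us b) = k * d" using U[OF us, of b] by auto
      have "(\<Sum>t<k * d. int (us b ! t) * int (us b ! t)) = sum_list (map (\<lambda>x. int x * int x) (us b))"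
        by (simp add: sum_list_sum_nth b(2) atLeast0LessThan)
      also have "\<dots> = (\<Sum>x\<in>#mset (us b). int x * int x)"
        by (simp flip: sum_mset_sum_list)
      finally show "(\<Sum>t<k * d. int (us b ! t) * int (us b ! t)) = (\<Sum>x\<in>#X. int x * int x)"
        by (simp add: b(1))
    qed
    finally show ?thesis by simp
  qed
  have sep: "us = us' \<and> vs = vs'"
    if us: "us \<in> U" "us' \<in> U" and vs: "vs \<in> V" "vs' \<in> V"
      and eq: "\<And>p. p \<in> P \<Longrightarrow> col vs' (pi us vs p) = col us' p" for us us' vs vs'
  proof -
    note g = pi[OF us(1) vs(1), unfolded good_def] and g' = pi[OF us(2) vs(2), unfolded good_def]
    have u_eq: "col us p = col us' p" if p: "p \<in> P" for p
    proof -
      have "int (col us p) = int (col us' p)"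
      proof (rule colouring_determined[where u = "\<lambda>p. int (col us p)" and u' = "\<lambda>p. int (col us' p)"
            and v' = "\<lambda>q. int (col vs' q)" and bP = "\<lambda>p. int (fst p)" and bQ = "\<lambda>q. int (fst q)"])
        show "bij_betw (pi us vs) P Q" "bij_betw (pi us' vs') P Q" using g g' by simp_all
        show "(\<Sum>p\<in>P. int (col us p) * int (col us p)) = (\<Sum>p\<in>P. int (col us' p) * int (col us' p))"
          using norm us by simp
      qed (use g g' eq p finPQ in simp_all)
      then show ?thesis by simp
    qed
    have "us b = us' b" if b: "b < s" for b
    proof (rule nth_equalityI)
      show "length (us b) = length (us' b)" using U us b by simp
      fix t assume "t < length (us b)"
      then have "(b, t) \<in> P" using U[OF us(1) b] b by (simp add: P_def)
      from u_eq[OF this] show "us b ! t = us' b ! t" by (simp add: col_def)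
    qed
    then have "us = us'" using us unfolding U_def by (intro PiE_ext) auto
    have v_eq: "col vs q = col vs' q" if "q \<in> Q" for q
    proof -
      have "q \<in> pi us vs ` P" using that g by (simp add: bij_betw_def)
      then obtain p where "p \<in> P" "q = pi us vs p" by blast
      then show ?thesis using g eq u_eq by simp
    qed
    have "vs c = vs' c" if c: "c < nQ" for c
    proof (rule nth_equalityI)
      show "length (vs c) = length (vs' c)" using V vs c by simp
      fix t assume "t < length (vs c)"
      then have "(c, t) \<in> Q" using V[OF vs(1) c] c by (simp add: Q_def)
      from v_eq[OF this] show "vs c ! t = vs' c ! t" by (simp add: col_def)
    qed
    then have "vs = vs'" using vs unfolding V_def by (intro PiE_ext) auto
    with \<open>us = us'\<close> show ?thesis by simp
  qed
  have cardP: "card P = m" by (simp add: P_def m_def mult_ac)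
  have perm_pos: "1 \<le> card (permutations_of_multiset Y)" for Y :: "nat multiset"
    using permutations_of_multiset_not_empty[of Y] finite_permutations_of_multiset[of Y]
    by (simp add: Suc_le_eq card_gt_0_iff)
  have cardU: "card U = M ^ s" by (simp add: U_def card_PiE M_def X_def)
  \<comment> \<open>only the blocks \<open>d - 1, \<dots>, s - 1\<close> of \<open>Q\<close> receive all colours\<close>
  have cardV: "M ^ (s + 1 - d) \<le> card V"
  proof -
    have "M ^ (s + 1 - d) = (\<Prod>c\<in>{d - 1..<s}. M)"
      using d s by (simp add: Suc_diff_le)
    also have "\<dots> = (\<Prod>c\<in>{d - 1..<s}. card (permutations_of_multiset (Xq c)))"
    proof (rule prod.cong[OF refl])
      fix c assume c: "c \<in> {d - 1..<s}"
      have "Xq c = X"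
        by (rule multiset_eqI) (use c in \<open>auto simp: Xq_def countX\<close>)
      then show "M = card (permutations_of_multiset (Xq c))" by (simp add: M_def X_def)
    qed
    also have "\<dots> \<le> (\<Prod>c<nQ. card (permutations_of_multiset (Xq c)))"
    proof -
      have "{d - 1..<s} \<subseteq> {..<nQ}" using d by (auto simp: nQ_def)
      then have "(\<Prod>c<nQ. card (permutations_of_multiset (Xq c)))
          = (\<Prod>c\<in>{..<nQ} - {d - 1..<s}. card (permutations_of_multiset (Xq c)))
            * (\<Prod>c\<in>{d - 1..<s}. card (permutations_of_multiset (Xq c)))"
        by (intro prod.subset_diff) simp_all
      moreover have "1 \<le> (\<Prod>c\<in>{..<nQ} - {d - 1..<s}. card (permutations_of_multiset (Xq c)))"
        using perm_pos by (intro prod_ge_1)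
      ultimately show ?thesis by simp
    qed
    also have "\<dots> = card V" by (simp add: V_def card_PiE)
    finally show ?thesis .
  qed
  have "U \<noteq> {}" "V \<noteq> {}" by (simp_all add: U_def V_def PiE_eq_empty_iff permutations_of_multiset_not_empty)
  then obtain us0 vs0 where "us0 \<in> U" "vs0 \<in> V" by blast
  then have cardQ: "card Q = m" using pi[of us0 vs0] cardP by (auto simp: good_def dest: bij_betw_same_card)
  obtain f where f: "bij_betw f {..<m} P"
    using ex_bij_betw_nat_finite[OF finPQ(1)] by (auto simp: cardP atLeast0LessThan)
  obtain g where g: "bij_betw g {..<m} Q"
    using ex_bij_betw_nat_finite[OF finPQ(2)] by (auto simp: cardQ atLeast0LessThan)
  define g' where "g' = inv_into {..<m} g"
  have g': "bij_betw g' Q {..<m}" unfolding g'_def by (rule bij_betw_inv_into[OF g])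
  have gg': "g (g' q) = q" if "q \<in> Q" for q
    unfolding g'_def using that g by (intro f_inv_into_f) (simp add: bij_betw_def)
  define triple where "triple x = (\<lambda>p. col (fst x) (f p), \<lambda>q. col (snd x) (g q),
    \<lambda>p. g' (pi (fst x) (snd x) (f p)))" for x
  have fP: "f p \<in> P" "g p \<in> Q" if "p < m" for p
    using f g that by (auto simp: bij_betw_def)
  have bij: "bij_betw (\<lambda>p. g' (pi us vs (f p))) {..<m} {..<m}" if "us \<in> U" "vs \<in> V" for us vs
    using bij_betw_trans[OF bij_betw_trans[OF f] g', of "pi us vs"] pi[OF that]
    by (simp add: good_def o_def)
  have transport: "col vs' (g (g' (pi us vs (f p)))) = col vs' (pi us vs (f p))"
    if "us \<in> U" "vs \<in> V" "p < m" for us vs vs' p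
  proof -
    have "pi us vs (f p) \<in> Q" using pi[OF that(1,2)] fP(1)[OF that(3)] by (auto simp: good_def bij_betw_def)
    then show ?thesis by (simp add: gg')
  qed
  have off: "\<exists>p<m. col us' (f p) \<noteq> col vs' (g (g' (pi us vs (f p))))"
    if x: "us \<in> U" "vs \<in> V" "us' \<in> U" "vs' \<in> V" and ne: "(us, vs) \<noteq> (us', vs')" for us vs us' vs'
  proof (rule ccontr)
    assume contra: "\<not> ?thesis"
    have "col vs' (pi us vs p) = col us' p" if p: "p \<in> P" for p
    proof -
      have "p \<in> f ` {..<m}" using p f by (simp add: bij_betw_def)
      then obtain i where "i < m" "p = f i" by blast
      then show ?thesis using contra transport[OF x(1,2), of i vs'] by auto
    qed
    from sep[OF x(1,3,2,4) this] ne show False by simp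
  qed
  have diag: "col us (f p) = col vs (g (g' (pi us vs (f p))))" if "us \<in> U" "vs \<in> V" "p < m" for us vs p
    using transport[OF that, of vs] pi[OF that(1,2)] fP(1)[OF that(3)] by (simp add: good_def)
  have inj: "inj_on triple (U \<times> V)"
  proof (rule inj_onI, rule ccontr)
    fix x y assume xy: "x \<in> U \<times> V" "y \<in> U \<times> V" "triple x = triple y" "x \<noteq> y"
    then obtain p where p: "p < m" "col (fst y) (f p) \<noteq> col (snd y) (g (g' (pi (fst x) (snd x) (f p))))"
      using off[of "fst x" "snd x" "fst y" "snd y"] by (auto simp: prod_eq_iff)
    have "col (fst x) (f p) = col (fst y) (f p)" "col (snd x) q = col (snd y) q" if "q = g (g' (pi (fst x) (snd x) (f p)))" for q
      using xy(3) that by (auto simp: triple_def fun_eq_iff)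
    then show False using p diag[of "fst x" "snd x" p] xy(1) by auto
  qed
  have "M ^ (2 * s + 1 - d) = M ^ s * M ^ (s + 1 - d)"
  proof -
    have "2 * s + 1 - d = s + (s + 1 - d)" using s by linarith
    then show ?thesis by (simp only: power_add)
  qed
  also have "\<dots> \<le> card U * card V" using cardU cardV by simp
  also have "\<dots> = card (triple ` (U \<times> V))" by (simp add: card_image[OF inj] card_cartesian_product)
  finally have card: "M ^ (2 * s + 1 - d) \<le> card (triple ` (U \<times> V))" .
  show ?thesis
  proof (intro exI[of _ "triple ` (U \<times> V)"] conjI)
    show "finite (triple ` (U \<times> V))" using finUV by simp
    show "\<forall>(u, v, \<pi>)\<in>triple ` (U \<times> V). bij_betw \<pi> {..<m} {..<m} \<and>
        (\<forall>p<m. u p < d \<and> v p < d \<and> u p = v (\<pi> p))"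
    proof
      fix x assume "x \<in> triple ` (U \<times> V)"
      then obtain us vs where x: "x = triple (us, vs)" and in_UV: "us \<in> U" "vs \<in> V" by blast
      have "bij_betw (\<lambda>p. g' (pi us vs (f p))) {..<m} {..<m} \<and>
          (\<forall>p<m. col us (f p) < d \<and> col vs (g p) < d \<and> col us (f p) = col vs (g (g' (pi us vs (f p)))))"
        using bij[OF in_UV] diag[OF in_UV] colU[OF in_UV(1) fP(1)] colV[OF in_UV(2) fP(2)] by blast
      then show "case x of (u, v, \<pi>) \<Rightarrow> bij_betw \<pi> {..<m} {..<m} \<and>
          (\<forall>p<m. u p < d \<and> v p < d \<and> u p = v (\<pi> p))"
        unfolding x triple_def fst_conv snd_conv prod.case .
    qed
    show "\<forall>(u, v, \<pi>)\<in>triple ` (U \<times> V). \<forall>(u', v', \<pi>')\<in>triple ` (U \<times> V).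
        (u, v, \<pi>) \<noteq> (u', v', \<pi>') \<longrightarrow> (\<exists>p<m. u' p \<noteq> v' (\<pi> p))"
    proof
      fix x assume "x \<in> triple ` (U \<times> V)"
      then obtain us vs where x: "x = triple (us, vs)" and in_UV: "us \<in> U" "vs \<in> V" by blast
      have "case y of (u', v', \<pi>') \<Rightarrow> triple (us, vs) \<noteq> (u', v', \<pi>') \<longrightarrow>
          (\<exists>p<m. u' p \<noteq> v' (g' (pi us vs (f p))))" if y_in: "y \<in> triple ` (U \<times> V)" for y
      proof -
        obtain us' vs' where y: "y = triple (us', vs')" and in_UV': "us' \<in> U" "vs' \<in> V"
          using y_in by blast
        have "\<exists>p<m. col us' (f p) \<noteq> col vs' (g (g' (pi us vs (f p))))"
          if "triple (us, vs) \<noteq> triple (us', vs')"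
          using that by (intro off[OF in_UV in_UV']) blast
        then show ?thesis
          unfolding y triple_def fst_conv snd_conv prod.case by (rule impI)
      qed
      then show "case x of (u, v, \<pi>) \<Rightarrow> \<forall>(u', v', \<pi>')\<in>triple ` (U \<times> V).
          (u, v, \<pi>) \<noteq> (u', v', \<pi>') \<longrightarrow> (\<exists>p<m. u' p \<noteq> v' (\<pi> p))"
        unfolding x triple_def fst_conv snd_conv prod.case by (rule ballI)
    qed
  qed (rule card)
qed

section \<open>The lower bound for graded simple algebras\<close>

context fin_dim_graded_algebra
begin

text \<open>
  The products of values of the trace form along the bijections \<open>\<pi>\<close>, evaluated at basis vectors
  \<open>e (u p)\<close> and dual basis vectors \<open>e' (v q)\<close>, test whether \<open>u = v \<circ> \<pi>\<close>.
\<close>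

lemma card_le_gr_codim:
  assumes nondeg: "perp UNIV = {0}"
    and J: "finite J" "{..<dimension} \<subseteq> J" "J \<noteq> {}"
    and \<Phi>: "\<Phi> \<in> multilinear_maps J" "alternating_on {..<dimension} \<Phi>" "\<Phi> a\<^sub>0 \<noteq> 0"
    and fin: "finite Fam"
    and bij: "\<And>u v \<pi>. (u, v, \<pi>) \<in> Fam \<Longrightarrow> bij_betw \<pi> {..<m} {..<m}"
    and range: "\<And>u v \<pi> p. (u, v, \<pi>) \<in> Fam \<Longrightarrow> p < m \<Longrightarrow> u p < dimension \<and> v p < dimension"
    and diag: "\<And>u v \<pi> p. (u, v, \<pi>) \<in> Fam \<Longrightarrow> p < m \<Longrightarrow> u p = v (\<pi> p)"
    and off: "\<And>u v \<pi> u' v' \<pi>'. (u, v, \<pi>) \<in> Fam \<Longrightarrow> (u', v', \<pi>') \<in> Fam \<Longrightarrow>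
      (u, v, \<pi>) \<noteq> (u', v', \<pi>') \<Longrightarrow> \<exists>p<m. u' p \<noteq> v' (\<pi> p)"
  shows "card Fam \<le> gr_codim (2 * m + card J)"
proof -
  obtain e where e: "bij_betw e {..<dimension} Basis"
    using ex_bij_betw_nat_finite[OF finite_Basis] by (auto simp: dimension_def atLeast0LessThan)
  have eB: "e i \<in> Basis" if "i < dimension" for i using e that by (auto simp: bij_betw_def)
  have inj: "e i = e j \<longleftrightarrow> i = j" if "i < dimension" "j < dimension" for i j
    using e that by (auto simp: bij_betw_def inj_on_def)
  from dual_basis[OF nondeg] obtain e' where
    dual: "\<forall>b\<in>Basis. \<forall>c\<in>Basis. tr (b * e' c) = (if b = c then 1 else 0)" ..
  note e' = dual[rule_format]
  from J(1) obtain N where "\<forall>j\<in>J. j < N"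
    unfolding finite_nat_set_iff_bounded ..
  then have N: "j < N" if "j \<in> J" for j using that by blast
  \<comment> \<open>arguments beyond \<open>J\<close>: even offsets for basis vectors, odd offsets for dual basis vectors\<close>
  define \<alpha> \<gamma> where "\<alpha> p = N + 2 * p" and "\<gamma> p = N + 2 * p + 1" for p :: nat
  define J' where "J' = J \<union> \<alpha> ` {..<m} \<union> \<gamma> ` {..<m}"
  let ?n = "2 * m + card J"
  have disj: "\<alpha> ` S \<inter> \<gamma> ` S' = {}" "(\<alpha> ` S \<union> \<gamma> ` S') \<inter> J = {}" for S S'
  proof -
    have "\<alpha> p \<noteq> \<gamma> q" for p q unfolding \<alpha>_def \<gamma>_def by presburger
    then show "\<alpha> ` S \<inter> \<gamma> ` S' = {}" by auto
    show "(\<alpha> ` S \<union> \<gamma> ` S') \<inter> J = {}" using N by (fastforce simp: \<alpha>_def \<gamma>_def)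
  qed
  have inj\<alpha>\<gamma>: "inj_on \<alpha> S" "inj_on \<gamma> S" for S by (auto simp: inj_on_def \<alpha>_def \<gamma>_def)
  have finJ': "finite J'" using J(1) by (simp add: J'_def)
  have "card J' = card J + card (\<alpha> ` {..<m} \<union> \<gamma> ` {..<m})"
    unfolding J'_def Un_assoc using J(1) disj(2)[of "{..<m}" "{..<m}"]
    by (intro card_Un_disjoint) auto
  also have "card (\<alpha> ` {..<m} \<union> \<gamma> ` {..<m}) = 2 * m"
    using disj(1)[of "{..<m}" "{..<m}"] by (subst card_Un_disjoint) (simp_all add: card_image inj\<alpha>\<gamma>)
  finally have "card J' = card {1..?n}" by simp
  then obtain g where g: "bij_betw g J' {1..?n}"
    using finite_same_card_bij[OF finJ'] by blast
  define h where "h = inv_into J' g"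
  have hg: "h (g j) = j" if "j \<in> J'" for j
    using g that unfolding h_def bij_betw_def by (simp add: inv_into_f_f)
  define F where "F \<pi> a = (\<Prod>p<m. tr (a (\<alpha> p) * a (\<gamma> (\<pi> p)))) *s \<Phi> a" for \<pi> a
  define pt where "pt u v j = (if j < N then a\<^sub>0 j else if even (j - N) then e (u ((j - N) div 2))
    else e' (e (v ((j - N) div 2))))" for u v :: "nat \<Rightarrow> nat" and j
  have F: "F \<pi> \<in> multilinear_maps J'" if \<pi>: "bij_betw \<pi> {..<m} {..<m}" for \<pi>
  proof -
    have img: "(\<lambda>p. \<gamma> (\<pi> p)) ` {..<m} = \<gamma> ` {..<m}"
      using \<pi> by (simp add: bij_betw_def flip: image_image)
    have "inj_on (\<lambda>p. \<gamma> (\<pi> p)) {..<m}"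
      using \<pi> by (auto simp: bij_betw_def inj_on_def \<gamma>_def)
    then have "(\<lambda>a. (\<Prod>p\<in>{..<m}. tr (a (\<alpha> p) * a (\<gamma> (\<pi> p)))) *s \<Phi> a)
        \<in> multilinear_maps (J \<union> \<alpha> ` {..<m} \<union> (\<lambda>p. \<gamma> (\<pi> p)) ` {..<m})"
      using disj inj\<alpha>\<gamma> unfolding img
      by (intro trace_form_prod_in[OF \<Phi>(1) J(2,3) \<Phi>(2), of "{..<m}" \<alpha> "\<lambda>p. \<gamma> (\<pi> p)", unfolded img]) simp_all
    then show ?thesis unfolding F_def img J'_def by (simp only:)
  qed
  have F_pt: "F \<pi> (pt u v) = (if \<forall>p<m. u p = v (\<pi> p) then \<Phi> a\<^sub>0 else 0)"
    if \<pi>: "bij_betw \<pi> {..<m} {..<m}" and uv: "\<And>p. p < m \<Longrightarrow> u p < dimension \<and> v p < dimension" for \<pi> u v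
  proof -
    have \<pi>m: "\<pi> p < m" if "p < m" for p using \<pi> that by (auto simp: bij_betw_def)
    have "tr (pt u v (\<alpha> p) * pt u v (\<gamma> (\<pi> p))) = (if u p = v (\<pi> p) then 1 else 0)" if "p < m" for p
    proof -
      have "pt u v (\<alpha> p) = e (u p)" "pt u v (\<gamma> (\<pi> p)) = e' (e (v (\<pi> p)))"
        by (simp_all add: pt_def \<alpha>_def \<gamma>_def)
      moreover have "u p < dimension" "v (\<pi> p) < dimension" using uv \<pi>m that by blast+
      ultimately show ?thesis using e' eB inj by simp
    qed
    then have "(\<Prod>p<m. tr (pt u v (\<alpha> p) * pt u v (\<gamma> (\<pi> p)))) = (\<Prod>p<m. if u p = v (\<pi> p) then 1 else 0)"
      by (intro prod.cong refl) simp
    also have "\<dots> = (if \<forall>p<m. u p = v (\<pi> p) then 1 else 0)"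
      by (auto intro!: prod.neutral)
    finally have prod: "(\<Prod>p<m. tr (pt u v (\<alpha> p) * pt u v (\<gamma> (\<pi> p))))
        = (if \<forall>p<m. u p = v (\<pi> p) then 1 else 0)" .
    have "\<Phi> (pt u v) = \<Phi> a\<^sub>0"
      using N by (intro multilinear_maps_cong[OF \<Phi>(1)]) (simp add: pt_def)
    then show ?thesis
      unfolding F_def prod
      by (simp only: if_distrib[where f = "\<lambda>c. c *s \<Phi> a\<^sub>0"] scale_one scale_zero_left)
  qed
  define G where "G x = (\<lambda>a. F (snd (snd x)) (\<lambda>j. a (g j)))" for x :: "(nat \<Rightarrow> nat) \<times> (nat \<Rightarrow> nat) \<times> (nat \<Rightarrow> nat)"
  define point where "point x = (\<lambda>i. pt (fst x) (fst (snd x)) (h i))" for x :: "(nat \<Rightarrow> nat) \<times> (nat \<Rightarrow> nat) \<times> (nat \<Rightarrow> nat)"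
  have G_pt: "G x (point y) = (if \<forall>p<m. fst y p = fst (snd y) (snd (snd x) p) then \<Phi> a\<^sub>0 else 0)"
    if "x \<in> Fam" "y \<in> Fam" for x y
  proof -
    obtain u v \<pi> where x: "x = (u, v, \<pi>)" by (metis prod.exhaust)
    obtain u' v' \<pi>' where y: "y = (u', v', \<pi>')" by (metis prod.exhaust)
    have \<pi>: "bij_betw \<pi> {..<m} {..<m}" using that(1) x bij by blast
    have "G x (point y) = F \<pi> (\<lambda>j. pt u' v' (h (g j)))" by (simp add: G_def point_def x y)
    also have "\<dots> = F \<pi> (pt u' v')"
      by (rule multilinear_maps_cong[OF F[OF \<pi>]]) (simp add: hg)
    also have "\<dots> = (if \<forall>p<m. u' p = v' (\<pi> p) then \<Phi> a\<^sub>0 else 0)"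
      using that(2) range by (intro F_pt[OF \<pi>]) (simp add: y)
    finally show ?thesis by (simp add: x y)
  qed
  have "card J > 0" using J by (simp add: card_gt_0_iff)
  then have n: "?n \<ge> 1" by simp
  have "card Fam \<le> vector_space.dim (fscale scale) (multilinear_maps {1..?n})"
  proof (rule dim_function_space_ge[OF vector_space_axioms multilinear_maps_finite_span fin,
        of "{1..?n}" G point])
    show "finite {1..?n}" by simp
    fix x assume x: "x \<in> Fam"
    obtain u v \<pi> where x': "x = (u, v, \<pi>)" by (metis prod.exhaust)
    have \<pi>: "bij_betw \<pi> {..<m} {..<m}" using x x' bij by blast
    have "J' \<noteq> {}" using J(3) by (auto simp: J'_def)
    have "(\<lambda>a. F \<pi> (\<lambda>j. (\<lambda>a. a (g j)) a)) \<in> multilinear_maps (\<Union>j\<in>J'. {g j})"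
      using g by (intro multilinear_maps_subst[OF F[OF \<pi>] \<open>J' \<noteq> {}\<close>] multilinear_maps_arg)
        (auto simp: bij_betw_def inj_on_def)
    moreover have "(\<Union>j\<in>J'. {g j}) = {1..?n}" using g by (auto simp: bij_betw_def)
    ultimately show "G x \<in> multilinear_maps {1..?n}" by (simp add: G_def x')
    show "G x (point x) \<noteq> 0"
      unfolding G_pt[OF x x] using diag x \<Phi>(3) by (simp add: x')
    show "G x (point y) = 0" if "y \<in> Fam" "x \<noteq> y" for y
    proof -
      obtain u' v' \<pi>' where y: "y = (u', v', \<pi>')" by (metis prod.exhaust)
      have "\<exists>p<m. u' p \<noteq> v' (\<pi> p)"
        using off[of u v \<pi> u' v' \<pi>'] x that by (simp add: x' y)
      then show ?thesis unfolding G_pt[OF x that(1)] by (auto simp: x' y)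
    qed
  qed
  then show ?thesis using gr_codim_eq_dim[OF n] by simp
qed

end

lemma power_shift_le:
  fixes q :: real
  assumes q: "q > 0" and E: "E \<le> n" "n \<le> E + c"
  shows "q ^ n \<le> max 1 q ^ c * q ^ E"
proof -
  have "q ^ (n - E) \<le> max 1 q ^ (n - E)" using q by (intro power_mono) auto
  also have "\<dots> \<le> max 1 q ^ c" using E by (intro power_increasing) auto
  finally have "q ^ (n - E) * q ^ E \<le> max 1 q ^ c * q ^ E"
    using q by (intro mult_right_mono) auto
  then show ?thesis using E by (simp flip: power_add)
qed

text \<open>The polynomial factor \<open>(k d) ^ d\<close> is absorbed by \<open>(d / q) ^ (k d)\<close> for large \<open>k\<close>.\<close>

lemma power_le_card_balanced_words_real:
  fixes q :: real
  assumes q: "0 < q" "q < real d"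
  shows "\<exists>k\<ge>1. q ^ (k * d) \<le> real (card (permutations_of_multiset (balanced_mset d k)))"
proof -
  have "(\<lambda>n. real n * (q / real d) ^ n) \<longlonglongrightarrow> 0"
    using q by (intro powser_times_n_limit_0) simp
  moreover have "0 < 1 / real d" using q by simp
  ultimately have "\<forall>\<^sub>F n in sequentially. real n * (q / real d) ^ n < 1 / real d"
    by (rule order_tendstoD)
  then obtain n0 where n0: "\<And>n. n \<ge> n0 \<Longrightarrow> real n * (q / real d) ^ n < 1 / real d"
    unfolding eventually_sequentially by blast
  define k where "k = max n0 1"
  have k: "k \<ge> 1" and "real k * (q / real d) ^ k < 1 / real d" using n0[of k] by (auto simp: k_def)
  then have "real (k * d) * q ^ k \<le> real d ^ k"
    using q by (simp add: field_simps)
  then have "(real (k * d) * q ^ k) ^ d \<le> (real d ^ k) ^ d"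
    using q by (intro power_mono) auto
  then have "real (k * d) ^ d * q ^ (k * d) \<le> real (d ^ (k * d))"
    by (simp add: power_mult_distrib power_mult)
  also have "\<dots> \<le> real (card (permutations_of_multiset (balanced_mset d k)) * (k * d) ^ d)"
    using power_le_card_balanced_words[OF k, of d] by (simp only: of_nat_le_iff)
  finally have "real (k * d) ^ d * q ^ (k * d)
      \<le> real (k * d) ^ d * real (card (permutations_of_multiset (balanced_mset d k)))"
    by (simp add: mult_ac)
  moreover have "0 < real (k * d) ^ d" using k q by simp
  ultimately have "q ^ (k * d) \<le> real (card (permutations_of_multiset (balanced_mset d k)))"
    by (simp only: mult_le_cancel_left_pos)
  then show ?thesis using k by blast
qed

context fin_dim_graded_algebra
begin

lemma gr_codim_le_power:
  assumes "n \<ge> 1"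
  shows "real (gr_codim n) \<le> real dimension * real dimension ^ n"
proof -
  have "gr_codim n \<le> card ({1..n} \<rightarrow>\<^sub>E Basis) * card Basis"
    using finite_Basis by (intro gr_codim_le[OF assms finite_Basis span_Basis]) (auto intro: finite_PiE)
  also have "\<dots> = dimension * dimension ^ n"
    by (simp add: card_PiE dimension_def)
  finally show ?thesis by (metis of_nat_le_iff of_nat_mult of_nat_power)
qed

text \<open>
  Write \<open>n = 2 k d s + r\<close>, where \<open>r\<close> is bounded but large enough to accommodate the alternating map;
  the remaining \<open>2 k d s\<close> arguments are paired by the trace form along \<open>separated_bijections_exist\<close>.
\<close>

lemma gr_codim_ge_power:
  assumes closed: "\<And>p :: 'f poly. degree p > 0 \<Longrightarrow> \<exists>c. poly p c = 0"
    and char0: "\<And>n. of_nat n = (0 :: 'f) \<Longrightarrow> n = 0" and simple: graded_simple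
    and q: "0 < q" "q < real dimension"
  shows "\<exists>C>0. \<forall>\<^sub>F n in sequentially. C * q ^ n \<le> real (gr_codim n)"
proof -
  let ?d = dimension
  have d: "?d \<ge> 1" using q by (cases ?d) auto
  obtain k where k: "k \<ge> 1" "q ^ (k * ?d) \<le> real (card (permutations_of_multiset (balanced_mset ?d k)))"
    using power_le_card_balanced_words_real[OF q] by blast
  define M where "M = card (permutations_of_multiset (balanced_mset ?d k))"
  from alternating_map_exists_card[OF closed char0 simple d] obtain r0 where
    r0: "\<forall>r\<ge>r0. \<exists>J \<Phi> a. finite J \<and> card J = r \<and> {..<?d} \<subseteq> J \<and> \<Phi> \<in> multilinear_maps J \<and>
      alternating_on {..<?d} \<Phi> \<and> \<Phi> a \<noteq> 0" ..
  have bound: "M ^ (2 * s + 1 - ?d) \<le> gr_codim (2 * (k * ?d * s) + r)" if s: "s \<ge> ?d" and r: "r \<ge> r0" for s r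
  proof -
    obtain J \<Phi> a where J: "finite J" "card J = r" "{..<?d} \<subseteq> J" "\<Phi> \<in> multilinear_maps J"
      "alternating_on {..<?d} \<Phi>" "\<Phi> a \<noteq> 0"
      using r0[rule_format, OF r] by (elim exE conjE)
    have "0 \<in> J" using J(3) d by (auto simp: subset_iff)
    then have ne: "J \<noteq> {}" by blast
    from separated_bijections_exist[OF d s, of k] obtain Fam where
      Fam: "finite Fam" "M ^ (2 * s + 1 - ?d) \<le> card Fam"
        "\<forall>(u, v, \<pi>)\<in>Fam. bij_betw \<pi> {..<k * ?d * s} {..<k * ?d * s} \<and>
          (\<forall>p<k * ?d * s. u p < ?d \<and> v p < ?d \<and> u p = v (\<pi> p))"
        "\<forall>(u, v, \<pi>)\<in>Fam. \<forall>(u', v', \<pi>')\<in>Fam. (u, v, \<pi>) \<noteq> (u', v', \<pi>') \<longrightarrow> (\<exists>p<k * ?d * s. u' p \<noteq> v' (\<pi> p))"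
      unfolding M_def by (elim exE conjE)
    have "card Fam \<le> gr_codim (2 * (k * ?d * s) + card J)"
    proof (rule card_le_gr_codim[OF trace_form_nondegenerate[OF char0 simple] J(1,3) ne J(4,5,6) Fam(1)])
      fix u v \<pi> assume x: "(u, v, \<pi>) \<in> Fam"
      note y = Fam(3)[rule_format, OF x, unfolded prod.case]
      show "bij_betw \<pi> {..<k * ?d * s} {..<k * ?d * s}" using y by blast
      show "u p < ?d \<and> v p < ?d" "u p = v (\<pi> p)" if "p < k * ?d * s" for p using y that by blast+
      show "\<exists>p<k * ?d * s. u' p \<noteq> v' (\<pi> p)"
        if "(u', v', \<pi>') \<in> Fam" "(u, v, \<pi>) \<noteq> (u', v', \<pi>')" for u' v' \<pi>'
        using bspec[OF Fam(4) x, unfolded prod.case, THEN bspec, OF that(1)] that(2) by simp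
    qed
    then show ?thesis using Fam(2) J(2) by simp
  qed
  define W where "W = 2 * (k * ?d)"
  define c where "c = r0 + W + k * ?d * ?d"
  have W: "W > 0" using k d by (simp add: W_def)
  have "q ^ n \<le> max 1 q ^ c * real (gr_codim n)" if n: "n \<ge> r0 + W * ?d" for n
  proof -
    define s where "s = (n - r0) div W"
    define r where "r = n - W * s"
    have s: "s \<ge> ?d" using n W by (simp add: s_def less_eq_div_iff_mult_less_eq mult.commute)
    have Ws: "W * s \<le> n - r0" "n - r0 < W * s + W"
      using W by (simp_all add: s_def) (metis dividend_less_times_div mult.commute add.commute)
    have r: "r \<ge> r0" and nr: "n = 2 * (k * ?d * s) + r"
      using Ws n by (auto simp: r_def W_def)
    \<comment> \<open>the count of bijections is at least \<open>q ^ E\<close>, and \<open>n - E\<close> is bounded\<close>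
    define E where "E = k * ?d * (2 * s + 1 - ?d)"
    have "k * ?d * (2 * s + 1 - ?d) + k * ?d * ?d = k * ?d * (2 * s + 1)"
      using s by (simp add: add_mult_distrib2[symmetric])
    then have E1: "E + k * ?d * ?d = W * s + k * ?d" by (simp add: E_def W_def algebra_simps)
    have "k * ?d \<le> k * ?d * ?d" using d by simp
    then have "E \<le> n" "n \<le> E + c" using E1 Ws n unfolding c_def by linarith+
    then have "q ^ n \<le> max 1 q ^ c * q ^ E" by (rule power_shift_le[OF q(1)])
    also have "q ^ E = (q ^ (k * ?d)) ^ (2 * s + 1 - ?d)" by (simp only: E_def power_mult)
    also have "\<dots> \<le> real M ^ (2 * s + 1 - ?d)"
      using k(2) q(1) unfolding M_def by (intro power_mono) auto
    also have "\<dots> \<le> real (gr_codim n)"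
      using bound[OF s r] unfolding nr by (metis of_nat_le_iff of_nat_power)
    finally show ?thesis by (simp add: mult_left_mono)
  qed
  then have "\<forall>\<^sub>F n in sequentially. (1 / max 1 q ^ c) * q ^ n \<le> real (gr_codim n)"
    by (intro eventually_sequentiallyI[of "r0 + W * ?d"]) (simp add: field_simps)
  moreover have "1 / max 1 q ^ c > 0" by simp
  ultimately show ?thesis by blast
qed

theorem gr_PI_exponent_of_graded_simple:
  assumes closed: "\<And>p :: 'f poly. degree p > 0 \<Longrightarrow> \<exists>c. poly p c = 0"
    and char0: "\<And>n. of_nat n = (0 :: 'f) \<Longrightarrow> n = 0" and simple: graded_simple
    and d: "dimension \<ge> 1"
  shows "has_gr_PI_exponent (real dimension)"
  unfolding has_gr_PI_exponent_def
proof (rule order_tendstoI)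
  fix b assume b: "b < real dimension"
  define q where "q = (max 0 b + real dimension) / 2"
  have q: "0 < q" "q < real dimension" "b < q" using b d by (auto simp: q_def)
  obtain C where C: "C > 0" "\<forall>\<^sub>F n in sequentially. C * q ^ n \<le> real (gr_codim n)"
    using gr_codim_ge_power[OF closed char0 simple q(1,2)] by blast
  have "(\<lambda>n. root n (C * q ^ n)) \<longlonglongrightarrow> q"
    using C(1) q(1) by (intro root_power_bound_tendsto) auto
  then have "\<forall>\<^sub>F n in sequentially. b < root n (C * q ^ n)" using q(3) by (rule order_tendstoD)
  moreover have "\<forall>\<^sub>F n in sequentially. n > 0" by (rule eventually_gt_at_top)
  ultimately show "\<forall>\<^sub>F n in sequentially. b < root n (real (gr_codim n))"
    using C(2)
  proof eventually_elim
    case (elim n)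
    then show ?case using real_root_le_mono[of n "C * q ^ n" "real (gr_codim n)"] by linarith
  qed
next
  fix b assume b: "real dimension < b"
  have "(\<lambda>n. root n (real dimension * real dimension ^ n)) \<longlonglongrightarrow> real dimension"
    using d by (intro root_power_bound_tendsto) auto
  then have "\<forall>\<^sub>F n in sequentially. root n (real dimension * real dimension ^ n) < b"
    using b by (rule order_tendstoD)
  moreover have "\<forall>\<^sub>F n in sequentially. n > 0" by (rule eventually_gt_at_top)
  ultimately show "\<forall>\<^sub>F n in sequentially. root n (real (gr_codim n)) < b"
  proof eventually_elim
    case (elim n)
    then show ?case
      using real_root_le_mono[of n "real (gr_codim n)" "real dimension * real dimension ^ n"]
        gr_codim_le_power[of n] by linarith
  qed
qed

end

theorem theorem22:
  fixes scale :: "'f::{alg_closed_field, field_char_0} \<Rightarrow> 'a::ring \<Rightarrow> 'a"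
    and \<Gamma> :: "'g::ab_group_add \<Rightarrow> 'a set"
  assumes "graded_algebra scale \<Gamma>"
    and "\<exists>B. finite B \<and> module.span scale B = UNIV"
    and "(UNIV :: 'a set) \<noteq> {0}"
  shows "graded_algebra.has_gr_PI_exponent scale \<Gamma> (real (vector_space.dim scale UNIV)) \<longleftrightarrow>
         graded_algebra.graded_simple scale \<Gamma>"
proof -
  interpret A: graded_algebra scale \<Gamma> by fact
  obtain B0 where B0: "finite B0" "A.span B0 = UNIV" using assms(2) by blast
  obtain B where B: "B \<subseteq> B0" "A.independent B" "B0 \<subseteq> A.span B"
    using A.maximal_independent_subset by blast
  have "finite B" using B(1) B0(1) by (rule finite_subset)
  moreover have "A.span B = UNIV"
    using A.span_mono[OF B(3)] B0(2) by (simp add: A.span_span top_le)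
  ultimately interpret A: fin_dim_graded_algebra scale \<Gamma> B
    using B(2) by unfold_locales
  have dim: "A.dim UNIV = A.dimension"
    by (simp add: A.dimension_def)
  have char0: "n = 0" if "of_nat n = (0 :: 'f)" for n using that by simp
  have "B \<noteq> {}" using \<open>A.span B = UNIV\<close> assms(3) by auto
  then have d: "A.dimension \<ge> 1"
    using \<open>finite B\<close> by (simp add: A.dimension_def Suc_le_eq card_gt_0_iff)
  show ?thesis
    unfolding dim
    using A.gr_PI_exponent_of_graded_simple[OF alg_closed_imp_poly_has_root char0 _ d]
      A.gr_PI_exponent_less_of_not_graded_simple[OF char0 assms(3)]
    by blast
qed

end
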